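(* Let $N\ge3$ be odd, $\alpha\in\{-1,1\}$, $\rho>0$, and define $$\Delta_{\rm odd}=-\alpha\Big(\rho\jmath'(\rho)+\tfrac12\rho^2\jmath''(\rho)\Big).$$ If $\Delta_{\rm odd}>0$, then the $2\pi/\rho$-periodic traveling wave $u(x,t)=\eta(a)(\rho(x-c(a)t))$ of $u_t+(\mathcal Ju+\alpha u^N)_x=0$ of sufficiently small amplitude $a$ is susceptible to the modulational (Benjamin-Feir) instability.
   Context: Equation. $u_t+(\mathcal J u+\alpha u^N)_x=0$, $u$ real valued, $N\ge2$ an integer, $\alpha\in\{-1,1\}$. $\mathcal J$ is the Fourier multiplier $\widehat{\mathcal Jf}(k)=\jmath(k)\hat f(k)$, where $\jmath$ satisfies: (H1) $\jmath$ is real valued, even, $\jmath(0)=1$; (H2) there are constants $C_1,C_2>0$ and $\sigma\ge-1$ with $C_1k^\sigma\le\jmath(k)\le C_2k^\sigma$ for $k\gg1$; (H3) for each fixed integer $n\ge0$, $n\ne1$, $\jmath(kn)-\jmath(k)\ne0$ for $k>0$. Notation. $\mathbb T=\mathbb R/2\pi\mathbb Z$, $s=\max(1,1+\sigma)$, $\langle f,g\rangle=\frac1\pi\int_0^{2\pi}f\bar g\,dz$. For $\rho>0$, $\mathcal J_\rho e^{inz}=\jmath(\rho n)e^{inz}$, $\mathcal D_\rho=\jmath(\rho)-\mathcal J_\rho$; $\mathcal D_\rho^{-1}$ is its inverse on the closed span of $\{e^{inz}:n\ne\pm1\}$. Small-amplitude waves. For $|a|$ small, $\eta=\eta(a)(z)$,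 $c=c(a)$ denote the family, analytic in $a$, of smooth even $2\pi$-periodic solutions of $\mathcal J_\rho\eta-c\eta+\alpha\eta^N=0$ with $\eta=a\cos z+a^N\eta_N+O(a^{N+1})$, $c=\jmath(\rho)+a^\tau c_\tau+O(a^{\tau+1})$; for $N$ odd $\tau=N-1$, $c_\tau=\alpha\langle\cos^Nz,\cos z\rangle$, $\eta_N=\alpha\mathcal D_\rho^{-1}(\cos^Nz-\langle\cos^Nz,\cos z\rangle\cos z)$. Linearization. Perturbations $e^{\lambda\rho t}e^{i\mu z}\tilde\psi(z)$ in the frame $z=\rho(x-ct)$, with $\tilde\psi$ $2\pi$-periodic and Floquet exponent $\mu\in(-1/2,1/2]$, lead to $\lambda\tilde\psi=\mathcal Q_{a,\mu}\tilde\psi$, with $\mathcal Q_{a,\mu}:H^s(\mathbb T)\to L^2(\mathbb T)$, $\mathcal Q_{a,\mu}=(\partial_z+i\mu)\circ(c-e^{-i\mu z}\mathcal J_\rho e^{i\mu z}-N\alpha\eta^{N-1})$. It is assumed that $\mathcal Q_{a,\mu}$ depends analytically on $(a,\mu)$ near $(0,0)$ (in particular $\jmath$ is smooth where its derivatives are evaluated). For small $a,\mu$ exactly three eigenvalues (with multiplicity) of $\mathcal Q_{a,\mu}$ lie near $0$, continuing the triple eigenvalue $0$ of $\mathcal Q_{0,0}$. The wave is susceptible to the modulational (Benjamin-Feir) instability if there is a range (nonempty open interval) of small Floquet exponents $\mu$ for which one of these three eigenvalues near $0$ has positive real part. *)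

theory Defs
  imports "HOL-Analysis.Analysis" "HOL-Library.Landau_Symbols"
begin

section \<open>Functions on the circle\<close>

text \<open>Functions on the circle of length \<open>2\<pi>\<close> are \<open>2\<pi>\<close>-periodic functions on the real line.\<close>

definition fourier_coeff :: "(real \<Rightarrow> complex) \<Rightarrow> int \<Rightarrow> complex" where
  "fourier_coeff f n = integral {0..2*pi} (\<lambda>z. f z * cis (- (of_int n * z))) / (2 * pi)"

text \<open>
  An element of \<open>L\<^sup>2\<close> of the circle is represented by its sequence of Fourier coefficients, a square
  summable family over the integers (Parseval; the constant factor in the norm is irrelevant here).
\<close>

definition L2_space :: "(int \<Rightarrow> complex) set" where
  "L2_space = {f. (\<lambda>n. (cmod (f n))\<^sup>2) summable_on UNIV}"

definition L2_norm :: "(int \<Rightarrow> complex) \<Rightarrow> real" where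
  "L2_norm f = sqrt (\<Sum>\<^sub>\<infinity>n. (cmod (f n))\<^sup>2)"

text \<open>
  The Sobolev space \<open>H\<^sup>s\<close> is only used for \<open>s \<ge> 1\<close>. Each of its elements then has exactly one continuous
  representative, and that representative is used.
\<close>

definition sobolev :: "real \<Rightarrow> (real \<Rightarrow> complex) set" where
  "sobolev s = {f. continuous_on UNIV f \<and> (\<forall>z. f (z + 2*pi) = f z) \<and>
     (\<lambda>n::int. (1 + (of_int n)\<^sup>2) powr s * (cmod (fourier_coeff f n))\<^sup>2) summable_on UNIV}"

definition sobolev_norm :: "real \<Rightarrow> (real \<Rightarrow> complex) \<Rightarrow> real" where
  "sobolev_norm s f =
     sqrt (\<Sum>\<^sub>\<infinity>n::int. (1 + (of_int n)\<^sup>2) powr s * (cmod (fourier_coeff f n))\<^sup>2)"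

text \<open>The pairing \<open>1/\<pi> \<integral> f g\<close>; it is only applied to real functions, so no conjugation is needed.\<close>

definition circle_inner :: "(real \<Rightarrow> real) \<Rightarrow> (real \<Rightarrow> real) \<Rightarrow> real" where
  "circle_inner f g = 1 / pi * integral {0..2*pi} (\<lambda>z. f z * g z)"

text \<open>\<open>g\<close> is the image of \<open>f\<close> under the multiplier \<open>exp (i n z) \<mapsto> m n * exp (i n z)\<close>.\<close>

definition is_multiplier_image ::
    "(int \<Rightarrow> real) \<Rightarrow> (real \<Rightarrow> complex) \<Rightarrow> (real \<Rightarrow> complex) \<Rightarrow> bool" where
  "is_multiplier_image m f g \<longleftrightarrow> (\<forall>n. fourier_coeff g n = of_real (m n) * fourier_coeff f n)"

section \<open>The small-amplitude waves\<close>

definition sobolev_exponent :: "real \<Rightarrow> real" where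
  "sobolev_exponent \<sigma> = max 1 (1 + \<sigma>)"

text \<open>The symbol of \<open>D\<^sub>\<rho> = j(\<rho>) - J\<^sub>\<rho>\<close>.\<close>

definition D_symbol :: "(real \<Rightarrow> real) \<Rightarrow> real \<Rightarrow> int \<Rightarrow> real" where
  "D_symbol j \<rho> n = j \<rho> - j (\<rho> * of_int n)"

text \<open>
  \<open>D\<^sub>\<rho>\<close> has a bounded inverse on the closed span of \<open>{exp (i n z). n \<noteq> \<plusminus>1}\<close> in \<open>L\<^sup>2\<close>. Injectivity there is
  hypothesis (H3); bounded invertibility could fail only if \<open>j(\<rho> n)\<close> accumulated at \<open>j(\<rho>)\<close> as \<open>n\<close> grows,
  in which case zero would not be an isolated point of the spectrum of the linearization.
\<close>

definition noncritical_modes :: "(int \<Rightarrow> complex) set" where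
  "noncritical_modes = {f \<in> L2_space. f 1 = 0 \<and> f (-1) = 0}"

definition D_invertible :: "(real \<Rightarrow> real) \<Rightarrow> real \<Rightarrow> bool" where
  "D_invertible j \<rho> \<longleftrightarrow> (\<exists>K. \<forall>f\<in>noncritical_modes. \<exists>g\<in>noncritical_modes.
     (\<forall>n. of_real (D_symbol j \<rho> n) * g n = f n) \<and> L2_norm g \<le> K * L2_norm f)"

definition D_inverse :: "(real \<Rightarrow> real) \<Rightarrow> real \<Rightarrow> (real \<Rightarrow> complex) \<Rightarrow> real \<Rightarrow> complex" where
  "D_inverse j \<rho> f z =
     (\<Sum>\<^sub>\<infinity>n\<in>- {1, -1}. fourier_coeff f n / of_real (D_symbol j \<rho> n) * cis (of_int n * z))"

definition c_tau :: "nat \<Rightarrow> real \<Rightarrow> real" where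
  "c_tau N \<alpha> = \<alpha> * circle_inner (\<lambda>z. cos z ^ N) cos"

definition eta_N :: "(real \<Rightarrow> real) \<Rightarrow> real \<Rightarrow> nat \<Rightarrow> real \<Rightarrow> real \<Rightarrow> complex" where
  "eta_N j \<rho> N \<alpha> z = of_real \<alpha> *
     D_inverse j \<rho>
       (\<lambda>y. of_real (cos y ^ N - circle_inner (\<lambda>x. cos x ^ N) cos * cos y)) z"

text \<open>
  A smooth even \<open>2\<pi>\<close>-periodic solution of \<open>J\<^sub>\<rho> \<eta> - c \<eta> + \<alpha> \<eta>\<^sup>N = 0\<close>, that is, the profile of the wave
  \<open>u(x,t) = \<eta>(\<rho> (x - c t))\<close>.
\<close>

definition wave_profile ::
    "(real \<Rightarrow> real) \<Rightarrow> real \<Rightarrow> nat \<Rightarrow> real \<Rightarrow> (real \<Rightarrow> real) \<Rightarrow> real \<Rightarrow> bool" where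
  "wave_profile j \<rho> N \<alpha> \<eta> c \<longleftrightarrow>
     (\<forall>k z. (deriv ^^ k) \<eta> field_differentiable at z) \<and>
     (\<forall>z. \<eta> (- z) = \<eta> z) \<and> (\<forall>z. \<eta> (z + 2*pi) = \<eta> z) \<and>
     is_multiplier_image (\<lambda>n. j (\<rho> * of_int n))
       (\<lambda>z. of_real (\<eta> z)) (\<lambda>z. of_real (c * \<eta> z - \<alpha> * \<eta> z ^ N))"

text \<open>
  The branch of waves for odd \<open>N\<close> (so that \<open>\<tau> = N - 1\<close>). Analyticity in \<open>a\<close> and the remainder of \<open>\<eta>\<close> are
  understood in \<open>H\<^sup>s\<close>. The parameter \<open>a\<close> ranges over a neighbourhood of zero; values of \<open>\<eta>\<close> and \<open>c\<close>
  elsewhere are unconstrained.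
\<close>

definition small_amplitude_family ::
    "(real \<Rightarrow> real) \<Rightarrow> real \<Rightarrow> real \<Rightarrow> nat \<Rightarrow> real \<Rightarrow> (real \<Rightarrow> real \<Rightarrow> real) \<Rightarrow> (real \<Rightarrow> real) \<Rightarrow> bool" where
  "small_amplitude_family j \<sigma> \<rho> N \<alpha> \<eta> c \<longleftrightarrow>
     (\<exists>\<delta>>0.
        (\<forall>a. \<bar>a\<bar> < \<delta> \<longrightarrow> wave_profile j \<rho> N \<alpha> (\<eta> a) (c a)) \<and>
        (\<exists>e :: nat \<Rightarrow> real \<Rightarrow> complex. (\<forall>k. e k \<in> sobolev (sobolev_exponent \<sigma>)) \<and>
           (\<forall>a. \<bar>a\<bar> < \<delta> \<longrightarrow> (\<lambda>z. of_real (\<eta> a z)) \<in> sobolev (sobolev_exponent \<sigma>) \<and>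
             (\<lambda>n. sobolev_norm (sobolev_exponent \<sigma>)
                (\<lambda>z. of_real (\<eta> a z) - (\<Sum>k<n. of_real (a ^ k) * e k z))) \<longlonglongrightarrow> 0)) \<and>
        (\<exists>b :: nat \<Rightarrow> real. \<forall>a. \<bar>a\<bar> < \<delta> \<longrightarrow> (\<lambda>k. b k * a ^ k) sums c a)) \<and>
     (\<lambda>a. sobolev_norm (sobolev_exponent \<sigma>)
        (\<lambda>z. of_real (\<eta> a z) - of_real (a * cos z) - of_real (a ^ N) * eta_N j \<rho> N \<alpha> z))
       \<in> O[at 0](\<lambda>a. a ^ (N + 1)) \<and>
     (\<lambda>a. c a - j \<rho> - a ^ (N - 1) * c_tau N \<alpha>) \<in> O[at 0](\<lambda>a. a ^ N)"

section \<open>The linearized operators\<close>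

text \<open>
  The Fourier coefficients of
  \<open>(\<partial>\<^sub>z + i \<mu>) (c \<psi> - exp (-i \<mu> z) J\<^sub>\<rho> (exp (i \<mu> z) \<psi>) - N \<alpha> \<eta>\<^bsup>N-1\<^esup> \<psi>)\<close>; conjugation by
  \<open>exp (i \<mu> z)\<close> shifts the frequency \<open>n\<close> to \<open>n + \<mu>\<close>.
\<close>

definition Q_op :: "(real \<Rightarrow> real) \<Rightarrow> real \<Rightarrow> nat \<Rightarrow> real \<Rightarrow> (real \<Rightarrow> real) \<Rightarrow> real \<Rightarrow> real
    \<Rightarrow> (real \<Rightarrow> complex) \<Rightarrow> int \<Rightarrow> complex" where
  "Q_op j \<rho> N \<alpha> \<eta> c \<mu> \<psi> n =
     \<i> * of_real (of_int n + \<mu>) *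
       (of_real (c - j (\<rho> * (of_int n + \<mu>))) * fourier_coeff \<psi> n
        - of_real (real N * \<alpha>) * fourier_coeff (\<lambda>z. of_real (\<eta> z ^ (N - 1)) * \<psi> z) n)"

text \<open>\<open>A\<close> is a linear operator from \<open>H\<^sup>s\<close> to \<open>L\<^sup>2\<close> with operator norm at most \<open>K\<close>.\<close>

definition bounded_op :: "real \<Rightarrow> real \<Rightarrow> ((real \<Rightarrow> complex) \<Rightarrow> int \<Rightarrow> complex) \<Rightarrow> bool" where
  "bounded_op s K A \<longleftrightarrow>
     (\<forall>f\<in>sobolev s. \<forall>g\<in>sobolev s. \<forall>u v. \<forall>n.
        A (\<lambda>z. u * f z + v * g z) n = u * A f n + v * A g n) \<and>
     (\<forall>f\<in>sobolev s. A f \<in> L2_space \<and> L2_norm (A f) \<le> K * sobolev_norm s f)"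

text \<open>
  \<open>Q\<close> is given near \<open>(0,0)\<close> by a power series in \<open>(a,\<mu>)\<close> whose coefficients are bounded operators. By the
  geometric bound on their norms the series converges in operator norm, so identifying its sum
  coefficientwise identifies it as an operator.
\<close>

definition analytic_at_origin ::
    "real \<Rightarrow> (real \<Rightarrow> real \<Rightarrow> (real \<Rightarrow> complex) \<Rightarrow> int \<Rightarrow> complex) \<Rightarrow> bool" where
  "analytic_at_origin s Q \<longleftrightarrow>
     (\<exists>A :: nat \<Rightarrow> nat \<Rightarrow> (real \<Rightarrow> complex) \<Rightarrow> int \<Rightarrow> complex. \<exists>K. \<exists>r>0.
        (\<forall>k l. bounded_op s (K / r ^ (k + l)) (A k l)) \<and>
        (\<forall>a \<mu>. \<bar>a\<bar> < r \<longrightarrow> \<bar>\<mu>\<bar> < r \<longrightarrow> (\<forall>\<psi>\<in>sobolev s. \<forall>n.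
           ((\<lambda>(k, l). of_real (a ^ k * \<mu> ^ l) * A k l \<psi> n) has_sum Q a \<mu> \<psi> n) UNIV)))"

definition is_eigenvalue ::
    "real \<Rightarrow> ((real \<Rightarrow> complex) \<Rightarrow> int \<Rightarrow> complex) \<Rightarrow> complex \<Rightarrow> bool" where
  "is_eigenvalue s A \<nu> \<longleftrightarrow>
     (\<exists>\<psi>\<in>sobolev s. (\<exists>z. \<psi> z \<noteq> 0) \<and> (\<forall>n. A \<psi> n = \<nu> * fourier_coeff \<psi> n))"

section \<open>Modulational instability\<close>

text \<open>
  \<open>Q \<mu>\<close> is the linearized operator of one wave with Floquet exponent \<open>\<mu>\<close>; an exponent is small if
  \<open>\<bar>\<mu>\<bar> < \<epsilon>\<close>, an eigenvalue is near zero if its modulus is less than \<open>\<epsilon>\<close>.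
\<close>

definition modulationally_unstable_within ::
    "real \<Rightarrow> real \<Rightarrow> (real \<Rightarrow> (real \<Rightarrow> complex) \<Rightarrow> int \<Rightarrow> complex) \<Rightarrow> bool" where
  "modulationally_unstable_within s \<epsilon> Q \<longleftrightarrow>
     (\<exists>\<mu>\<^sub>1 \<mu>\<^sub>2. \<mu>\<^sub>1 < \<mu>\<^sub>2 \<and> {\<mu>\<^sub>1<..<\<mu>\<^sub>2} \<subseteq> {-1/2<..1/2} \<inter> {-\<epsilon><..<\<epsilon>} \<and>
        (\<forall>\<mu>\<in>{\<mu>\<^sub>1<..<\<mu>\<^sub>2}. \<exists>\<nu>. is_eigenvalue s (Q \<mu>) \<nu> \<and> cmod \<nu> < \<epsilon> \<and> Re \<nu> > 0))"

text \<open>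
  All waves of sufficiently small nonzero amplitude are modulationally unstable, \<open>Q a \<mu>\<close> being the
  linearized operator of the wave of amplitude \<open>a\<close>. The three eigenvalues that continue the triple
  eigenvalue zero of \<open>Q 0 0\<close> are, for small \<open>a\<close> and \<open>\<mu>\<close>, all the eigenvalues in some fixed disc about
  zero, and they tend to zero with \<open>(a,\<mu>)\<close>. Quantifying over all \<open>\<epsilon>\<close> therefore says precisely that the
  unstable eigenvalue is one of these three.
\<close>

definition small_waves_modulationally_unstable ::
    "real \<Rightarrow> (real \<Rightarrow> real \<Rightarrow> (real \<Rightarrow> complex) \<Rightarrow> int \<Rightarrow> complex) \<Rightarrow> bool" where
  "small_waves_modulationally_unstable s Q \<longleftrightarrow>
     (\<forall>\<epsilon>>0. \<exists>a\<^sub>0>0. \<forall>a. 0 < \<bar>a\<bar> \<and> \<bar>a\<bar> < a\<^sub>0 \<longrightarrow> modulationally_unstable_within s \<epsilon> (Q a))"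

definition Delta_odd :: "(real \<Rightarrow> real) \<Rightarrow> real \<Rightarrow> real \<Rightarrow> real" where
  "Delta_odd j \<rho> \<alpha> = - \<alpha> * (\<rho> * deriv j \<rho> + 1/2 * \<rho>\<^sup>2 * deriv (deriv j) \<rho>)"

end

theory Submission
  imports Defs
begin

text \<open>
  At \<open>a = 0\<close> the operator is diagonal; on the modes \<open>\<plusminus>1\<close> its eigenvalues are
  \<open>- i \<rho> j'(\<rho>) \<mu> \<mp> i P \<mu>\<^sup>2 + O(\<mu>\<^sup>3)\<close> with \<open>P = \<rho> j'(\<rho>) + \<rho>\<^sup>2 j''(\<rho>) / 2\<close>. To leading order the wave
  adds \<open>\<mp> i \<beta> a\<^bsup>N-1\<^esup>\<close> to these and couples the two modes with coefficients of the same modulus, where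
  \<open>\<beta> = \<alpha> N m\<^sub>2\<close> and \<open>m\<^sub>2 > 0\<close> is the second Fourier coefficient of \<open>cos\<^bsup>N-1\<^esup>\<close>. With \<open>b\<^sup>2 = a\<^bsup>N-1\<^esup>\<close>,
  \<open>\<mu> = \<kappa> b\<close> and \<open>\<nu> = - i \<rho> j'(\<rho>) \<mu> + b\<^sup>2 x\<close> this gives \<open>x\<^sup>2 = - P \<kappa>\<^sup>2 (P \<kappa>\<^sup>2 + 2 \<beta>)\<close> in the limit. If
  \<open>\<alpha> P < 0\<close>, the choice \<open>P \<kappa>\<^sup>2 = - \<beta>\<close> makes \<open>x = \<bar>\<beta>\<bar>\<close> a simple root, which a contraction argument on
  \<open>\<ell>\<^sup>2\<close> continues to the full operator, for all \<open>\<kappa>\<close> near the chosen one. The mode \<open>0\<close> may be resonant with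
  the modes \<open>\<plusminus>1\<close>, but its own diagonal entry is purely imaginary and its coupling to the rest carries a
  factor \<open>\<mu>\<close>, so it stays at distance at least \<open>b\<^sup>2 Re x\<close> and enters only through a small error.
\<close>

section \<open>Square summable sequences\<close>

text \<open>The expression \<open>- y * (y + 2 * \<beta>)\<close> with
  \<open>y = P * \<kappa>\<^sup>2\<close> is largest at \<open>y = - \<beta>\<close>. There the
  diagonal of the leading block vanishes, and a purely off-diagonal block with the two real
  eigenvalues \<plusminus>|\<beta>| remains. That diagonal shift and coupling have the same size
  \<beta> is a binomial identity which expresses translation invariance of the wave.

  The obstacle is a mismatch of scales. Analyticity bounds the change of the operator by a multiple
  of |a| + |\<mu>|, which is far larger than the size b^2 of the instability. This bound is
  therefore used only in the rows |n| \<ge> 2, where the unperturbed diagonal stays away from zero;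
  the rows 0 and \<plusminus>1 are computed from the operator itself, up to errors small relative to
  b^2. Analyticity of the operator enters once more at a = 0, where it supplies the second order
  expansion of j at \<rho>.

  Eigenvalue and eigenvector are solved for together, without spectral projections: only the real
  part of the eigenvalue separates it from the diagonal entry of mode 0, so no case distinction on
  resonance arises.\<close>

text \<open>Passing to finite index sets makes \<open>L2_set\<close> available, whose monotonicity
  and triangle inequality then carry all norm estimates for infinite families.\<close>

lemma L2_space_iff_bounded:
  "f \<in> L2_space \<longleftrightarrow> (\<exists>B. \<forall>F. finite F \<longrightarrow> L2_set (\<lambda>n. cmod (f n)) F \<le> B)"
proof
  assume "f \<in> L2_space"
  then have sm: "(\<lambda>n. (cmod (f n))\<^sup>2) summable_on UNIV"
    by (simp add: L2_space_def)
  have "L2_set (\<lambda>n. cmod (f n)) F \<le> L2_norm f" if "finite F" for F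
    unfolding L2_set_def L2_norm_def
    by (intro real_sqrt_le_mono finite_sum_le_infsum sm that) auto
  then show "\<exists>B. \<forall>F. finite F \<longrightarrow> L2_set (\<lambda>n. cmod (f n)) F \<le> B" by blast
next
  assume "\<exists>B. \<forall>F. finite F \<longrightarrow> L2_set (\<lambda>n. cmod (f n)) F \<le> B"
  then obtain B where B: "\<And>F. finite F \<Longrightarrow> L2_set (\<lambda>n. cmod (f n)) F \<le> B" by blast
  have *: "(\<Sum>n\<in>F. (cmod (f n))\<^sup>2) \<le> B\<^sup>2" if "finite F" for F
  proof -
    have "(\<Sum>n\<in>F. (cmod (f n))\<^sup>2) = (L2_set (\<lambda>n. cmod (f n)) F)\<^sup>2"
      by (simp add: L2_set_def sum_nonneg)
    also have "\<dots> \<le> B\<^sup>2"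
      by (intro power_mono B that L2_set_nonneg)
    finally show ?thesis .
  qed
  have "bdd_above (sum (\<lambda>n. (cmod (f n))\<^sup>2) ` {F. F \<subseteq> UNIV \<and> finite F})"
    using * by (intro bdd_aboveI2[where M = "B\<^sup>2"]) simp
  then show "f \<in> L2_space"
    unfolding L2_space_def mem_Collect_eq
    by (intro nonneg_bdd_above_summable_on) simp_all
qed

lemma L2_set_le_L2_norm:
  assumes "f \<in> L2_space" "finite F"
  shows "L2_set (\<lambda>n. cmod (f n)) F \<le> L2_norm f"
  using assms unfolding L2_set_def L2_norm_def L2_space_def
  by (intro real_sqrt_le_mono finite_sum_le_infsum) auto

lemma L2_norm_le:
  assumes "\<And>F. finite F \<Longrightarrow> L2_set (\<lambda>n. cmod (f n)) F \<le> B"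
  shows "f \<in> L2_space" "L2_norm f \<le> B"
proof -
  show f: "f \<in> L2_space"
    using assms L2_space_iff_bounded by blast
  have B0: "B \<ge> 0" using assms[of "{}"] by simp
  have "(\<Sum>n\<in>F. (cmod (f n))\<^sup>2) \<le> B\<^sup>2" if "finite F" for F
  proof -
    have "(\<Sum>n\<in>F. (cmod (f n))\<^sup>2) = (L2_set (\<lambda>n. cmod (f n)) F)\<^sup>2"
      by (simp add: L2_set_def sum_nonneg)
    also have "\<dots> \<le> B\<^sup>2"
      by (intro power_mono assms that L2_set_nonneg)
    finally show ?thesis .
  qed
  then have "(\<Sum>\<^sub>\<infinity>n. (cmod (f n))\<^sup>2) \<le> B\<^sup>2"
    using f unfolding L2_space_def by (intro infsum_le_finite_sums) auto
  then show "L2_norm f \<le> B"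
    unfolding L2_norm_def by (metis B0 real_le_lsqrt real_sqrt_le_iff real_sqrt_unique)
qed

lemma L2_norm_mono:
  assumes "f \<in> L2_space" "C \<ge> 0" "\<And>n. cmod (g n) \<le> C * cmod (f n)"
  shows "g \<in> L2_space" "L2_norm g \<le> C * L2_norm f"
proof -
  have *: "L2_set (\<lambda>n. cmod (g n)) F \<le> C * L2_norm f" if "finite F" for F
  proof -
    have "L2_set (\<lambda>n. cmod (g n)) F \<le> L2_set (\<lambda>n. C * cmod (f n)) F"
      by (intro L2_set_mono assms) auto
    also have "\<dots> = C * L2_set (\<lambda>n. cmod (f n)) F"
      using assms by (simp add: L2_set_right_distrib)
    also have "\<dots> \<le> C * L2_norm f"
      using assms that by (intro mult_left_mono L2_set_le_L2_norm)
    finally show ?thesis .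
  qed
  show "g \<in> L2_space" "L2_norm g \<le> C * L2_norm f"
    using L2_norm_le[OF *] by auto
qed

lemma L2_norm_add:
  assumes "f \<in> L2_space" "g \<in> L2_space"
  shows "(\<lambda>n. f n + g n) \<in> L2_space" "L2_norm (\<lambda>n. f n + g n) \<le> L2_norm f + L2_norm g"
proof -
  have *: "L2_set (\<lambda>n. cmod (f n + g n)) F \<le> L2_norm f + L2_norm g" if "finite F" for F
  proof -
    have "L2_set (\<lambda>n. cmod (f n + g n)) F \<le> L2_set (\<lambda>n. cmod (f n) + cmod (g n)) F"
      by (intro L2_set_mono norm_triangle_ineq) auto
    also have "\<dots> \<le> L2_set (\<lambda>n. cmod (f n)) F + L2_set (\<lambda>n. cmod (g n)) F"
      by (rule L2_set_triangle_ineq)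
    also have "\<dots> \<le> L2_norm f + L2_norm g"
      using assms that by (intro add_mono L2_set_le_L2_norm)
    finally show ?thesis .
  qed
  show "(\<lambda>n. f n + g n) \<in> L2_space" "L2_norm (\<lambda>n. f n + g n) \<le> L2_norm f + L2_norm g"
    using L2_norm_le[OF *] by auto
qed

lemma L2_norm_ge_coeff:
  assumes "f \<in> L2_space"
  shows "cmod (f n) \<le> L2_norm f"
  using L2_set_le_L2_norm[OF assms, of "{n}"] by simp

lemma L2_space_scale:
  assumes "f \<in> L2_space"
  shows "(\<lambda>n. c * f n) \<in> L2_space"
  using L2_norm_mono(1)[OF assms, of "cmod c" "\<lambda>n. c * f n"] by (simp add: norm_mult)

lemma L2_norm_scale: "L2_norm (\<lambda>n. c * f n) = cmod c * L2_norm f"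
  by (simp add: L2_norm_def norm_mult power_mult_distrib infsum_cmult_right' real_sqrt_mult)

lemma finite_support_L2_space:
  assumes "finite {n. f n \<noteq> 0}"
  shows "f \<in> L2_space"
  unfolding L2_space_def
  by (auto intro!: finite_nonzero_values_imp_summable_on simp: assms)

text \<open>The fixed point argument runs in a type of class \<open>banach\<close>, so square
  summable families are made into a type of their own.\<close>

typedef ell2 = L2_space
  morphisms coord Ell2
  by (auto intro!: exI[of _ "\<lambda>_. 0"] simp: L2_space_def)

setup_lifting type_definition_ell2

lemma coord_L2_space [simp]: "coord u \<in> L2_space"
  using coord by blast

instantiation ell2 :: real_normed_vector
begin

lift_definition zero_ell2 :: ell2 is "\<lambda>_. 0"
  by (simp add: L2_space_def)

lift_definition plus_ell2 :: "ell2 \<Rightarrow> ell2 \<Rightarrow> ell2" is "\<lambda>f g n. f n + g n"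
  by (rule L2_norm_add)

lift_definition uminus_ell2 :: "ell2 \<Rightarrow> ell2" is "\<lambda>f n. - f n"
  by (simp add: L2_space_def)

definition minus_ell2 :: "ell2 \<Rightarrow> ell2 \<Rightarrow> ell2" where
  "minus_ell2 u v = u + (- v)"

lift_definition scaleR_ell2 :: "real \<Rightarrow> ell2 \<Rightarrow> ell2" is "\<lambda>r f n. of_real r * f n"
  by (rule L2_space_scale)

lift_definition norm_ell2 :: "ell2 \<Rightarrow> real" is L2_norm .

definition sgn_ell2 :: "ell2 \<Rightarrow> ell2" where
  "sgn_ell2 u = inverse (norm u) *\<^sub>R u"

definition dist_ell2 :: "ell2 \<Rightarrow> ell2 \<Rightarrow> real" where
  "dist_ell2 u v = norm (u - v)"

definition uniformity_ell2 :: "(ell2 \<times> ell2) filter" where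
  "uniformity_ell2 = (INF e\<in>{0<..}. principal {(x, y). dist x y < e})"

definition open_ell2 :: "ell2 set \<Rightarrow> bool" where
  "open_ell2 U \<longleftrightarrow> (\<forall>x\<in>U. eventually (\<lambda>(x', y). x' = x \<longrightarrow> y \<in> U) uniformity)"

instance
proof
  fix u v w :: ell2 and r q :: real
  show "u + v + w = u + (v + w)" "u + v = v + u" "0 + u = u" "- u + u = 0"
    by (transfer, simp add: algebra_simps)+
  show "u - v = u + - v" by (simp add: minus_ell2_def)
  show "r *\<^sub>R (u + v) = r *\<^sub>R u + r *\<^sub>R v" "(r + q) *\<^sub>R u = r *\<^sub>R u + q *\<^sub>R u"
    "r *\<^sub>R q *\<^sub>R u = (r * q) *\<^sub>R u" "1 *\<^sub>R u = u"
    by (transfer, simp add: algebra_simps)+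
  show "norm (u + v) \<le> norm u + norm v"
    by transfer (rule L2_norm_add)
  show "norm (r *\<^sub>R u) = \<bar>r\<bar> * norm u"
    by transfer (simp add: L2_norm_scale)
  show "(norm u = 0) \<longleftrightarrow> (u = 0)"
  proof transfer
    fix f :: "int \<Rightarrow> complex" assume "f \<in> L2_space"
    then have le: "cmod (f n) \<le> L2_norm f" for n by (rule L2_norm_ge_coeff)
    have "f = (\<lambda>_. 0)" if "L2_norm f = 0"
    proof
      fix n show "f n = 0" using le[of n] unfolding that by simp
    qed
    moreover have "L2_norm (\<lambda>_. 0) = 0" by (simp add: L2_norm_def)
    ultimately show "(L2_norm f = 0) \<longleftrightarrow> (f = (\<lambda>_. 0))" by blast
  qed
qed (simp_all add: sgn_ell2_def dist_ell2_def uniformity_ell2_def open_ell2_def)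

end

lemma coord_zero [simp]: "coord 0 n = 0"
  and coord_add [simp]: "coord (u + v) n = coord u n + coord v n"
  and coord_uminus [simp]: "coord (- u) n = - coord u n"
  and coord_scaleR [simp]: "coord (r *\<^sub>R u) n = of_real r * coord u n"
  by (simp_all add: zero_ell2.rep_eq plus_ell2.rep_eq uminus_ell2.rep_eq scaleR_ell2.rep_eq)

lemma coord_diff [simp]: "coord (u - v) n = coord u n - coord v n"
  unfolding minus_ell2_def coord_add coord_uminus by simp

lemma norm_ell2_eq: "norm u = L2_norm (coord u)"
  by (simp add: norm_ell2.rep_eq)

lemma norm_Ell2: "f \<in> L2_space \<Longrightarrow> norm (Ell2 f) = L2_norm f"
  by (simp add: norm_ell2_eq Ell2_inverse)

lemma ell2_eqI: "(\<And>n. coord u n = coord v n) \<Longrightarrow> u = v"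
  by (metis coord_inject ext)

lemma norm_coord_le: "cmod (coord u n) \<le> norm u"
  by (simp add: norm_ell2_eq L2_norm_ge_coeff)

lemma bounded_linear_coord: "bounded_linear (\<lambda>u. coord u n)"
  by (rule bounded_linear_intro[where K = 1]) (auto simp: norm_coord_le scaleR_conv_of_real)

text \<open>Coordinatewise limits exist because the complex numbers are complete. The Cauchy
  estimate passes to these limits on each finite index set with a bound independent of the set,
  which yields both square summability of the limit and convergence in norm.\<close>

instance ell2 :: banach
proof
  fix X :: "nat \<Rightarrow> ell2"
  assume X: "Cauchy X"
  have "\<exists>l. (\<lambda>k. coord (X k) n) \<longlonglongrightarrow> l" for n
    using bounded_linear.Cauchy[OF bounded_linear_coord X] by (simp add: Cauchy_convergent convergent_def convergent_eq_Cauchy)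
  then obtain f where f: "\<And>n. (\<lambda>k. coord (X k) n) \<longlonglongrightarrow> f n" by metis
  have *: "\<exists>M. \<forall>k\<ge>M. \<forall>F. finite F \<longrightarrow> L2_set (\<lambda>n. cmod (coord (X k) n - f n)) F \<le> e"
    if "e > 0" for e
  proof -
    obtain M where M: "\<And>k m. k \<ge> M \<Longrightarrow> m \<ge> M \<Longrightarrow> norm (X k - X m) < e"
      using X \<open>e > 0\<close> unfolding Cauchy_iff by meson
    show ?thesis
    proof (intro exI[of _ M] allI impI)
      fix k and F :: "int set" assume k: "M \<le> k" and F: "finite F"
      have "(\<lambda>m. L2_set (\<lambda>n. cmod (coord (X k) n - coord (X m) n)) F)
          \<longlonglongrightarrow> L2_set (\<lambda>n. cmod (coord (X k) n - f n)) F"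
        unfolding L2_set_def by (intro tendsto_intros f)
      moreover have "\<forall>\<^sub>F m in sequentially. L2_set (\<lambda>n. cmod (coord (X k) n - coord (X m) n)) F \<le> e"
        unfolding eventually_sequentially
      proof (intro exI[of _ M] allI impI)
        fix m assume "M \<le> m"
        then show "L2_set (\<lambda>n. cmod (coord (X k) n - coord (X m) n)) F \<le> e"
          using M[of k m] k L2_set_le_L2_norm[OF coord_L2_space F, of "X k - X m"]
          by (simp add: norm_ell2_eq)
      qed
      ultimately show "L2_set (\<lambda>n. cmod (coord (X k) n - f n)) F \<le> e"
        by (rule tendsto_upperbound) simp
    qed
  qed
  obtain M where M: "\<And>F. finite F \<Longrightarrow> L2_set (\<lambda>n. cmod (coord (X M) n - f n)) F \<le> 1"
    using *[of 1] by force
  have "(\<lambda>n. coord (X M) n + (-1) * (coord (X M) n - f n)) \<in> L2_space"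
    by (intro L2_norm_add(1) L2_space_scale coord_L2_space L2_norm_le(1)[OF M])
  then have fL: "f \<in> L2_space" by simp
  have "X \<longlonglongrightarrow> Ell2 f"
  proof (rule LIMSEQ_I)
    fix r :: real assume r: "r > 0"
    obtain M where M: "\<And>k F. k \<ge> M \<Longrightarrow> finite F \<Longrightarrow> L2_set (\<lambda>n. cmod (coord (X k) n - f n)) F \<le> r / 2"
      using *[of "r / 2"] r by auto
    have "norm (X k - Ell2 f) < r" if "k \<ge> M" for k
    proof -
      have "norm (X k - Ell2 f) \<le> r / 2"
        unfolding norm_ell2_eq using fL M[OF that] by (intro L2_norm_le(2)) (simp add: Ell2_inverse)
      then show ?thesis using r by simp
    qed
    then show "\<exists>no. \<forall>n\<ge>no. norm (X n - Ell2 f) < r" by blast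
  qed
  then show "convergent X" by (auto simp: convergent_def)
qed

definition unit_at :: "int \<Rightarrow> complex \<Rightarrow> ell2" where
  "unit_at m z = Ell2 (\<lambda>n. if n = m then z else 0)"

lemma coord_unit_at [simp]: "coord (unit_at m z) n = (if n = m then z else 0)"
  unfolding unit_at_def by (subst Ell2_inverse) (auto intro: finite_support_L2_space)

lemma norm_unit_at [simp]: "norm (unit_at m z) = cmod z"
proof (rule antisym)
  show "norm (unit_at m z) \<le> cmod z"
    unfolding norm_ell2_eq
  proof (rule L2_norm_le(2))
    fix F :: "int set" assume F: "finite F"
    have "(\<Sum>n\<in>F. (cmod (coord (unit_at m z) n))\<^sup>2) = (\<Sum>n\<in>F. if n = m then (cmod z)\<^sup>2 else 0)"
      by (intro sum.cong) auto
    also have "\<dots> \<le> (cmod z)\<^sup>2"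
      using F by (subst sum.delta) auto
    finally show "L2_set (\<lambda>n. cmod (coord (unit_at m z) n)) F \<le> cmod z"
      unfolding L2_set_def by (simp add: real_le_lsqrt)
  qed
  show "cmod z \<le> norm (unit_at m z)"
    using norm_coord_le[of "unit_at m z" m] by simp
qed

text \<open>Lipschitz constant 1/2 keeps the image within r/2 of the value at 0, and that value uses
  up the other half of the radius; hence the ball is mapped into itself.\<close>

lemma contraction_fixpoint_in_ball:
  fixes \<Phi> :: "'a::banach \<Rightarrow> 'a"
  assumes "r \<ge> 0" "norm (\<Phi> 0) \<le> r / 2"
    and lip: "\<And>x y. norm x \<le> r \<Longrightarrow> norm y \<le> r \<Longrightarrow> norm (\<Phi> x - \<Phi> y) \<le> norm (x - y) / 2"
  obtains x where "norm x \<le> r" "\<Phi> x = x"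
proof -
  have "\<exists>!x\<in>cball 0 r. \<Phi> x = x"
  proof (rule Banach_fix[where c = "1/2"])
    show "complete (cball (0::'a) r)" by (simp add: closed_cball complete_eq_closed)
    show "cball (0::'a) r \<noteq> {}" using assms by auto
    show "\<Phi> ` cball 0 r \<subseteq> cball 0 r"
    proof clarify
      fix x :: 'a assume "x \<in> cball 0 r"
      then have "norm x \<le> r" by simp
      then have "norm (\<Phi> x - \<Phi> 0) \<le> r / 2" using lip[of x 0] assms by simp
      then have "norm (\<Phi> x) \<le> r" using assms norm_triangle_ineq2[of "\<Phi> x" "\<Phi> 0"] by linarith
      then show "\<Phi> x \<in> cball 0 r" by simp
    qed
  qed (use lip in \<open>auto simp: dist_norm\<close>)
  then show ?thesis using that by auto
qed

section \<open>Perturbation of a two by two block\<close>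

text \<open>\<open>Ell2\<close> is specified only on square summable families, so each use of this
  operator comes with a bound on \<open>m\<close>.\<close>

definition mult_coord :: "(int \<Rightarrow> complex) \<Rightarrow> ell2 \<Rightarrow> ell2" where
  "mult_coord m u = Ell2 (\<lambda>n. m n * coord u n)"

lemma mult_coord_bounded:
  assumes "B \<ge> 0" "\<And>n. cmod (m n) \<le> B"
  shows coord_mult_coord: "coord (mult_coord m u) n = m n * coord u n"
    and norm_mult_coord_le: "norm (mult_coord m u) \<le> B * norm u"
proof -
  have *: "(\<lambda>n. m n * coord u n) \<in> L2_space" "L2_norm (\<lambda>n. m n * coord u n) \<le> B * L2_norm (coord u)"
    using L2_norm_mono[OF coord_L2_space assms(1), of "\<lambda>n. m n * coord u n" u] assms(2)
    by (auto simp: norm_mult mult_right_mono)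
  show "coord (mult_coord m u) n = m n * coord u n" "norm (mult_coord m u) \<le> B * norm u"
    using * by (auto simp: mult_coord_def Ell2_inverse norm_Ell2 norm_ell2_eq)
qed

definition tail :: "ell2 \<Rightarrow> ell2" where
  "tail = mult_coord (\<lambda>n. if \<bar>n\<bar> \<le> 1 then 0 else 1)"

lemma coord_tail [simp]: "coord (tail u) n = (if \<bar>n\<bar> \<le> 1 then 0 else coord u n)"
  unfolding tail_def by (subst coord_mult_coord[where B = 1]) auto

lemma norm_tail_le: "norm (tail u) \<le> norm u"
  using norm_mult_coord_le[of 1 "\<lambda>n. if \<bar>n\<bar> \<le> 1 then 0 else 1" u] by (simp add: tail_def)

lemma ell2_split:
  "u = unit_at 1 (coord u 1) + unit_at (-1) (coord u (-1)) + unit_at 0 (coord u 0) + tail u"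
proof (rule ell2_eqI)
  fix n :: int
  show "coord u n =
    coord (unit_at 1 (coord u 1) + unit_at (-1) (coord u (-1)) + unit_at 0 (coord u 0) + tail u) n"
    by (cases "n = 1"; cases "n = -1"; cases "n = 0") auto
qed

lemma norm_diff_le_add:
  fixes a b :: "'a::real_normed_vector"
  assumes "norm a \<le> e" "norm b \<le> f"
  shows "norm (a - b) \<le> e + f"
  using assms norm_triangle_ineq4[of a b] by linarith

text \<open>
  The unknown \<open>t\<close> of the fixed point equation stores the correction of the eigenvalue in the otherwise
  unused slot \<open>1\<close>, since the eigenvector is normalized there; the tail is scaled by \<open>\<theta>\<close> because the rows
  \<open>\<plusminus>1\<close> depend on it with a coefficient that is bounded but not small.
\<close>

lemma perturbed_block_eigenvector:
  fixes A :: "ell2 \<Rightarrow> int \<Rightarrow> complex" and l :: "int \<Rightarrow> ell2 \<Rightarrow> complex"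
    and R :: "ell2 \<Rightarrow> ell2" and q :: "int \<Rightarrow> complex"
    and s b \<gamma> d \<sigma> \<epsilon> C c\<^sub>0 r \<theta> :: real
  assumes s: "s > 0" and \<sigma>: "\<sigma>\<^sup>2 = 1" and b: "b > 0"
    and row: "\<And>u n. n \<in> {1, -1} \<Longrightarrow> A u n = - \<i> * of_real \<gamma> * coord u n
        + of_real (b\<^sup>2) * (- \<i> * of_real (\<sigma> * s) * of_int n * coord u (- n) + l n u)"
    and row0: "\<And>u. A u 0 = \<i> * of_real d * coord u 0 + of_real (b\<^sup>2) * l 0 u"
    and rowt: "\<And>u n. \<bar>n\<bar> \<ge> 2 \<Longrightarrow> A u n = q n * (coord u n + coord (R u) n)"
    and q: "\<And>n. \<bar>n\<bar> \<ge> 2 \<Longrightarrow> cmod (q n) \<ge> c\<^sub>0" and c0: "c\<^sub>0 > 0"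
    and l_diff: "\<And>n u v. l n (u - v) = l n u - l n v"
    and R_diff: "\<And>u v. R (u - v) = R u - R v"
    and l_le: "\<And>n u. \<bar>n\<bar> \<le> 1 \<Longrightarrow> cmod (l n u) \<le> \<epsilon> * norm u + C * norm (tail u)"
    and R_le: "\<And>u. norm (R u) \<le> \<epsilon> * norm u"
    and const: "0 < r" "r \<le> s / 2" "0 < \<theta>" "\<theta> \<le> 1" "\<epsilon> \<ge> 0" "C \<ge> 0"
    and lip: "(\<epsilon> + C * \<theta> + r) / s + (2 * (\<epsilon> + C * \<theta>) + r) + (\<epsilon> + C * \<theta> + 2 * r) / s
        + ((\<bar>\<gamma>\<bar> + b\<^sup>2 * (s + 2 * r)) / c\<^sub>0 + \<epsilon> / \<theta>) \<le> 1 / 2"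
    and init: "4 * \<epsilon> / s + 4 * \<epsilon> + 2 * \<epsilon> / \<theta> \<le> r / 2"
  obtains u \<nu> where "coord u 1 = 1" "\<And>n. A u n = \<nu> * coord u n" "Re \<nu> > 0"
    "cmod \<nu> \<le> \<bar>\<gamma>\<bar> + 2 * b\<^sup>2 * s"
proof -
  define \<Lambda> where "\<Lambda> = mult_coord (\<lambda>n. if n = 1 then 0 else if \<bar>n\<bar> \<le> 1 then 1 else of_real \<theta>)"
  have \<Lambda>_bd: "cmod (if n = 1 then 0 else if \<bar>n\<bar> \<le> 1 then 1 else of_real \<theta>) \<le> 1" for n :: int
    using const by auto
  have coord_\<Lambda>: "coord (\<Lambda> t) n = (if n = 1 then 0 else if \<bar>n\<bar> \<le> 1 then 1 else of_real \<theta>) * coord t n" for t n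
    unfolding \<Lambda>_def by (rule coord_mult_coord[OF _ \<Lambda>_bd]) auto
  have norm_\<Lambda>: "norm (\<Lambda> t) \<le> norm t" for t
    unfolding \<Lambda>_def using norm_mult_coord_le[OF _ \<Lambda>_bd] by fastforce
  have tail_\<Lambda>: "norm (tail (\<Lambda> t)) \<le> \<theta> * norm t" for t
  proof -
    have "tail (\<Lambda> t) = \<theta> *\<^sub>R tail t"
      by (rule ell2_eqI) (auto simp: coord_\<Lambda>)
    then show ?thesis using norm_tail_le[of t] const by (simp add: mult_left_mono)
  qed
  have \<Lambda>_diff: "\<Lambda> x - \<Lambda> y = \<Lambda> (x - y)" for x y
    by (rule ell2_eqI) (simp add: coord_\<Lambda> algebra_simps)
  \<comment> \<open>\<open>V\<close> is the eigenvector of the limiting block for its eigenvalue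
    \<open>s\<close>: the rows read \<open>- \<i> * \<sigma> * s * (\<i> * \<sigma>) = s\<close> and
    \<open>\<i> * \<sigma> * s * 1 = s * (\<i> * \<sigma>)\<close>, because \<sigma> squares to
    1.\<close>
  define V where "V = unit_at 1 1 + unit_at (-1) (\<i> * of_real \<sigma>)"
  have \<sigma>abs: "\<bar>\<sigma>\<bar> = 1" using \<sigma> by (auto simp: power2_eq_1_iff)
  have norm_V: "norm V \<le> 2"
    unfolding V_def using norm_triangle_ineq[of "unit_at 1 1" "unit_at (-1) (\<i> * of_real \<sigma>)"]
    by (simp add: norm_mult \<sigma>abs)
  have tail_V: "tail V = 0"
    by (rule ell2_eqI) (auto simp: V_def)
  define U where "U t = V + \<Lambda> t" for t
  have U_diff: "U x - U y = \<Lambda> (x - y)" for x y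
    by (simp add: U_def \<Lambda>_diff)
  have U0: "U 0 = V"
    unfolding U_def by (auto intro: ell2_eqI simp: coord_\<Lambda>)
  define \<kappa> where "\<kappa> = \<epsilon> + C * \<theta>"
  have \<kappa>0: "\<kappa> \<ge> 0" using const by (simp add: \<kappa>_def)
  have l_\<Lambda>: "cmod (l n (\<Lambda> t)) \<le> \<kappa> * norm t" if "\<bar>n\<bar> \<le> 1" for n t
  proof -
    have "cmod (l n (\<Lambda> t)) \<le> \<epsilon> * norm (\<Lambda> t) + C * norm (tail (\<Lambda> t))" by (rule l_le[OF that])
    also have "\<dots> \<le> \<epsilon> * norm t + C * (\<theta> * norm t)"
      by (intro add_mono mult_left_mono norm_\<Lambda> tail_\<Lambda> const)
    finally show ?thesis by (simp add: \<kappa>_def algebra_simps)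
  qed
  have l_U_diff: "cmod (l n (U x) - l n (U y)) \<le> \<kappa> * norm (x - y)" if "\<bar>n\<bar> \<le> 1" for n x y
    unfolding l_diff[symmetric] U_diff by (rule l_\<Lambda>[OF that])
  have l_V: "cmod (l n V) \<le> 2 * \<epsilon>" if "\<bar>n\<bar> \<le> 1" for n
    using l_le[OF that, of V] mult_left_mono[OF norm_V \<open>\<epsilon> \<ge> 0\<close>] by (simp add: tail_V)

  \<comment> \<open>With \<open>x\<close> the correction in slot 1, subtracting the diagonal entry
    \<open>\<i> * d\<close> from the eigenvalue and dividing by b^2 leaves \<open>D + x\<close>. The
    real part \<open>s\<close> of \<open>D\<close> does not see \<gamma> and d, so \<open>D\<close>
    is bounded below even at resonance.\<close>
  define D where "D = of_real s - \<i> * of_real ((\<gamma> + d) / b\<^sup>2)"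
  have D: "cmod D \<ge> s"
    using complex_Re_le_cmod[of D] by (simp add: D_def)
  have D_nz: "D \<noteq> 0" using D s by auto
  define \<nu> where "\<nu> t = - \<i> * of_real \<gamma> + of_real (b\<^sup>2) * (of_real s + coord t 1)" for t
  \<comment> \<open>Write x and y for the slots 1 and -1 of t. Row 1 becomes
    \<open>x = l 1 u - \<i> * \<sigma> * s * y\<close>, row -1 becomes
    \<open>\<i> * \<sigma> * x + s * y + x * y = l (-1) u\<close>. Inserting the first into the
    linear term of the second gives the formula for y. The divisor 2 s is the gap between the roots
    s and -s of the block, so simplicity of the root is what makes it solvable.\<close>
  define Y where "Y t = (l (-1) (U t) - \<i> * of_real \<sigma> * l 1 (U t) - coord t 1 * coord t (-1)) / of_real (2 * s)" for t
  define X where "X t = l 1 (U t) - \<i> * of_real (\<sigma> * s) * Y t" for t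
  define Z where "Z t = (l 0 (U t) - coord t 1 * coord t 0) / D" for t
  define G where "G = mult_coord (\<lambda>n. if \<bar>n\<bar> \<le> 1 then 0 else 1 / q n)"
  have G_bd: "cmod (if \<bar>n\<bar> \<le> 1 then 0 else 1 / q n) \<le> 1 / c\<^sub>0" for n
    using q[of n] c0 by (auto simp: norm_divide intro!: frac_le)
  have coord_G: "coord (G u) n = (if \<bar>n\<bar> \<le> 1 then 0 else 1 / q n) * coord u n" for u n
    unfolding G_def using c0 by (intro coord_mult_coord[OF _ G_bd]) auto
  have norm_G: "norm (G u) \<le> norm u / c\<^sub>0" for u
    unfolding G_def using c0 norm_mult_coord_le[OF _ G_bd, where u = u] by simp
  define cs where "cs z = mult_coord (\<lambda>_. z)" for z
  have coord_cs: "coord (cs z u) n = z * coord u n" for z u n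
    unfolding cs_def by (rule coord_mult_coord[of "cmod z"]) auto
  have norm_cs: "norm (cs z u) \<le> cmod z * norm u" for z u
    unfolding cs_def by (rule norm_mult_coord_le) auto
  \<comment> \<open>The tail rows read
    \<open>q n * (\<theta> * t n + R u n) = \<nu> * \<theta> * t n\<close>; solving for the slot of
    t puts 1/\<theta> in front of the remainder. This is affordable as long as \<epsilon> is small
    compared with \<theta>.\<close>
  define W where "W t = G (cs (\<nu> t) t) - (1 / \<theta>) *\<^sub>R tail (R (U t))" for t
  define \<Phi> where "\<Phi> t = unit_at 1 (X t) + unit_at (-1) (Y t) + unit_at 0 (Z t) + W t" for t
  have coord_W: "coord (W t) n = 0" if "\<bar>n\<bar> \<le> 1" for t n
    using that by (simp add: W_def coord_G)
  have \<Phi>1: "coord (\<Phi> t) 1 = X t" and \<Phi>m: "coord (\<Phi> t) (-1) = Y t" and \<Phi>0: "coord (\<Phi> t) 0 = Z t"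
    and \<Phi>t: "\<bar>n\<bar> \<ge> 2 \<Longrightarrow> coord (\<Phi> t) n = \<nu> t / q n * coord t n - coord (R (U t)) n / of_real \<theta>" for t n
    using coord_W[of 1] coord_W[of "-1"] coord_W[of 0]
    by (auto simp: \<Phi>_def W_def coord_G coord_cs divide_simps)
  have prod_diff: "cmod (coord x m * coord x n - coord y m * coord y n) \<le> 2 * r * norm (x - y)"
    if "norm x \<le> r" "norm y \<le> r" for x y m n
  proof -
    have "coord x m * coord x n - coord y m * coord y n
        = coord x m * coord (x - y) n + coord (x - y) m * coord y n" by (simp add: algebra_simps)
    also have "cmod \<dots> \<le> r * norm (x - y) + norm (x - y) * r"
      using that norm_coord_le[of x m] norm_coord_le[of y n] const
      by (intro norm_triangle_mono) (auto simp: norm_mult intro!: mult_mono norm_coord_le simp del: coord_diff)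
    finally show ?thesis by (simp add: algebra_simps)
  qed
  have Y_diff: "cmod (Y x - Y y) \<le> (\<kappa> + r) / s * norm (x - y)"
    if "norm x \<le> r" "norm y \<le> r" for x y
  proof -
    have "cmod (Y x - Y y) = cmod ((l (-1) (U x) - l (-1) (U y)) - \<i> * of_real \<sigma> * (l 1 (U x) - l 1 (U y))
        - (coord x 1 * coord x (-1) - coord y 1 * coord y (-1))) / (2 * s)"
      using s by (simp add: Y_def norm_divide diff_divide_distrib[symmetric] algebra_simps)
    also have "\<dots> \<le> (\<kappa> * norm (x - y) + \<kappa> * norm (x - y) + 2 * r * norm (x - y)) / (2 * s)"
      using s l_U_diff[of 1 x y]
      by (intro divide_right_mono norm_diff_le_add[OF norm_diff_le_add[OF l_U_diff] prod_diff[OF that]])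
         (auto simp: norm_mult \<sigma>abs)
    also have "\<dots> = (\<kappa> + r) / s * norm (x - y)" using s by (simp add: field_simps)
    finally show ?thesis .
  qed
  have X_diff: "cmod (X x - X y) \<le> (2 * \<kappa> + r) * norm (x - y)"
    if "norm x \<le> r" "norm y \<le> r" for x y
  proof -
    have "cmod (X x - X y) = cmod ((l 1 (U x) - l 1 (U y)) - \<i> * of_real (\<sigma> * s) * (Y x - Y y))"
      by (simp add: X_def algebra_simps)
    also have "\<dots> \<le> \<kappa> * norm (x - y) + s * ((\<kappa> + r) / s * norm (x - y))"
      using mult_left_mono[OF Y_diff[OF that], of s] s
      by (intro norm_diff_le_add[OF l_U_diff]) (auto simp: norm_mult \<sigma>abs)
    also have "\<dots> = (2 * \<kappa> + r) * norm (x - y)" using s by (simp add: field_simps)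
    finally show ?thesis .
  qed
  have Z_diff: "cmod (Z x - Z y) \<le> (\<kappa> + 2 * r) / s * norm (x - y)"
    if "norm x \<le> r" "norm y \<le> r" for x y
  proof -
    have "cmod (Z x - Z y) = cmod ((l 0 (U x) - l 0 (U y)) - (coord x 1 * coord x 0 - coord y 1 * coord y 0)) / cmod D"
      by (simp add: Z_def norm_divide[symmetric] diff_divide_distrib[symmetric] algebra_simps)
    also have "\<dots> \<le> (\<kappa> * norm (x - y) + 2 * r * norm (x - y)) / s"
      using D s \<kappa>0 const
      by (intro frac_le norm_diff_le_add[OF l_U_diff prod_diff[OF that]]) auto
    also have "\<dots> = (\<kappa> + 2 * r) / s * norm (x - y)" using s by (simp add: field_simps)
    finally show ?thesis .
  qed
  have \<nu>_le: "cmod (\<nu> t) \<le> \<bar>\<gamma>\<bar> + b\<^sup>2 * (s + r)" if "norm t \<le> r" for t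
  proof -
    have "cmod (of_real s + coord t 1) \<le> s + r"
      using norm_triangle_ineq[of "of_real s" "coord t 1"] norm_coord_le[of t 1] that s by simp
    then show ?thesis
      unfolding \<nu>_def
      by (intro norm_triangle_mono) (auto simp: norm_mult norm_power intro!: mult_left_mono)
  qed
  have W_diff: "norm (W x - W y) \<le> ((\<bar>\<gamma>\<bar> + b\<^sup>2 * (s + 2 * r)) / c\<^sub>0 + \<epsilon> / \<theta>) * norm (x - y)"
    if xy: "norm x \<le> r" "norm y \<le> r" for x y
  proof -
    \<comment> \<open>The eigenvalue itself depends on the unknown through slot 1, so the product of
      the two is split into two differences. They contribute \<open>s + r\<close> and a further
      \<open>r\<close> to the Lipschitz constant.\<close>
    have "W x - W y = G (cs (\<nu> x) (x - y) + cs (\<nu> x - \<nu> y) y) - (1 / \<theta>) *\<^sub>R tail (R (\<Lambda> (x - y)))"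
      unfolding U_diff[symmetric] R_diff
      by (rule ell2_eqI) (simp add: W_def coord_G coord_cs algebra_simps diff_divide_distrib)
    moreover have "norm (G (cs (\<nu> x) (x - y) + cs (\<nu> x - \<nu> y) y))
        \<le> ((\<bar>\<gamma>\<bar> + b\<^sup>2 * (s + r)) * norm (x - y) + (b\<^sup>2 * norm (x - y)) * r) / c\<^sub>0"
    proof (intro order_trans[OF norm_G] divide_right_mono norm_triangle_mono)
      show "norm (cs (\<nu> x) (x - y)) \<le> (\<bar>\<gamma>\<bar> + b\<^sup>2 * (s + r)) * norm (x - y)"
        using norm_cs[of "\<nu> x" "x - y"] mult_right_mono[OF \<nu>_le[OF xy(1)], of "norm (x - y)"] by simp
      have "\<nu> x - \<nu> y = of_real (b\<^sup>2) * coord (x - y) 1" by (simp add: \<nu>_def algebra_simps)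
      then have "cmod (\<nu> x - \<nu> y) \<le> b\<^sup>2 * norm (x - y)"
        using norm_coord_le[of "x - y" 1] by (simp add: norm_mult norm_power mult_left_mono del: coord_diff)
      then show "norm (cs (\<nu> x - \<nu> y) y) \<le> b\<^sup>2 * norm (x - y) * r"
        using norm_cs[of "\<nu> x - \<nu> y" y] xy(2) mult_mono[of "cmod (\<nu> x - \<nu> y)" "b\<^sup>2 * norm (x - y)" "norm y" r]
        by (meson norm_ge_zero order_trans)
    qed (use c0 in auto)
    moreover have "norm ((1 / \<theta>) *\<^sub>R tail (R (\<Lambda> (x - y)))) \<le> \<epsilon> * norm (x - y) / \<theta>"
    proof -
      have "norm (tail (R (\<Lambda> (x - y)))) \<le> \<epsilon> * norm (x - y)"
        using norm_tail_le[of "R (\<Lambda> (x - y))"] R_le[of "\<Lambda> (x - y)"]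
          mult_left_mono[OF norm_\<Lambda>[of "x - y"] \<open>\<epsilon> \<ge> 0\<close>] by linarith
      then show ?thesis using const by (simp add: divide_right_mono)
    qed
    ultimately have "norm (W x - W y) \<le> ((\<bar>\<gamma>\<bar> + b\<^sup>2 * (s + r)) * norm (x - y) + (b\<^sup>2 * norm (x - y)) * r) / c\<^sub>0
        + \<epsilon> * norm (x - y) / \<theta>"
      by (simp only: norm_diff_le_add)
    also have "\<dots> = ((\<bar>\<gamma>\<bar> + b\<^sup>2 * (s + 2 * r)) / c\<^sub>0 + \<epsilon> / \<theta>) * norm (x - y)"
      using c0 const by (simp add: field_simps)
    finally show ?thesis .
  qed
  have "norm (\<Phi> x - \<Phi> y) \<le> norm (x - y) / 2" if xy: "norm x \<le> r" "norm y \<le> r" for x y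
  proof -
    have "\<Phi> x - \<Phi> y = unit_at 1 (X x - X y) + unit_at (-1) (Y x - Y y) + unit_at 0 (Z x - Z y) + (W x - W y)"
      by (rule ell2_eqI) (simp add: \<Phi>_def)
    also have "norm \<dots> \<le> (2 * \<kappa> + r) * norm (x - y) + (\<kappa> + r) / s * norm (x - y)
        + (\<kappa> + 2 * r) / s * norm (x - y) + ((\<bar>\<gamma>\<bar> + b\<^sup>2 * (s + 2 * r)) / c\<^sub>0 + \<epsilon> / \<theta>) * norm (x - y)"
      using X_diff[OF xy] Y_diff[OF xy] Z_diff[OF xy] W_diff[OF xy]
      by (intro norm_triangle_mono) auto
    also have "\<dots> = ((\<kappa> + r) / s + (2 * \<kappa> + r) + (\<kappa> + 2 * r) / s
        + ((\<bar>\<gamma>\<bar> + b\<^sup>2 * (s + 2 * r)) / c\<^sub>0 + \<epsilon> / \<theta>)) * norm (x - y)"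
      by (simp add: distrib_right)
    also have "\<dots> \<le> 1 / 2 * norm (x - y)"
      using lip unfolding \<kappa>_def[symmetric] by (intro mult_right_mono) auto
    finally show ?thesis by simp
  qed
  \<comment> \<open>At 0 the vector is \<open>V\<close>, which has no tail, so the constant
    \<open>C\<close> drops out and every term carries a factor \<epsilon>.\<close>
  moreover have "norm (\<Phi> 0) \<le> r / 2"
  proof -
    have Y0: "cmod (Y 0) \<le> 2 * \<epsilon> / s"
    proof -
      have "cmod (Y 0) \<le> (2 * \<epsilon> + 2 * \<epsilon>) / (2 * s)"
        unfolding Y_def norm_divide U0 using s l_V[of 1] norm_diff_le_add[OF l_V[of "-1"], of "\<i> * of_real \<sigma> * l 1 V" "2 * \<epsilon>"] const
        by (intro frac_le) (auto simp: norm_mult \<sigma>abs)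
      then show ?thesis by simp
    qed
    have X0: "cmod (X 0) \<le> 4 * \<epsilon>"
    proof -
      have "cmod (X 0) \<le> 2 * \<epsilon> + s * (2 * \<epsilon> / s)"
        unfolding X_def U0 using s mult_left_mono[OF Y0, of s]
        by (intro norm_diff_le_add[OF l_V]) (auto simp: norm_mult \<sigma>abs)
      then show ?thesis using s by simp
    qed
    have Z0: "cmod (Z 0) \<le> 2 * \<epsilon> / s"
      unfolding Z_def norm_divide U0 using s D l_V[of 0] const by (intro frac_le) auto
    have "W 0 = - (1 / \<theta>) *\<^sub>R tail (R V)"
      by (rule ell2_eqI) (simp add: W_def coord_G coord_cs U0)
    then have "norm (W 0) = norm (tail (R V)) / \<theta>" using const by simp
    also have "\<dots> \<le> 2 * \<epsilon> / \<theta>"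
      using norm_tail_le[of "R V"] R_le[of V] mult_left_mono[OF norm_V \<open>\<epsilon> \<ge> 0\<close>] const
      by (intro divide_right_mono) auto
    finally have W0: "norm (W 0) \<le> 2 * \<epsilon> / \<theta>" .
    have "norm (\<Phi> 0) \<le> 4 * \<epsilon> + 2 * \<epsilon> / s + 2 * \<epsilon> / s + 2 * \<epsilon> / \<theta>"
      unfolding \<Phi>_def using X0 Y0 Z0 W0 by (intro norm_triangle_mono) auto
    then show ?thesis using init by simp
  qed
  ultimately obtain t where t: "norm t \<le> r" "\<Phi> t = t"
    using contraction_fixpoint_in_ball[of r \<Phi>] const by auto
  define u where "u = U t"
  have u1: "coord u 1 = 1" and um: "coord u (-1) = \<i> * of_real \<sigma> + coord t (-1)"
    and u0: "coord u 0 = coord t 0" and ut: "\<And>n. \<bar>n\<bar> \<ge> 2 \<Longrightarrow> coord u n = of_real \<theta> * coord t n"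
    by (auto simp: u_def U_def V_def coord_\<Lambda>)
  define x where "x = coord t 1"
  define y where "y = coord t (-1)"
  have X: "x = l 1 u - \<i> * of_real (\<sigma> * s) * y"
    using \<Phi>1[of t] \<Phi>m[of t] by (simp add: t X_def u_def x_def y_def)
  have Y: "of_real (2 * s) * y = l (-1) u - \<i> * of_real \<sigma> * l 1 u - x * y"
    using \<Phi>m[of t] s by (simp add: t Y_def u_def x_def y_def field_simps)
  have Z: "D * coord t 0 = l 0 u - x * coord t 0"
    using \<Phi>0[of t] D_nz by (simp add: t Z_def u_def x_def field_simps)
  have \<sigma>2: "complex_of_real \<sigma> * of_real \<sigma> = 1"
    using \<sigma> by (metis of_real_1 of_real_mult power2_eq_square)
  have \<nu>: "\<nu> t = - \<i> * of_real \<gamma> + of_real (b\<^sup>2) * (of_real s + x)" by (simp add: \<nu>_def x_def)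
  have eig: "A u n = \<nu> t * coord u n" for n
  proof -
    consider "n = 1" | "n = -1" | "n = 0" | "\<bar>n\<bar> \<ge> 2" by linarith
    then show ?thesis
    proof cases
      case 1
      have "- \<i> * of_real (\<sigma> * s) * coord u (-1) + l 1 u = of_real s + x"
        unfolding um y_def[symmetric] X using \<sigma>2 by (simp add: algebra_simps)
      then show ?thesis using row[of 1 u] 1 by (simp add: u1 \<nu> algebra_simps)
    next
      case 2
      have "\<i> * of_real (\<sigma> * s) + l (-1) u = (of_real s + x) * (\<i> * of_real \<sigma> + y)"
      proof -
        have "\<i> * of_real \<sigma> * x = \<i> * of_real \<sigma> * l 1 u + of_real s * y"
          unfolding X using \<sigma>2 by (simp add: algebra_simps)
        then show ?thesis using Y by (simp add: algebra_simps)
      qed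
      then show ?thesis using row[of "-1" u] 2 by (simp add: u1 um y_def[symmetric] \<nu> algebra_simps)
    next
      case 3
      have D_eq: "of_real (b\<^sup>2) * D = of_real (b\<^sup>2 * s) - \<i> * of_real (\<gamma> + d)"
      proof -
        have "complex_of_real (b\<^sup>2) * of_real ((\<gamma> + d) / b\<^sup>2) = of_real (\<gamma> + d)"
          unfolding of_real_mult[symmetric] using b by simp
        then show ?thesis by (simp only: D_def of_real_mult right_diff_distrib mult.left_commute[of _ \<i>])
      qed
      have l_eq: "of_real (b\<^sup>2) * l 0 u = of_real (b\<^sup>2) * D * coord t 0 + of_real (b\<^sup>2) * x * coord t 0"
        unfolding mult.assoc distrib_left[symmetric] using Z by (simp add: algebra_simps)
      show ?thesis
        unfolding 3 row0 u0 \<nu> l_eq D_eq by (simp add: algebra_simps)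
    next
      case 4
      have "coord t n = \<nu> t / q n * coord t n - coord (R u) n / of_real \<theta>"
        using \<Phi>t[OF 4, of t] by (simp add: t u_def)
      moreover have "q n \<noteq> 0" using q[OF 4] c0 by auto
      ultimately have "q n * (of_real \<theta> * coord t n + coord (R u) n) = \<nu> t * (of_real \<theta> * coord t n)"
        using const by (simp add: field_simps)
      then show ?thesis using rowt[OF 4] ut[OF 4] by simp
    qed
  qed
  \<comment> \<open>The bound \<open>r \<le> s / 2\<close> prevents the correction from cancelling
    the growth rate \<open>s\<close>; the term with \<gamma> is imaginary and does not affect
    it.\<close>
  have x_le: "cmod x \<le> s / 2" using norm_coord_le[of t 1] t const by (simp add: x_def)
  have "Re (\<nu> t) > 0"
  proof -
    have "Re x > - s" using abs_Re_le_cmod[of x] x_le s by linarith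
    then show ?thesis using b by (simp add: \<nu>)
  qed
  moreover have "cmod (\<nu> t) \<le> \<bar>\<gamma>\<bar> + 2 * b\<^sup>2 * s"
  proof -
    have "b\<^sup>2 * (s + r) \<le> b\<^sup>2 * (2 * s)" using const s by (intro mult_left_mono) auto
    then show ?thesis using \<nu>_le[OF t(1)] by simp
  qed
  ultimately show ?thesis using that[OF u1 eig] by blast
qed

section \<open>Fourier series on the circle\<close>

lemma fourier_coeff_add:
  assumes "continuous_on UNIV f" "continuous_on UNIV g"
  shows "fourier_coeff (\<lambda>z. f z + g z) n = fourier_coeff f n + fourier_coeff g n"
proof -
  have "(\<lambda>z. f z * cis (- (of_int n * z))) integrable_on {0..2*pi}"
    "(\<lambda>z. g z * cis (- (of_int n * z))) integrable_on {0..2*pi}"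
    by (intro integrable_continuous_interval continuous_intros
        continuous_on_subset[OF assms(1)] continuous_on_subset[OF assms(2)]; simp)+
  then show ?thesis
    unfolding fourier_coeff_def distrib_right by (simp add: integral_add add_divide_distrib)
qed

lemma fourier_coeff_cmult: "fourier_coeff (\<lambda>z. c * f z) n = c * fourier_coeff f n"
  unfolding fourier_coeff_def by (simp add: mult.assoc)

lemma fourier_coeff_uminus: "fourier_coeff (\<lambda>z. - f z) n = - fourier_coeff f n"
  using fourier_coeff_cmult[of "-1" f n] by simp

lemma fourier_coeff_diff:
  assumes "continuous_on UNIV f" "continuous_on UNIV g"
  shows "fourier_coeff (\<lambda>z. f z - g z) n = fourier_coeff f n - fourier_coeff g n"
  using fourier_coeff_add[OF assms(1) continuous_on_minus[OF assms(2)]]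
  by (simp add: fourier_coeff_uminus)

lemma integral_interval_of_real:
  fixes f :: "real \<Rightarrow> real"
  assumes "continuous_on {a..b} f"
  shows "integral {a..b} (\<lambda>x. complex_of_real (f x)) = of_real (integral {a..b} f)"
  using integral_linear[OF integrable_continuous_interval[OF assms] bounded_linear_of_real]
  by (simp add: o_def)

lemma fourier_coeff_shift:
  "fourier_coeff (\<lambda>z. f z * cis (of_int m * z)) n = fourier_coeff f (n - m)"
  unfolding fourier_coeff_def by (simp add: mult.assoc cis_mult algebra_simps)

lemma norm_fourier_coeff_le:
  assumes "continuous_on UNIV f" "\<And>z. cmod (f z) \<le> B"
  shows "cmod (fourier_coeff f n) \<le> B"
proof -
  have "cmod (integral {0..2*pi} (\<lambda>z. f z * cis (- (of_int n * z)))) \<le> B * (2 * pi - 0)"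
    using assms(2) by (intro integral_bound)
      (auto intro!: continuous_intros continuous_on_subset[OF assms(1)] simp: norm_mult)
  then show ?thesis
    unfolding fourier_coeff_def by (simp add: norm_divide divide_simps)
qed

lemma fourier_coeff_const_cis:
  "fourier_coeff (\<lambda>z. c * cis (of_int m * z)) n = (if n = m then c else 0)"
proof -
  define k where "k = m - n"
  have "integral {0..2*pi} (\<lambda>z. cis (of_int k * z)) = (if k = 0 then 2 * pi else 0)"
  proof (cases "k = 0")
    case False
    have "((\<lambda>z. cis (of_int k * z)) has_integral
        (exp (\<i> * of_int k * of_real (2 * pi)) / (\<i> * of_int k) - exp (\<i> * of_int k * of_real 0) / (\<i> * of_int k)))
        {0..2*pi}"
    proof (rule fundamental_theorem_of_calculus)
      fix x :: real
      have "((\<lambda>z. exp (\<i> * of_int k * z) / (\<i> * of_int k)) has_field_derivative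
          exp (\<i> * of_int k * of_real x)) (at (of_real x))"
        using False by (auto intro!: derivative_eq_intros)
      moreover have "exp (\<i> * of_int k * of_real x) = cis (of_int k * x)"
        by (simp add: cis_conv_exp mult.assoc)
      ultimately show "((\<lambda>z. exp (\<i> * of_int k * complex_of_real z) / (\<i> * of_int k)) has_vector_derivative
          cis (of_int k * x)) (at x within {0..2*pi})"
        using has_vector_derivative_real_field[of "\<lambda>z. exp (\<i> * of_int k * z) / (\<i> * of_int k)"
            "exp (\<i> * of_int k * of_real x)" x "{0..2*pi}"] by (simp only:)
    qed simp
    moreover have "exp (\<i> * of_int k * of_real (2 * pi)) = 1"
      using exp_integer_2pi[of "of_int k"] by (simp add: mult_ac)
    ultimately show ?thesis using False by (simp add: integral_unique)
  qed (simp add: scaleR_conv_of_real)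
  then have "fourier_coeff (\<lambda>z. cis (of_int m * z)) n = (if n = m then 1 else 0)"
    unfolding fourier_coeff_def cis_mult k_def by (auto simp: algebra_simps)
  then show ?thesis using fourier_coeff_cmult[of c "\<lambda>z. cis (of_int m * z)" n] by simp
qed

text \<open>The Weierstrass test makes the series uniformly convergent, so continuity passes to the
  sum and the coefficients may be computed by integrating termwise.\<close>

lemma abs_summable_fourier_series:
  fixes c :: "int \<Rightarrow> complex"
  assumes M: "M summable_on UNIV" and c: "\<And>n. cmod (c n) \<le> M n"
  defines "f \<equiv> \<lambda>z. \<Sum>\<^sub>\<infinity>n. c n * cis (of_int n * z)"
  shows continuous_on_fourier_series: "continuous_on UNIV f"
    and fourier_series_periodic: "f (z + 2 * pi) = f z"
    and fourier_coeff_series: "fourier_coeff f n = c n"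
    and norm_fourier_series_le: "cmod (f z) \<le> infsum M UNIV"
    and fourier_series_has_sum: "((\<lambda>n. c n * cis (of_int n * z)) has_sum f z) UNIV"
proof -
  have lim: "uniform_limit UNIV (\<lambda>X z. \<Sum>n\<in>X. c n * cis (of_int n * z)) f (finite_subsets_at_top UNIV)"
    unfolding f_def using c M by (intro Weierstrass_m_test_general) (auto simp: norm_mult)
  show "continuous_on UNIV f"
    by (rule uniform_limit_theorem[OF _ lim]) (auto intro!: always_eventually continuous_intros)
  have "cis (of_int n * (z + 2 * pi)) = cis (of_int n * z)" for n z
    by (simp add: ring_distribs flip: cis_mult)
       (metis cis_multiple_2pi Ints_of_int mult.commute mult.left_commute mult_1_right)
  then show "f (z + 2 * pi) = f z" by (simp add: f_def)
  show sum: "((\<lambda>n. c n * cis (of_int n * z)) has_sum f z) UNIV" for z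
    unfolding f_def
    by (rule has_sum_infsum, rule abs_summable_summable, rule summable_on_comparison_test[OF M])
       (use c in \<open>auto simp: norm_mult\<close>)
  show "cmod (f z) \<le> infsum M UNIV"
    using c by (intro norm_infsum_le[OF sum[of z] has_sum_infsum[OF M]]) (auto simp: norm_mult)
  have "uniform_limit {0..2*pi} (\<lambda>X z. (\<Sum>m\<in>X. c m * cis (of_int m * z)) * cis (- (of_int n * z)))
      (\<lambda>z. f z * cis (- (of_int n * z))) (finite_subsets_at_top UNIV)"
  proof (rule uniform_limitI)
    fix e :: real assume "e > 0"
    from uniform_limitD[OF lim this]
    show "\<forall>\<^sub>F X in finite_subsets_at_top UNIV. \<forall>z\<in>{0..2*pi}.
        dist ((\<Sum>m\<in>X. c m * cis (of_int m * z)) * cis (- (of_int n * z))) (f z * cis (- (of_int n * z))) < e"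
    proof eventually_elim
      case (elim X)
      then show ?case
        by (simp add: dist_norm norm_mult flip: left_diff_distrib)
    qed
  qed
  then obtain I J where I: "\<And>X. ((\<lambda>z. (\<Sum>m\<in>X. c m * cis (of_int m * z)) * cis (- (of_int n * z))) has_integral I X) {0..2*pi}"
    and J: "((\<lambda>z. f z * cis (- (of_int n * z))) has_integral J) {0..2*pi}"
    and IJ: "(I \<longlongrightarrow> J) (finite_subsets_at_top UNIV)"
    by (rule uniform_limit_integral) (auto intro!: continuous_intros)
  have fin: "fourier_coeff (\<lambda>z. \<Sum>m\<in>X. c m * cis (of_int m * z)) n = (if n \<in> X then c n else 0)"
    if "finite X" for X
    using that
  proof (induction X rule: finite_induct)
    case empty
    then show ?case by (simp add: fourier_coeff_def)
  next
    case (insert m X)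
    have "fourier_coeff (\<lambda>z. c m * cis (of_int m * z) + (\<Sum>m\<in>X. c m * cis (of_int m * z))) n
        = (if n = m then c m else 0) + (if n \<in> X then c n else 0)"
      by (subst fourier_coeff_add) (auto intro!: continuous_intros simp: insert fourier_coeff_const_cis)
    then show ?case using insert by auto
  qed
  \<comment> \<open>As soon as the finite index set contains n, the integral of the partial sum has
    its final value; the limit is that of an eventually constant net.\<close>
  have "I X = 2 * pi * (if n \<in> X then c n else 0)" if "finite X" for X
    using fin[OF that] integral_unique[OF I[of X]]
    by (auto simp: fourier_coeff_def field_simps split: if_splits)
  then have "\<forall>\<^sub>F X in finite_subsets_at_top UNIV. I X = 2 * pi * c n"
    unfolding eventually_finite_subsets_at_top by (intro exI[of _ "{n}"]) auto
  then have "(I \<longlongrightarrow> 2 * pi * c n) (finite_subsets_at_top UNIV)"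
    by (rule tendsto_eventually)
  then have "J = 2 * pi * c n"
    using IJ by (intro tendsto_unique[OF _ IJ]) auto
  then show "fourier_coeff f n = c n"
    unfolding fourier_coeff_def integral_unique[OF J] by simp
qed

section \<open>Uniqueness of the Fourier coefficients of a continuous periodic function\<close>

lemma periodic_int:
  fixes f :: "real \<Rightarrow> 'a"
  assumes "\<And>z. f (z + 2 * pi) = f z"
  shows "f (z + 2 * pi * of_int k) = f z"
proof (induction k rule: int_induct[where k = 0])
  case (step1 i)
  then show ?case using assms[of "z + 2 * pi * of_int i"] by (simp add: algebra_simps)
next
  case (step2 i)
  then show ?case using assms[of "z + 2 * pi * of_int (i - 1)"] by (simp add: algebra_simps)
qed simp

lemma periodic_cis_eq:
  fixes f :: "real \<Rightarrow> 'a"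
  assumes "\<And>z. f (z + 2 * pi) = f z" "cis x = cis y"
  shows "f x = f y"
proof -
  have "sin x = sin y \<and> cos x = cos y" using assms(2) by (simp add: complex_eq_iff)
  then obtain n :: int where "x = y + 2 * pi * n" using sin_cos_eq_iff by blast
  then show ?thesis using periodic_int[of f y n] assms(1) by simp
qed

text \<open>Stone-Weierstrass is applied on the unit circle, to which the periodic function is
  transported here. \<open>Arg\<close> jumps across the negative axis, but there
  \<open>Arg (- w) + pi\<close> is another admissible angle, continuous near w, and periodicity
  makes both give the same value.\<close>

lemma periodic_factors_through_circle:
  fixes f :: "real \<Rightarrow> complex"
  assumes f: "continuous_on UNIV f" "\<And>z. f (z + 2 * pi) = f z"
  obtains F where "continuous_on (sphere 0 1) F" "\<And>z. F (cis z) = f z"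
proof
  define F where "F w = f (Arg w)" for w
  have F: "F (cis z) = f z" for z
    unfolding F_def by (rule periodic_cis_eq[where f = f, OF f(2)]) (simp add: cis_Arg sgn_eq)
  then show "F (cis z) = f z" for z .
  have F': "F w = f (Arg (- w) + pi)" if "w \<noteq> 0" for w
    unfolding F_def using that
    by (intro periodic_cis_eq[where f = f, OF f(2)]) (simp add: cis_Arg sgn_eq flip: cis_mult)
  have cf: "isCont f x" for x
    using f(1) by (simp add: continuous_on_eq_continuous_at)
  show "continuous_on (sphere 0 1) F"
  proof (intro continuous_at_imp_continuous_on ballI)
    fix w :: complex assume "w \<in> sphere 0 1"
    then have w: "w \<noteq> 0" by auto
    show "isCont F w"
    proof (cases "w \<in> \<real>\<^sub>\<le>\<^sub>0")
      case False
      then show ?thesis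
        unfolding F_def by (intro isCont_o2[OF continuous_at_Arg cf])
    next
      case True
      then have "- w \<notin> \<real>\<^sub>\<le>\<^sub>0" using w by (auto elim!: nonpos_Reals_cases simp: complex_nonpos_Reals_iff complex_eq_iff)
      then have "isCont (\<lambda>w. f (Arg (- w) + pi)) w"
        by (intro isCont_o2[OF _ cf] continuous_intros isCont_o2[OF _ continuous_at_Arg]) auto
      moreover have "\<forall>\<^sub>F v in nhds w. F v = f (Arg (- v) + pi)"
        using t1_space_nhds[OF w] by eventually_elim (rule F')
      ultimately show ?thesis by (simp add: isCont_cong)
    qed
  qed
qed

lemma continuous_on_real_polynomial_cis:
  assumes "real_polynomial_function p"
  shows "continuous_on S (\<lambda>z. p (cis z))"
proof (rule continuous_on_compose2[OF continuous_on_polymonial_function[of p UNIV]])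
  show "polynomial_function p" using assms by (simp add: real_polynomial_function_eq)
  show "continuous_on S cis" by (rule continuous_on_cis[OF continuous_on_id])
qed simp

text \<open>A real linear functional of \<open>cis z\<close> is a combination of exp (i z) and exp
  (-i z), and multiplication by these only shifts the coefficients. Products are handled by applying
  the induction hypothesis to f already multiplied by the first factor, which is why
  \<open>f\<close> varies in the induction.\<close>

lemma fourier_coeff_mult_polynomial_eq_0:
  fixes p :: "complex \<Rightarrow> real"
  assumes "real_polynomial_function p"
  shows "continuous_on UNIV f \<Longrightarrow> (\<And>n. fourier_coeff f n = 0)
    \<Longrightarrow> fourier_coeff (\<lambda>z. f z * of_real (p (cis z))) n = 0"
  using assms
proof (induction p arbitrary: f n rule: real_polynomial_function.induct)
  case (linear p)
  have p: "p (cis z) = cos z * p 1 + sin z * p \<i>" for z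
  proof -
    have "cis z = cos z *\<^sub>R 1 + sin z *\<^sub>R \<i>" by (simp add: complex_eq_iff)
    then have "p (cis z) = p (cos z *\<^sub>R 1 + sin z *\<^sub>R \<i>)" by simp
    also have "\<dots> = p (cos z *\<^sub>R 1) + p (sin z *\<^sub>R \<i>)"
      by (rule linear_simps(1)[OF linear(1)])
    also have "\<dots> = cos z * p 1 + sin z * p \<i>"
      using linear_simps(5)[OF linear(1), of "cos z" 1] linear_simps(5)[OF linear(1), of "sin z" \<i>]
      by (simp only: real_scaleR_def)
    finally show ?thesis .
  qed
  \<comment> \<open>\<open>A\<close> and \<open>B\<close> are the coefficients of exp (i z) and exp
    (-i z) in \<open>p 1 * cos z + p \<i> * sin z\<close>.\<close>
  define A where "A = (of_real (p 1) - \<i> * of_real (p \<i>)) / 2"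
  define B where "B = (of_real (p 1) + \<i> * of_real (p \<i>)) / 2"
  have "f z * of_real (p (cis z)) = A * (f z * cis (of_int 1 * z)) + B * (f z * cis (of_int (-1) * z))" for z
    by (simp add: p A_def B_def complex_eq_iff field_simps)
  then have "fourier_coeff (\<lambda>z. f z * of_real (p (cis z))) n
      = fourier_coeff (\<lambda>z. A * (f z * cis (of_int 1 * z)) + B * (f z * cis (of_int (-1) * z))) n"
    by simp
  also have "\<dots> = 0"
    by (subst fourier_coeff_add)
       (auto intro!: continuous_intros linear simp: fourier_coeff_cmult fourier_coeff_shift linear simp del: of_int_1 of_int_minus)
  finally show ?case .
next
  case (const c)
  then show ?case by (simp add: fourier_coeff_cmult mult.commute[of "f _"])
next
  case (add p q)
  have "fourier_coeff (\<lambda>z. f z * of_real (p (cis z)) + f z * of_real (q (cis z))) n = 0"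
    using add by (subst fourier_coeff_add)
      (simp_all add: continuous_on_mult continuous_on_of_real continuous_on_real_polynomial_cis)
  then show ?case by (simp only: of_real_add distrib_left)
next
  case (mult p q)
  have "fourier_coeff (\<lambda>z. (f z * of_real (p (cis z))) * of_real (q (cis z))) n = 0"
  proof (rule mult.IH(2))
    show "continuous_on UNIV (\<lambda>z. f z * of_real (p (cis z)))"
      using mult by (intro continuous_on_mult continuous_on_of_real continuous_on_real_polynomial_cis)
    show "fourier_coeff (\<lambda>z. f z * of_real (p (cis z))) n = 0" for n
      using mult by (intro mult.IH(1))
  qed
  then show ?case by (simp add: mult.assoc)
qed

text \<open>Vanishing coefficients make f orthogonal to every polynomial in \<open>cis z\<close>. If
  such a polynomial g is within e of f, then the integral of |f|^2 equals that of f times the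
  conjugate of f - g, hence is at most e times the integral of |f|; let e tend to 0.\<close>

lemma fourier_uniqueness:
  assumes f: "continuous_on UNIV f" "\<And>z. f (z + 2 * pi) = f z" "\<And>n. fourier_coeff f n = 0"
  shows "f z = 0"
proof -
  obtain F where F: "continuous_on (sphere 0 1) F" "\<And>z. F (cis z) = f z"
    by (rule periodic_factors_through_circle[where f = f, OF f(1,2)]) blast
  have cf: "continuous_on {0..2*pi} f" by (rule continuous_on_subset[OF f(1)]) simp
  have int: "integral {0..2*pi} (\<lambda>z. (cmod (f z))\<^sup>2) \<le> e * integral {0..2*pi} (\<lambda>z. cmod (f z))" if "e > 0" for e
  proof -
    obtain g where g: "polynomial_function g" "\<And>w. w \<in> sphere 0 1 \<Longrightarrow> cmod (F w - g w) < e"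
      using Stone_Weierstrass_polynomial_function[OF compact_sphere F(1) \<open>e > 0\<close>] by blast
    have gR: "real_polynomial_function (\<lambda>w. Re (g w))" "real_polynomial_function (\<lambda>w. Im (g w))"
      using g(1) bounded_linear_Re bounded_linear_Im unfolding polynomial_function_def o_def by auto
    have cg: "continuous_on {0..2*pi} (\<lambda>z. g (cis z))"
      by (rule continuous_on_compose2[OF continuous_on_polymonial_function[OF g(1), of UNIV]
          continuous_on_cis[OF continuous_on_id]]) simp
    have "integral {0..2*pi} (\<lambda>z. f z * of_real (Re (g (cis z)))) = 0"
      "integral {0..2*pi} (\<lambda>z. f z * of_real (Im (g (cis z)))) = 0"
      using fourier_coeff_mult_polynomial_eq_0[OF gR(1) f(1,3), of 0]
        fourier_coeff_mult_polynomial_eq_0[OF gR(2) f(1,3), of 0]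
      by (simp_all add: fourier_coeff_def)
    moreover have "f z * cnj (g (cis z)) = f z * of_real (Re (g (cis z))) + (- \<i>) * (f z * of_real (Im (g (cis z))))" for z
      by (simp add: complex_eq_iff algebra_simps)
    ultimately have g0: "integral {0..2*pi} (\<lambda>z. f z * cnj (g (cis z))) = 0"
      by (simp only:) (subst integral_add; simp; intro integrable_continuous_interval continuous_intros cf cg)
    have "of_real (integral {0..2*pi} (\<lambda>z. (cmod (f z))\<^sup>2)) = integral {0..2*pi} (\<lambda>z. f z * cnj (f z))"
      unfolding complex_norm_square[symmetric] of_real_power[symmetric]
      by (rule integral_interval_of_real[symmetric]) (intro continuous_intros cf)
    also have "\<dots> = integral {0..2*pi} (\<lambda>z. f z * cnj (f z) - f z * cnj (g (cis z)))"
      by (subst integral_diff) (auto intro!: integrable_continuous_interval continuous_intros cf cg simp: g0)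
    finally have eq: "of_real (integral {0..2*pi} (\<lambda>z. (cmod (f z))\<^sup>2))
        = integral {0..2*pi} (\<lambda>z. f z * cnj (f z) - f z * cnj (g (cis z)))" .
    have "integral {0..2*pi} (\<lambda>z. (cmod (f z))\<^sup>2)
        \<le> cmod (integral {0..2*pi} (\<lambda>z. f z * cnj (f z) - f z * cnj (g (cis z))))"
      unfolding eq[symmetric] by simp
    also have "\<dots> \<le> integral {0..2*pi} (\<lambda>z. e * cmod (f z))"
    proof (rule integral_norm_bound_integral)
      fix z :: real
      have "f z * cnj (f z) - f z * cnj (g (cis z)) = f z * cnj (F (cis z) - g (cis z))"
        by (simp add: F algebra_simps)
      then show "cmod (f z * cnj (f z) - f z * cnj (g (cis z))) \<le> e * cmod (f z)"
        using g(2)[of "cis z"] by (simp add: norm_mult mult.commute[of e] mult_left_mono del: complex_cnj_diff)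
    qed (auto intro!: integrable_continuous_interval continuous_intros cf cg)
    finally show ?thesis by simp
  qed
  have "integral {0..2*pi} (\<lambda>z. (cmod (f z))\<^sup>2) \<le> 0"
  proof (rule field_le_epsilon)
    fix e :: real assume e: "e > 0"
    define L where "L = integral {0..2*pi} (\<lambda>z. cmod (f z))"
    have L: "L \<ge> 0"
      unfolding L_def by (intro integral_nonneg integrable_continuous_interval continuous_intros cf) auto
    have "integral {0..2*pi} (\<lambda>z. (cmod (f z))\<^sup>2) \<le> e / (L + 1) * L"
      using int[of "e / (L + 1)"] e L by (simp add: L_def)
    also have "\<dots> \<le> e" using e L by (simp add: divide_simps)
    finally show "integral {0..2*pi} (\<lambda>z. (cmod (f z))\<^sup>2) \<le> 0 + e" by simp
  qed
  moreover have "integral {0..2*pi} (\<lambda>z. (cmod (f z))\<^sup>2) \<ge> 0"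
    by (intro integral_nonneg integrable_continuous_interval continuous_intros cf) auto
  ultimately have "integral {0..2*pi} (\<lambda>z. (cmod (f z))\<^sup>2) = 0" by simp
  then have *: "f x = 0" if "x \<in> {0..2*pi}" for x
  proof -
    have "continuous_on {0..2*pi} (\<lambda>z. (cmod (f z))\<^sup>2)" by (intro continuous_intros cf)
    from integral_eq_0_iff[OF this] show ?thesis
      using \<open>integral {0..2*pi} (\<lambda>z. (cmod (f z))\<^sup>2) = 0\<close> that by simp
  qed
  have "f z = f (Arg2pi (cis z))"
    by (rule periodic_cis_eq[where f = f, OF f(2)]) (use cos_Arg2pi[of "cis z"] sin_Arg2pi[of "cis z"] in \<open>simp add: complex_eq_iff\<close>)
  also have "\<dots> = 0" using * Arg2pi[of "cis z"] by simp
  finally show ?thesis .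
qed

section \<open>Sobolev functions and analytic families of operators\<close>

text \<open>The exponent is s/2 because this is the square root of the Sobolev weight: the
  coefficients multiplied by \<open>wt s\<close> have the Sobolev norm as their square sum
  norm.\<close>

definition wt :: "real \<Rightarrow> int \<Rightarrow> real" where
  "wt s n = (1 + (of_int n)\<^sup>2) powr (s / 2)"

lemma wt_pos [simp]: "wt s n > 0" and wt_nz [simp]: "wt s n \<noteq> 0"
proof -
  have "1 + (real_of_int n)\<^sup>2 \<noteq> 0" by (metis add_cancel_right_right add_nonneg_eq_0_iff zero_le_one zero_le_power2 zero_neq_one)
  then show "wt s n > 0" "wt s n \<noteq> 0" by (auto simp: wt_def)
qed

lemma wt_minus [simp]: "wt s (- n) = wt s n" and wt_0 [simp]: "wt s 0 = 1"
  by (simp_all add: wt_def)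

lemma wt_square: "(wt s n)\<^sup>2 = (1 + (of_int n)\<^sup>2) powr s"
  unfolding wt_def power2_eq_square[of "_ powr _"] powr_add[symmetric] by simp

lemma wt_square_ge: "s \<ge> 1 \<Longrightarrow> (wt s n)\<^sup>2 \<ge> 1 + (of_int n)\<^sup>2"
  unfolding wt_square using powr_mono[of 1 s "1 + (real_of_int n)\<^sup>2"] by simp

lemma summable_inverse_wt: "(\<lambda>n::int. 1 / (1 + (real_of_int n)\<^sup>2)) summable_on UNIV"
proof -
  have "summable (\<lambda>n::nat. 1 / (1 + (real n)\<^sup>2))"
  proof (rule summable_comparison_test[OF _ inverse_power_summable[of 2]])
    show "\<exists>N. \<forall>n\<ge>N. norm (1 / (1 + (real n)\<^sup>2)) \<le> inverse (real n ^ 2)"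
    proof (intro exI[of _ 1] allI impI)
      fix n :: nat assume "1 \<le> n"
      then have "real n ^ 2 > 0" by simp
      moreover have "1 + (real n)\<^sup>2 > 0" by (simp add: add_pos_nonneg)
      ultimately show "norm (1 / (1 + (real n)\<^sup>2)) \<le> inverse (real n ^ 2)" by (simp add: divide_simps)
    qed
  qed simp
  then have nat: "(\<lambda>n::nat. 1 / (1 + (real n)\<^sup>2)) summable_on UNIV"
    by (intro summable_nonneg_imp_summable_on) auto
  have "(\<lambda>n::int. 1 / (1 + (real_of_int n)\<^sup>2)) summable_on range int"
    using nat summable_on_reindex[of int UNIV "\<lambda>n. 1 / (1 + (real_of_int n)\<^sup>2)"]
    by (simp add: o_def)
  moreover have "(\<lambda>n::int. 1 / (1 + (real_of_int n)\<^sup>2)) summable_on range (\<lambda>n. - int n)"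
    using nat summable_on_reindex[of "\<lambda>n. - int n" UNIV "\<lambda>n. 1 / (1 + (real_of_int n)\<^sup>2)"]
    by (simp add: o_def inj_def)
  ultimately have "(\<lambda>n::int. 1 / (1 + (real_of_int n)\<^sup>2)) summable_on range int \<union> range (\<lambda>n. - int n)"
    by (rule summable_on_union)
  moreover have "range int \<union> range (\<lambda>n. - int n) = UNIV"
  proof -
    have "x \<in> range int \<union> range (\<lambda>n. - int n)" for x by (cases x rule: int_cases2) auto
    then show ?thesis by blast
  qed
  ultimately show ?thesis by simp
qed

text \<open>For \<open>s \<ge> 1\<close> this is the isometry of the sequence space onto the Sobolev
  space; the coordinates are the weighted Fourier coefficients. Through it the eigenvalue problem
  becomes one for sequences.\<close>

definition synth :: "real \<Rightarrow> ell2 \<Rightarrow> real \<Rightarrow> complex" where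
  "synth s u z = (\<Sum>\<^sub>\<infinity>n. coord u n / of_real (wt s n) * cis (of_int n * z))"

text \<open>A constant for the embedding of the Sobolev spaces with \<open>s \<ge> 1\<close> into
  the bounded functions. It arises from |x y| \<le> (x^2 + y^2) / 2 for a coordinate and the inverse
  weight, summed over a sequence of norm 1; the same inequality supplies the summable majorant of
  the series.\<close>

definition sup_const :: real where
  "sup_const = 1 / 2 * (1 + (\<Sum>\<^sub>\<infinity>n::int. 1 / (1 + (real_of_int n)\<^sup>2)))"

lemma sup_const_nonneg: "sup_const \<ge> 0"
  unfolding sup_const_def by (intro mult_nonneg_nonneg add_nonneg_nonneg infsum_nonneg) auto

lemma synth_coeff_le:
  assumes "s \<ge> 1"
  shows "cmod (coord u n / of_real (wt s n)) \<le> 1 / 2 * ((cmod (coord u n))\<^sup>2 + 1 / (1 + (real_of_int n)\<^sup>2))"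
proof -
  have "2 * (cmod (coord u n) * (1 / wt s n)) \<le> (cmod (coord u n))\<^sup>2 + (1 / wt s n)\<^sup>2"
    using sum_squares_bound[of "cmod (coord u n)" "1 / wt s n"] by simp
  also have "(1 / wt s n)\<^sup>2 \<le> 1 / (1 + (real_of_int n)\<^sup>2)"
    using wt_square_ge[OF assms, of n] unfolding power_divide power_one
    by (intro frac_le) (auto intro: add_pos_nonneg)
  finally show ?thesis by (simp add: norm_divide less_imp_le mult.commute)
qed

lemma synth_majorant:
  "(\<lambda>n. 1 / 2 * ((cmod (coord u n))\<^sup>2 + 1 / (1 + (real_of_int n)\<^sup>2))) summable_on UNIV"
  using coord_L2_space[of u] unfolding L2_space_def
  by (intro summable_on_cmult_right summable_on_add summable_inverse_wt) simp

context
  fixes s :: real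
  assumes s: "s \<ge> 1"
begin

lemmas synth_series = abs_summable_fourier_series[OF synth_majorant synth_coeff_le[OF s],
    folded synth_def]

lemma continuous_on_synth: "continuous_on S (synth s u)"
  by (rule continuous_on_subset[OF synth_series(1)]) simp

lemma synth_periodic: "synth s u (z + 2 * pi) = synth s u z"
  by (rule synth_series(2))

lemma fourier_coeff_synth: "fourier_coeff (synth s u) n = coord u n / of_real (wt s n)"
  by (rule synth_series(3))

text \<open>By uniqueness of Fourier coefficients, identities for \<open>synth\<close> need only be
  checked coefficient by coefficient; linearity and the formula for single modes are obtained in
  this way.\<close>

lemma synth_eqI:
  assumes "continuous_on UNIV f" "\<And>z. f (z + 2 * pi) = f z"
    and "\<And>n. coord u n = of_real (wt s n) * fourier_coeff f n"
  shows "synth s u = f"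
proof
  fix z
  have "synth s u z - f z = 0"
  proof (rule fourier_uniqueness[where f = "\<lambda>z. synth s u z - f z"])
    show "fourier_coeff (\<lambda>z. synth s u z - f z) n = 0" for n
      by (subst fourier_coeff_diff[OF continuous_on_synth assms(1)])
         (simp add: fourier_coeff_synth assms(3))
  qed (auto intro!: continuous_intros continuous_on_synth assms simp: synth_periodic assms(2))
  then show "synth s u z = f z" by simp
qed

lemma synth_add: "synth s (u + v) z = synth s u z + synth s v z"
proof -
  have "synth s (u + v) = (\<lambda>z. synth s u z + synth s v z)"
    by (rule synth_eqI)
       (auto intro!: continuous_intros continuous_on_synth
         simp: synth_periodic fourier_coeff_add continuous_on_synth fourier_coeff_synth divide_simps)
  then show ?thesis by simp
qed

lemma synth_mult: "synth s (mult_coord (\<lambda>_. c) u) z = c * synth s u z"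
proof -
  have "synth s (mult_coord (\<lambda>_. c) u) = (\<lambda>z. c * synth s u z)"
    by (rule synth_eqI)
       (auto intro!: continuous_intros continuous_on_synth
         simp: synth_periodic fourier_coeff_cmult fourier_coeff_synth coord_mult_coord[of "cmod c"])
  then show ?thesis by simp
qed

lemma synth_scaleR: "synth s (r *\<^sub>R u) z = of_real r * synth s u z"
proof -
  have "r *\<^sub>R u = mult_coord (\<lambda>_. of_real r) u"
    by (rule ell2_eqI) (simp add: coord_mult_coord[of "\<bar>r\<bar>"])
  then show ?thesis by (simp add: synth_mult)
qed

lemma synth_diff: "synth s (u - v) z = synth s u z - synth s v z"
  using synth_add[of "u - v" v z] by simp

lemma synth_unit_at: "synth s (unit_at n x) z = x / of_real (wt s n) * cis (of_int n * z)"
proof -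
  have "synth s (unit_at n x) = (\<lambda>z. x / of_real (wt s n) * cis (of_int n * z))"
  proof (rule synth_eqI)
    fix z
    show "x / of_real (wt s n) * cis (of_int n * (z + 2 * pi)) = x / of_real (wt s n) * cis (of_int n * z)"
      using cis_multiple_2pi[of "of_int n"] by (simp add: ring_distribs mult_ac flip: cis_mult)
  qed (auto intro!: continuous_intros simp: fourier_coeff_const_cis simp del: times_divide_eq_left)
  then show ?thesis by simp
qed

text \<open>The majorant of the series is not homogeneous in u, so the bound is taken for the
  normalized sequence and then scaled back.\<close>

lemma norm_synth_le: "cmod (synth s u z) \<le> sup_const * norm u"
proof (cases "u = 0")
  case True
  then show ?thesis by (simp add: synth_def)
next
  case False
  define v where "v = (1 / norm u) *\<^sub>R u"
  have nv: "norm v = 1" using False by (simp add: v_def)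
  then have "(\<Sum>\<^sub>\<infinity>n. (cmod (coord v n))\<^sup>2) = 1"
    by (simp add: norm_ell2_eq L2_norm_def)
  moreover have "(\<lambda>n. (cmod (coord v n))\<^sup>2) summable_on UNIV"
    using coord_L2_space[of v] by (simp add: L2_space_def)
  ultimately have "infsum (\<lambda>n. 1 / 2 * ((cmod (coord v n))\<^sup>2 + 1 / (1 + (real_of_int n)\<^sup>2))) UNIV = sup_const"
    by (simp only: sup_const_def infsum_cmult_right' infsum_add summable_inverse_wt)
  then have "cmod (synth s v z) \<le> sup_const" using synth_series(4)[of v z] by simp
  moreover have "synth s v z = of_real (1 / norm u) * synth s u z"
    unfolding v_def by (rule synth_scaleR)
  ultimately show ?thesis using False by (simp add: norm_mult norm_divide field_simps)
qed

lemma sobolev_weight_eq: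
  "(1 + (of_int n)\<^sup>2) powr s * (cmod (fourier_coeff (synth s u) n))\<^sup>2 = (cmod (coord u n))\<^sup>2"
  by (simp add: fourier_coeff_synth norm_divide power_divide wt_square[symmetric])

lemma synth_in_sobolev [simp]: "synth s u \<in> sobolev s"
  unfolding sobolev_def mem_Collect_eq sobolev_weight_eq
  using coord_L2_space[of u] by (simp add: continuous_on_synth synth_periodic L2_space_def)

lemma sobolev_norm_synth [simp]: "sobolev_norm s (synth s u) = norm u"
  unfolding sobolev_norm_def sobolev_weight_eq by (simp add: norm_ell2_eq L2_norm_def)

text \<open>Surjectivity of the isometry: the weighted coefficients are square summable by
  definition of the space, and uniqueness recovers f from them.\<close>

lemma sobolev_imp_synth:
  assumes "f \<in> sobolev s"
  obtains u where "f = synth s u" "norm u = sobolev_norm s f"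
proof -
  define u where "u = Ell2 (\<lambda>n. of_real (wt s n) * fourier_coeff f n)"
  have "(\<lambda>n. of_real (wt s n) * fourier_coeff f n) \<in> L2_space"
    using assms unfolding L2_space_def sobolev_def
    by (simp add: norm_mult power_mult_distrib wt_square)
  then have "coord u n = of_real (wt s n) * fourier_coeff f n" for n
    by (simp add: u_def Ell2_inverse)
  then have "synth s u = f"
    using assms by (intro synth_eqI) (auto simp: sobolev_def)
  then show ?thesis using that sobolev_norm_synth by metis
qed

lemma sobolev_sup_le:
  assumes "f \<in> sobolev s"
  shows "cmod (f z) \<le> sup_const * sobolev_norm s f"
  using sobolev_imp_synth[OF assms] norm_synth_le by metis

lemma sobolev_add:
  assumes "f \<in> sobolev s" "g \<in> sobolev s"
  shows "(\<lambda>z. f z + g z) \<in> sobolev s"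
proof -
  obtain u v where "f = synth s u" "g = synth s v"
    using sobolev_imp_synth assms by metis
  moreover have "(\<lambda>z. synth s u z + synth s v z) = synth s (u + v)"
    by (simp add: fun_eq_iff synth_add)
  ultimately show "(\<lambda>z. f z + g z) \<in> sobolev s" by simp
qed

lemma sobolev_cmult:
  assumes "f \<in> sobolev s"
  shows "(\<lambda>z. c * f z) \<in> sobolev s"
proof -
  obtain u where "f = synth s u" using sobolev_imp_synth assms by metis
  moreover have "(\<lambda>z. c * synth s u z) = synth s (mult_coord (\<lambda>_. c) u)"
    by (simp add: fun_eq_iff synth_mult)
  ultimately show "(\<lambda>z. c * f z) \<in> sobolev s" by simp
qed

lemma sobolev_diff:
  assumes "f \<in> sobolev s" "g \<in> sobolev s"
  shows "(\<lambda>z. f z - g z) \<in> sobolev s"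
  using sobolev_add[OF assms(1) sobolev_cmult[OF assms(2), of "-1"]] by simp

lemma sobolev_trig: "(\<lambda>z. c * cis (of_int n * z)) \<in> sobolev s"
proof -
  have "(\<lambda>z. c * cis (of_int n * z)) = synth s (unit_at n (c * of_real (wt s n)))"
    by (simp add: fun_eq_iff synth_unit_at)
  then show ?thesis by simp
qed

lemma sobolev_sum:
  assumes "\<And>i. i \<in> I \<Longrightarrow> f i \<in> sobolev s"
  shows "(\<lambda>z. \<Sum>i\<in>I. f i z) \<in> sobolev s"
  using assms
proof (induction I rule: infinite_finite_induct)
  case (insert i I)
  then show ?case using sobolev_add[of "f i" "\<lambda>z. \<Sum>i\<in>I. f i z"] by simp
qed (use sobolev_trig[of 0 0] in auto)

end

section \<open>Power series of operators in the amplitude and the Floquet exponent\<close>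

lemma geometric_pair_has_sum:
  fixes x y :: real
  assumes "0 \<le> x" "x < 1" "0 \<le> y" "y < 1"
  shows "((\<lambda>(k::nat, l::nat). x ^ k * y ^ l) has_sum (1 / (1 - x) * (1 / (1 - y)))) UNIV"
proof -
  have g: "((\<lambda>k. t ^ k) has_sum (1 / (1 - t))) UNIV" if "0 \<le> t" "t < 1" for t :: real
    using geometric_sums[of t] that by (intro sums_nonneg_imp_has_sum) auto
  have "((\<lambda>(k, l). x ^ k * y ^ l) has_sum (1 / (1 - x) * (1 / (1 - y)))) (UNIV \<times> UNIV)"
  proof (rule has_sum_SigmaI)
    show "((\<lambda>l. case (k, l) of (k, l) \<Rightarrow> x ^ k * y ^ l) has_sum (x ^ k * (1 / (1 - y)))) UNIV" for k
      using has_sum_cmult_right[OF g[OF assms(3,4)], of "x ^ k"] by simp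
    show "((\<lambda>k. x ^ k * (1 / (1 - y))) has_sum (1 / (1 - x) * (1 / (1 - y)))) UNIV"
      by (rule has_sum_cmult_left[OF g[OF assms(1,2)]])
    show "(\<lambda>(k::nat, l::nat). x ^ k * y ^ l) summable_on UNIV \<times> UNIV"
    proof (rule summable_on_SigmaI)
      show "((\<lambda>l. case (k, l) of (k, l) \<Rightarrow> x ^ k * y ^ l) has_sum (x ^ k * (1 / (1 - y)))) UNIV" for k
        using has_sum_cmult_right[OF g[OF assms(3,4)], of "x ^ k"] by simp
      show "(\<lambda>k. x ^ k * (1 / (1 - y))) summable_on UNIV"
        using has_sum_cmult_left[OF g[OF assms(1,2)]] by (rule has_sum_imp_summable)
    qed (use assms in auto)
  qed
  then show ?thesis by simp
qed

lemma analytic_at_originE: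
  assumes "analytic_at_origin s Q"
  obtains A K r where "r > 0" "\<And>k l. bounded_op s (K / r ^ (k + l)) (A k l)"
    "\<And>a \<mu> \<psi> n. \<bar>a\<bar> < r \<Longrightarrow> \<bar>\<mu>\<bar> < r \<Longrightarrow> \<psi> \<in> sobolev s \<Longrightarrow>
       ((\<lambda>(k, l). of_real (a ^ k * \<mu> ^ l) * A k l \<psi> n) has_sum Q a \<mu> \<psi> n) UNIV"
proof -
  obtain A K r where *: "r > 0" "\<forall>k l. bounded_op s (K / r ^ (k + l)) (A k l)"
    "\<forall>a \<mu>. \<bar>a\<bar> < r \<longrightarrow> \<bar>\<mu>\<bar> < r \<longrightarrow> (\<forall>\<psi>\<in>sobolev s. \<forall>n.
           ((\<lambda>(k, l). of_real (a ^ k * \<mu> ^ l) * A k l \<psi> n) has_sum Q a \<mu> \<psi> n) UNIV)"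
    using assms unfolding analytic_at_origin_def by (elim exE conjE) (rule that)
  show ?thesis by (rule that[of r K A]) (use * in blast)+
qed

text \<open>Without its constant term the double series is dominated by a geometric one of size
  O(|a| + |\<mu>|). The sum is formed in the sequence space, where the operator norms give absolute
  convergence, so the outcome is a bound in operator norm; its coordinates agree with the given
  coordinatewise sums. Half the radius of convergence keeps both geometric ratios below 1/2.\<close>

lemma analytic_operator_bound:
  assumes s: "s \<ge> 1" and Q: "analytic_at_origin s Q"
  obtains C r where "C \<ge> 0" "r > 0"
    "\<And>a \<mu> u. \<bar>a\<bar> < r \<Longrightarrow> \<bar>\<mu>\<bar> < r \<Longrightarrow>
       (\<lambda>n. Q a \<mu> (synth s u) n - Q 0 0 (synth s u) n) \<in> L2_space \<and>
       L2_norm (\<lambda>n. Q a \<mu> (synth s u) n - Q 0 0 (synth s u) n) \<le> C * (\<bar>a\<bar> + \<bar>\<mu>\<bar>) * norm u"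
proof -
  obtain A K r where r: "r > 0" and A: "\<And>k l. bounded_op s (K / r ^ (k + l)) (A k l)"
    and sum: "\<And>a \<mu> \<psi> n. \<bar>a\<bar> < r \<Longrightarrow> \<bar>\<mu>\<bar> < r \<Longrightarrow> \<psi> \<in> sobolev s \<Longrightarrow>
       ((\<lambda>(k, l). of_real (a ^ k * \<mu> ^ l) * A k l \<psi> n) has_sum Q a \<mu> \<psi> n) UNIV"
    by (rule analytic_at_originE[OF Q]) blast
  have main: "(\<lambda>n. Q a \<mu> (synth s u) n - Q 0 0 (synth s u) n) \<in> L2_space \<and>
       L2_norm (\<lambda>n. Q a \<mu> (synth s u) n - Q 0 0 (synth s u) n)
         \<le> 4 * \<bar>K\<bar> / r * (\<bar>a\<bar> + \<bar>\<mu>\<bar>) * norm u"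
    if a: "\<bar>a\<bar> < r / 2" and \<mu>: "\<bar>\<mu>\<bar> < r / 2" for a \<mu> u
  proof -
    define \<psi> where "\<psi> = synth s u"
    define x where "x = \<bar>a\<bar> / r"
    define y where "y = \<bar>\<mu>\<bar> / r"
    have xy: "0 \<le> x" "x < 1 / 2" "0 \<le> y" "y < 1 / 2"
      using a \<mu> r by (auto simp: x_def y_def field_simps)
    have L2: "A k l \<psi> \<in> L2_space" and A_le: "L2_norm (A k l \<psi>) \<le> \<bar>K\<bar> / r ^ (k + l) * norm u" for k l
    proof -
      have "A k l \<psi> \<in> L2_space \<and> L2_norm (A k l \<psi>) \<le> K / r ^ (k + l) * norm u"
        using A[of k l] synth_in_sobolev[OF s, of u] sobolev_norm_synth[OF s, of u]
        unfolding bounded_op_def \<psi>_def by metis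
      moreover have "K / r ^ (k + l) * norm u \<le> \<bar>K\<bar> / r ^ (k + l) * norm u"
        using r by (intro mult_right_mono divide_right_mono) auto
      ultimately show "A k l \<psi> \<in> L2_space" "L2_norm (A k l \<psi>) \<le> \<bar>K\<bar> / r ^ (k + l) * norm u" by auto
    qed
    define B where "B k l = (a ^ k * \<mu> ^ l) *\<^sub>R Ell2 (A k l \<psi>)" for k l
    define M where "M = (\<lambda>(k::nat, l::nat). \<bar>K\<bar> * norm u * (x ^ k * y ^ l))"
    have B_le: "norm (B k l) \<le> M (k, l)" for k l
    proof -
      have "norm (B k l) = \<bar>a\<bar> ^ k * \<bar>\<mu>\<bar> ^ l * L2_norm (A k l \<psi>)"
        by (simp add: B_def norm_Ell2[OF L2] abs_mult power_abs)
      also have "\<dots> \<le> \<bar>a\<bar> ^ k * \<bar>\<mu>\<bar> ^ l * (\<bar>K\<bar> / r ^ (k + l) * norm u)"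
        by (intro mult_left_mono A_le) auto
      also have "\<dots> = M (k, l)"
        by (simp add: M_def x_def y_def power_divide power_add)
      finally show ?thesis .
    qed
    define S where "S = 1 / (1 - x) * (1 / (1 - y))"
    have M_sum: "(M has_sum (\<bar>K\<bar> * norm u * S)) UNIV"
      using has_sum_cmult_right[OF geometric_pair_has_sum[of x y], of "\<bar>K\<bar> * norm u"] xy
      by (simp add: M_def S_def case_prod_unfold)
    have M_sum': "(M has_sum (\<bar>K\<bar> * norm u * S - M (0, 0))) (- {(0, 0)})"
      using has_sum_Diff[OF M_sum has_sum_finite[of "{(0,0)}" M]] by (simp add: Compl_eq_Diff_UNIV)
    define T where "T = (\<Sum>\<^sub>\<infinity>p\<in>-{(0,0)}. case p of (k, l) \<Rightarrow> B k l)"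
    have T_sum: "((\<lambda>(k, l). B k l) has_sum T) (- {(0, 0)})"
      unfolding T_def
      by (rule has_sum_infsum, rule abs_summable_summable,
          rule summable_on_comparison_test[OF has_sum_imp_summable[OF M_sum']])
         (auto simp: B_le)
    have T_le: "norm T \<le> \<bar>K\<bar> * norm u * S - M (0, 0)"
      by (rule norm_infsum_le[OF T_sum M_sum']) (auto simp: B_le)
    have coord_T: "coord T n = Q a \<mu> \<psi> n - Q 0 0 \<psi> n" for n
    proof -
      have 1: "((\<lambda>(k, l). of_real (a ^ k * \<mu> ^ l) * A k l \<psi> n) has_sum coord T n) (- {(0, 0)})"
        using has_sum_bounded_linear[OF bounded_linear_coord[of n] T_sum]
        by (simp add: case_prod_unfold o_def B_def Ell2_inverse[OF L2])
      have \<psi>: "\<psi> \<in> sobolev s" using s by (simp add: \<psi>_def)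
      have 2: "((\<lambda>(k, l). of_real (a ^ k * \<mu> ^ l) * A k l \<psi> n) has_sum (Q a \<mu> \<psi> n - A 0 0 \<psi> n)) (- {(0, 0)})"
        using has_sum_Diff[OF sum[of a \<mu> \<psi> n] has_sum_finite[of "{(0,0)}"]] a \<mu> r \<psi>
        by (simp add: Compl_eq_Diff_UNIV)
      \<comment> \<open>At the origin exactly the term with k = l = 0 survives, since
        \<open>0 ^ 0 = 1\<close>.\<close>
      have "((\<lambda>(k, l). of_real (0 ^ k * 0 ^ l) * A k l \<psi> n) has_sum A 0 0 \<psi> n) UNIV"
        by (rule has_sum_finite_neutralI[of "{(0, 0)}"]) auto
      then have "Q 0 0 \<psi> n = A 0 0 \<psi> n"
        using has_sum_unique[OF _ sum[of 0 0 \<psi> n]] r \<psi> by simp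
      then show ?thesis using has_sum_unique[OF 1 2] by simp
    qed
    have "S - 1 \<le> 4 * (x + y)"
    proof -
      define d where "d = (1 - x) * (1 - y)"
      have d: "d \<ge> 1 / 2 * (1 / 2)" unfolding d_def using xy by (intro mult_mono) auto
      then have "S - 1 = (1 - d) / d"
        using xy by (simp add: S_def d_def diff_divide_distrib)
      also have "1 - d = x + y - x * y" by (simp add: d_def algebra_simps)
      also have "(x + y - x * y) / d \<le> (x + y) / (1 / 4)"
        using xy d by (intro frac_le) auto
      finally have "S - 1 \<le> (x + y) / (1 / 4)" .
      then show ?thesis by simp
    qed
    then have "\<bar>K\<bar> * norm u * (S - 1) \<le> \<bar>K\<bar> * norm u * (4 * (x + y))"
      by (intro mult_left_mono) auto
    then have "norm T \<le> 4 * \<bar>K\<bar> / r * (\<bar>a\<bar> + \<bar>\<mu>\<bar>) * norm u"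
      using T_le by (simp add: M_def x_def y_def algebra_simps add_divide_distrib)
    moreover have "coord T = (\<lambda>n. Q a \<mu> \<psi> n - Q 0 0 \<psi> n)" using coord_T by auto
    ultimately show ?thesis
      using coord_L2_space[of T] by (simp add: norm_ell2_eq \<psi>_def)
  qed
  show ?thesis
    by (rule that[of "4 * \<bar>K\<bar> / r" "r / 2"]) (use main r in auto)
qed

text \<open>At a = 0 only the terms with k = 0 remain. Applied to the entry of mode 1, this is the
  source of the regularity of j near \<rho>.\<close>

lemma analytic_matrix_entry_sums:
  assumes "analytic_at_origin s Q" "\<psi> \<in> sobolev s"
  obtains g r where "r > 0" "\<And>\<mu>. \<bar>\<mu>\<bar> < r \<Longrightarrow> (\<lambda>l. of_real (\<mu> ^ l) * g l) sums Q 0 \<mu> \<psi> n"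
proof -
  obtain A K r where r: "r > 0"
    and sum: "\<And>a \<mu> \<psi> n. \<bar>a\<bar> < r \<Longrightarrow> \<bar>\<mu>\<bar> < r \<Longrightarrow> \<psi> \<in> sobolev s \<Longrightarrow>
       ((\<lambda>(k, l). of_real (a ^ k * \<mu> ^ l) * A k l \<psi> n) has_sum Q a \<mu> \<psi> n) UNIV"
    by (rule analytic_at_originE[OF assms(1)]) blast
  show ?thesis
  proof (rule that[OF r])
    fix \<mu> :: real assume "\<bar>\<mu>\<bar> < r"
    then have "((\<lambda>(k, l). of_real (0 ^ k * \<mu> ^ l) * A k l \<psi> n) has_sum Q 0 \<mu> \<psi> n) UNIV"
      using sum[of 0 \<mu> \<psi> n] r assms(2) by simp
    then have "((\<lambda>(k, l). of_real (0 ^ k * \<mu> ^ l) * A k l \<psi> n) has_sum Q 0 \<mu> \<psi> n) (range (Pair 0))"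
      by (rule has_sum_cong_neutral[THEN iffD1, rotated -1]) (auto simp: image_iff)
    then have "((\<lambda>l. of_real (\<mu> ^ l) * A 0 l \<psi> n) has_sum Q 0 \<mu> \<psi> n) UNIV"
      by (subst (asm) has_sum_reindex) (auto simp: inj_def o_def)
    then show "(\<lambda>l. of_real (\<mu> ^ l) * A 0 l \<psi> n) sums Q 0 \<mu> \<psi> n"
      by (rule has_sum_imp_sums)
  qed
qed

section \<open>The symbol and the powers of the cosine\<close>

text \<open>Testing the bounded inverse on the unit vector at n gives g with
  \<open>D_symbol j \<rho> n * g n = 1\<close> and |g n| \<le> K. The maximum with 1 makes the
  resulting constant positive.\<close>

lemma D_invertible_symbol_bound:
  assumes "D_invertible j \<rho>"
  obtains K where "K > 0" "\<And>n. n \<noteq> 1 \<Longrightarrow> n \<noteq> -1 \<Longrightarrow> \<bar>D_symbol j \<rho> n\<bar> \<ge> K"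
proof -
  obtain K where K: "\<And>f. f \<in> noncritical_modes \<Longrightarrow> \<exists>g\<in>noncritical_modes.
     (\<forall>n. of_real (D_symbol j \<rho> n) * g n = f n) \<and> L2_norm g \<le> K * L2_norm f"
    using assms unfolding D_invertible_def by blast
  have *: "1 \<le> \<bar>D_symbol j \<rho> n\<bar> * max K 1" if n: "n \<noteq> 1" "n \<noteq> -1" for n
  proof -
    have "coord (unit_at n 1) \<in> noncritical_modes"
      using n by (auto simp: noncritical_modes_def)
    then obtain g where g: "g \<in> noncritical_modes"
      "\<And>m. of_real (D_symbol j \<rho> m) * g m = coord (unit_at n 1) m"
      "L2_norm g \<le> K * L2_norm (coord (unit_at n 1))"
      using K by blast
    have "L2_norm g \<le> K" using g(3) norm_unit_at[of n 1] by (simp add: norm_ell2_eq)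
    then have "cmod (g n) \<le> max K 1"
      using L2_norm_ge_coeff[of g n] g(1) by (simp add: noncritical_modes_def)
    moreover have "\<bar>D_symbol j \<rho> n\<bar> * cmod (g n) = 1"
      using arg_cong[OF g(2)[of n], of cmod] by (simp add: norm_mult)
    ultimately show ?thesis by (metis abs_ge_zero mult_left_mono)
  qed
  show ?thesis
    by (rule that[of "1 / max K 1"]) (use * in \<open>auto simp: field_simps\<close>)
qed

text \<open>Ellipticity of the unperturbed operator on the tail. Since s - 1 is the maximum of 0 and
  \<sigma>, the uniform bound from \<open>D_invertible\<close> is enough for \<sigma> \<le> 0. For
  \<sigma> > 0 the growth of j takes over at large frequencies, and the uniform bound covers the
  bounded range that is left.\<close>

lemma tail_symbol_bound:
  fixes j :: "real \<Rightarrow> real"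
  assumes even: "\<And>k. j (- k) = j k" and \<rho>: "\<rho> > 0" and D: "D_invertible j \<rho>"
    and growth: "C\<^sub>1 > 0" "\<forall>\<^sub>F k in at_top. C\<^sub>1 * k powr \<sigma> \<le> j k"
  obtains c\<^sub>0 where "c\<^sub>0 > 0"
    "\<And>n. \<bar>n\<bar> \<ge> 2 \<Longrightarrow> c\<^sub>0 * wt (sobolev_exponent \<sigma>) n \<le> \<bar>of_int n\<bar> * \<bar>D_symbol j \<rho> n\<bar>"
proof -
  define s where "s = sobolev_exponent \<sigma>"
  have s1: "s \<ge> 1" by (simp add: s_def sobolev_exponent_def)
  obtain K where K: "K > 0" "\<And>n. n \<noteq> 1 \<Longrightarrow> n \<noteq> -1 \<Longrightarrow> \<bar>D_symbol j \<rho> n\<bar> \<ge> K"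
    using D_invertible_symbol_bound[OF D] by blast
  have "\<exists>c>0. \<forall>n. \<bar>n\<bar> \<ge> 2 \<longrightarrow> c * \<bar>of_int n\<bar> powr (s - 1) \<le> \<bar>D_symbol j \<rho> n\<bar>"
  proof (cases "\<sigma> \<le> 0")
    case True
    then have "s - 1 = 0" by (simp add: s_def sobolev_exponent_def)
    then show ?thesis using K by (intro exI[of _ K]) auto
  next
    case False
    then have \<sigma>: "\<sigma> > 0" and s: "s - 1 = \<sigma>" by (auto simp: s_def sobolev_exponent_def)
    \<comment> \<open>From \<open>T powr (1 / \<sigma>)\<close> on, j \<rho> is at most half of the
      lower growth bound. The maximum with 1 keeps \<open>T\<close> positive, so that the powers
      cancel.\<close>
    define T where "T = max 1 (2 / C\<^sub>1 * j \<rho>)"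
    have "2 / C\<^sub>1 * j \<rho> \<le> k powr \<sigma>" if "k \<ge> T powr (1 / \<sigma>)" for k
    proof -
      have "T = (T powr (1 / \<sigma>)) powr \<sigma>" using \<sigma> by (simp add: powr_powr T_def)
      also have "\<dots> \<le> k powr \<sigma>" using that \<sigma> by (intro powr_mono2) auto
      finally show ?thesis by (simp add: T_def)
    qed
    then have "\<forall>\<^sub>F k in at_top. 2 / C\<^sub>1 * j \<rho> \<le> k powr \<sigma>"
      unfolding eventually_at_top_linorder by blast
    with growth(2) have "\<forall>\<^sub>F k in at_top. C\<^sub>1 / 2 * k powr \<sigma> \<le> j k - j \<rho>"
    proof eventually_elim
      case (elim k)
      then have "j \<rho> \<le> C\<^sub>1 / 2 * k powr \<sigma>" using growth(1) by (simp add: field_simps)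
      then show ?case using elim by simp
    qed
    then obtain X where X: "\<And>k. k \<ge> X \<Longrightarrow> C\<^sub>1 / 2 * k powr \<sigma> \<le> j k - j \<rho>"
      unfolding eventually_at_top_linorder by blast
    define Y where "Y = max X \<rho> / \<rho>"
    have Y: "Y > 0" using \<rho> by (simp add: Y_def)
    \<comment> \<open>The first constant serves the frequencies with \<rho> |n| \<ge> X, the second
      the others, for which |n| \<le> Y. The maximum with \<rho> inside \<open>Y\<close> keeps
      \<open>Y\<close> positive.\<close>
    define c where "c = min (C\<^sub>1 / 2 * \<rho> powr \<sigma>) (K / Y powr \<sigma>)"
    have "c * \<bar>of_int n\<bar> powr \<sigma> \<le> \<bar>D_symbol j \<rho> n\<bar>" if n: "\<bar>n\<bar> \<ge> 2" for n
    proof (cases "\<rho> * \<bar>of_int n\<bar> \<ge> X")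
      case True
      have "c * \<bar>of_int n\<bar> powr \<sigma> \<le> C\<^sub>1 / 2 * \<rho> powr \<sigma> * \<bar>of_int n\<bar> powr \<sigma>"
        unfolding c_def by (intro mult_right_mono min.cobounded1) auto
      also have "\<dots> = C\<^sub>1 / 2 * (\<rho> * \<bar>of_int n\<bar>) powr \<sigma>"
        using \<rho> by (simp add: powr_mult)
      also have "\<dots> \<le> j (\<rho> * \<bar>of_int n\<bar>) - j \<rho>" by (rule X[OF True])
      also have "j (\<rho> * \<bar>of_int n\<bar>) = j (\<rho> * of_int n)"
        using even[of "\<rho> * of_int n"] by (auto simp: abs_if)
      finally show ?thesis by (simp add: D_symbol_def)
    next
      case False
      then have "\<bar>of_int n\<bar> \<le> Y" using \<rho> by (simp add: Y_def field_simps)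
      then have "\<bar>of_int n\<bar> powr \<sigma> \<le> Y powr \<sigma>" using \<sigma> by (intro powr_mono2) auto
      then have "c * \<bar>of_int n\<bar> powr \<sigma> \<le> K / Y powr \<sigma> * Y powr \<sigma>"
        using K Y by (intro mult_mono) (auto simp: c_def)
      also have "\<dots> = K" using Y by simp
      also have "\<dots> \<le> \<bar>D_symbol j \<rho> n\<bar>" using n by (intro K) auto
      finally show ?thesis .
    qed
    moreover have "c > 0" using growth \<rho> K Y by (simp add: c_def)
    ultimately show ?thesis unfolding s by blast
  qed
  then obtain c where c: "c > 0"
    "\<And>n. \<bar>n\<bar> \<ge> 2 \<Longrightarrow> c * \<bar>of_int n\<bar> powr (s - 1) \<le> \<bar>D_symbol j \<rho> n\<bar>" by blast
  \<comment> \<open>The divisor comes from 1 + n^2 \<le> 2 n^2 for n different from 0. Of the power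
    |n|^s, one factor |n| is supplied by the derivative and the rest by the symbol.\<close>
  have "c / 2 powr (s / 2) * wt s n \<le> \<bar>of_int n\<bar> * \<bar>D_symbol j \<rho> n\<bar>" if n: "\<bar>n\<bar> \<ge> 2" for n
  proof -
    define x where "x = \<bar>real_of_int n\<bar>"
    have x: "x \<ge> 1" using n by (simp add: x_def)
    have "1 + (real_of_int n)\<^sup>2 \<le> 2 * x\<^sup>2" using x one_le_power[of x 2] by (simp add: x_def)
    then have "wt s n \<le> (2 * x\<^sup>2) powr (s / 2)"
      unfolding wt_def using s1 by (intro powr_mono2) auto
    also have "\<dots> = 2 powr (s / 2) * x powr s"
    proof -
      have "x\<^sup>2 = x powr 2" using x by simp
      then show ?thesis by (simp only: powr_mult powr_powr) simp
    qed
    finally have "c / 2 powr (s / 2) * wt s n \<le> c / 2 powr (s / 2) * (2 powr (s / 2) * x powr s)"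
      using c by (intro mult_left_mono) auto
    also have "\<dots> = x * (c * x powr (s - 1))" using x by (simp add: powr_diff)
    also have "\<dots> \<le> x * \<bar>D_symbol j \<rho> n\<bar>"
      using c(2)[OF n] x by (intro mult_left_mono) (auto simp: x_def)
    finally show ?thesis by (simp add: x_def)
  qed
  then show ?thesis using c by (intro that[of "c / 2 powr (s / 2)"]) (auto simp: s_def)
qed

section \<open>Fourier coefficients of powers of the cosine\<close>

lemma fourier_coeff_trig_sum:
  "finite I \<Longrightarrow> fourier_coeff (\<lambda>z. \<Sum>k\<in>I. c k * cis (of_int (m k) * z)) n
    = (\<Sum>k\<in>I. if m k = n then c k else 0)"
proof (induction I rule: finite_induct)
  case empty
  then show ?case by (simp add: fourier_coeff_def)
next
  case (insert i I)
  have "fourier_coeff (\<lambda>z. c i * cis (of_int (m i) * z) + (\<Sum>k\<in>I. c k * cis (of_int (m k) * z))) n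
      = (if m i = n then c i else 0) + (\<Sum>k\<in>I. if m k = n then c k else 0)"
    by (subst fourier_coeff_add) (auto intro!: continuous_intros simp: insert fourier_coeff_const_cis)
  then show ?case using insert by simp
qed

lemma cos_power_trig_sum:
  "complex_of_real (cos z ^ M)
    = (\<Sum>k\<le>M. of_real (real (M choose k) / 2 ^ M) * cis (of_int (2 * int k - int M) * z))"
proof -
  have "complex_of_real (cos z) = (cis z + cis (- z)) / 2"
    by (simp add: complex_eq_iff)
  then have "complex_of_real (cos z ^ M) = (cis z + cis (- z)) ^ M / 2 ^ M"
    by (simp only: of_real_power power_divide)
  also have "(cis z + cis (- z)) ^ M = (\<Sum>k\<le>M. of_nat (M choose k) * cis z ^ k * cis (- z) ^ (M - k))"
    by (rule binomial_ring)
  also have "\<dots> = (\<Sum>k\<le>M. of_nat (M choose k) * cis (of_int (2 * int k - int M) * z))"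
  proof (rule sum.cong)
    fix k assume "k \<in> {..M}"
    then have "real k * z + real (M - k) * (- z) = of_int (2 * int k - int M) * z"
      by (simp add: of_nat_diff algebra_simps)
    then have "cis z ^ k * cis (- z) ^ (M - k) = cis (of_int (2 * int k - int M) * z)"
      by (simp only: Complex.DeMoivre cis_mult)
    then show "of_nat (M choose k) * cis z ^ k * cis (- z) ^ (M - k)
        = of_nat (M choose k) * cis (of_int (2 * int k - int M) * z)"
      by (simp only: mult.assoc)
  qed simp
  finally show ?thesis by (simp add: sum_divide_distrib)
qed

lemma fourier_coeff_cos_power:
  "fourier_coeff (\<lambda>z. complex_of_real (cos z ^ M)) n
    = (\<Sum>k\<le>M. if 2 * int k - int M = n then of_real (real (M choose k) / 2 ^ M) else 0)"
  unfolding cos_power_trig_sum by (rule fourier_coeff_trig_sum) simp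

text \<open>\<open>cos_mean q\<close> and \<open>cos_second q\<close> are the Fourier coefficients
  of the power 2 q of the cosine at the frequencies 0 and \<plusminus>2. The former enters the
  diagonal of the leading block, the latter couples the modes 1 and -1.\<close>

definition cos_mean :: "nat \<Rightarrow> real" where
  "cos_mean q = real ((2 * q) choose q) / 4 ^ q"

definition cos_second :: "nat \<Rightarrow> real" where
  "cos_second q = real ((2 * q) choose (q - 1)) / 4 ^ q"

lemma fourier_coeff_cos_even_power:
  assumes "q \<ge> 1"
  shows "fourier_coeff (\<lambda>z. complex_of_real (cos z ^ (2 * q))) 0 = of_real (cos_mean q)"
    and "fourier_coeff (\<lambda>z. complex_of_real (cos z ^ (2 * q))) 2 = of_real (cos_second q)"
    and "fourier_coeff (\<lambda>z. complex_of_real (cos z ^ (2 * q))) (-2) = of_real (cos_second q)"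
    and "odd n \<Longrightarrow> fourier_coeff (\<lambda>z. complex_of_real (cos z ^ (2 * q))) n = 0"
proof -
  have 4: "(2::real) ^ (2 * q) = 4 ^ q" by (simp add: power_mult)
  have *: "fourier_coeff (\<lambda>z. complex_of_real (cos z ^ (2 * q))) (2 * int p - 2 * int q)
      = of_real (real ((2 * q) choose p) / 4 ^ q)" if "p \<le> 2 * q" for p
    unfolding fourier_coeff_cos_power 4 using that by (simp add: sum.delta eq_commute[of p])
  show "fourier_coeff (\<lambda>z. complex_of_real (cos z ^ (2 * q))) 0 = of_real (cos_mean q)"
    using *[of q] by (simp add: cos_mean_def)
  have "(2 * q) choose (q + 1) = (2 * q) choose (q - 1)"
    using assms binomial_symmetric[of "q + 1" "2 * q"] by simp
  then show "fourier_coeff (\<lambda>z. complex_of_real (cos z ^ (2 * q))) 2 = of_real (cos_second q)"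
    using *[of "q + 1"] assms by (simp add: cos_second_def)
  show "fourier_coeff (\<lambda>z. complex_of_real (cos z ^ (2 * q))) (-2) = of_real (cos_second q)"
    using *[of "q - 1"] assms by (simp add: cos_second_def of_nat_diff)
  show "fourier_coeff (\<lambda>z. complex_of_real (cos z ^ (2 * q))) n = 0" if "odd n"
    unfolding fourier_coeff_cos_power using that by (intro sum.neutral) auto
qed

lemma cos_second_pos: "q \<ge> 1 \<Longrightarrow> cos_second q > 0"
  by (simp add: cos_second_def)

lemma cos_mean_nonneg: "cos_mean q \<ge> 0"
  by (simp add: cos_mean_def)

text \<open>With N = 2 q + 1 this yields \<open>c_tau N \<alpha> - N * \<alpha> * cos_mean q = -
  \<alpha> * N * cos_second q\<close>: diagonal shift and coupling cancel on the sine, as they must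
  because the derivative of the wave solves the linearized equation at \<mu> = 0.\<close>

lemma cos_mean_second_relation:
  assumes "q \<ge> 1"
  shows "real q * cos_mean q = (real q + 1) * cos_second q"
proof -
  have "Suc (q - 1) * ((2 * q) choose Suc (q - 1)) = (2 * q - (q - 1)) * ((2 * q) choose (q - 1))"
    by (simp only: binomial_absorption binomial_absorb_comp)
  then have "q * ((2 * q) choose q) = (q + 1) * ((2 * q) choose (q - 1))"
    using assms by (simp add: Suc_diff_le)
  then have "real q * real ((2 * q) choose q) = (real q + 1) * real ((2 * q) choose (q - 1))"
    by (metis of_nat_1 of_nat_add of_nat_mult)
  then show ?thesis by (simp add: cos_mean_def cos_second_def)
qed

text \<open>The integrand is the power 2 (q + 1) of the cosine, whose mean is a central binomial
  coefficient. Applying the rule of Pascal twice expresses it through the two coefficients for q, so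
  that \<open>c_tau\<close> can be compared with the potential.\<close>

lemma circle_inner_cos_power:
  assumes "q \<ge> 1"
  shows "circle_inner (\<lambda>z. cos z ^ (2 * q + 1)) cos = cos_mean q + cos_second q"
proof -
  define I where "I = integral {0..2*pi} (\<lambda>z. cos z ^ (2 * (q + 1)))"
  have "of_real I = fourier_coeff (\<lambda>z. complex_of_real (cos z ^ (2 * (q + 1)))) 0 * (2 * pi)"
    using integral_interval_of_real[of 0 "2 * pi" "\<lambda>z. cos z ^ (2 * (q + 1))"]
    by (simp add: fourier_coeff_def I_def continuous_intros)
  also have "\<dots> = of_real (cos_mean (q + 1) * (2 * pi))"
    by (subst fourier_coeff_cos_even_power(1)) auto
  finally have I: "I = cos_mean (q + 1) * (2 * pi)" using of_real_eq_iff by blast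
  have "(2 * (q + 1)) choose (q + 1) = 2 * (((2 * q) choose q) + ((2 * q) choose (q - 1)))"
  proof -
    have "(2 * (q + 1)) choose (q + 1) = ((2 * q + 1) choose (q + 1)) + ((2 * q + 1) choose q)"
      by simp
    moreover have "(2 * q + 1) choose (q + 1) = (2 * q + 1) choose q"
      using binomial_symmetric[of "q + 1" "2 * q + 1"] by simp
    moreover have "(2 * q + 1) choose q = ((2 * q) choose q) + ((2 * q) choose (q - 1))"
      using assms choose_reduce_nat[of "2 * q + 1" q] by simp
    ultimately show ?thesis by simp
  qed
  then have "real ((2 * (q + 1)) choose (q + 1)) = 2 * (real ((2 * q) choose q) + real ((2 * q) choose (q - 1)))"
    by (simp only: of_nat_mult of_nat_add of_nat_numeral)
  then have "2 * cos_mean (q + 1) = cos_mean q + cos_second q"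
    unfolding cos_mean_def cos_second_def by (simp only:) (simp add: field_simps)
  moreover have "circle_inner (\<lambda>z. cos z ^ (2 * q + 1)) cos = I / pi"
    by (simp add: circle_inner_def I_def mult.commute)
  ultimately show ?thesis using I by simp
qed

text \<open>The power of the cosine has no frequency beyond N, so the infinite sum in
  \<open>D_inverse\<close> reduces to a trigonometric polynomial.\<close>

lemma eta_N_in_sobolev:
  assumes "s \<ge> 1"
  shows "eta_N j \<rho> N \<alpha> \<in> sobolev s"
proof -
  define k where "k = circle_inner (\<lambda>x. cos x ^ N) cos"
  define f where "f = (\<lambda>y. complex_of_real (cos y ^ N - k * cos y))"
  define d where "d n = fourier_coeff f n / of_real (D_symbol j \<rho> n)" for n
  have "fourier_coeff f n = 0" if n: "\<bar>n\<bar> > int N" "n \<noteq> 1" "n \<noteq> -1" for n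
  proof -
    have f: "f y = complex_of_real (cos y ^ N) - of_real k * complex_of_real (cos y ^ 1)" for y
      by (simp add: f_def)
    have "fourier_coeff (\<lambda>z. complex_of_real (cos z ^ N)) n = 0"
      unfolding fourier_coeff_cos_power using n by (intro sum.neutral) auto
    moreover have "fourier_coeff (\<lambda>z. complex_of_real (cos z ^ 1)) n = 0"
      unfolding fourier_coeff_cos_power using n by (intro sum.neutral) auto
    ultimately show ?thesis
      unfolding f by (subst fourier_coeff_diff) (auto intro!: continuous_intros simp: fourier_coeff_cmult simp del: power_one_right)
  qed
  then have d0: "d n = 0" if "n \<notin> {- int N..int N}" "n \<notin> {1, -1}" for n
    using that by (auto simp: d_def)
  have "eta_N j \<rho> N \<alpha> = (\<lambda>z. of_real \<alpha> * (\<Sum>n\<in>{- int N..int N} - {1, -1}. d n * cis (of_int n * z)))"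
  proof
    fix z
    have "D_inverse j \<rho> f z = (\<Sum>\<^sub>\<infinity>n\<in>- {1, -1}. d n * cis (of_int n * z))"
      by (simp add: D_inverse_def d_def)
    also have "\<dots> = (\<Sum>\<^sub>\<infinity>n\<in>{- int N..int N} - {1, -1}. d n * cis (of_int n * z))"
      by (rule infsum_cong_neutral) (use d0 in auto)
    finally show "eta_N j \<rho> N \<alpha> z
        = of_real \<alpha> * (\<Sum>n\<in>{- int N..int N} - {1, -1}. d n * cis (of_int n * z))"
      by (simp add: eta_N_def f_def k_def)
  qed
  then show ?thesis
    using assms by (simp only:) (intro sobolev_cmult sobolev_sum sobolev_trig)
qed

text \<open>
  The asymptotic expansions of the family say nothing about the amplitude \<open>a = 0\<close> itself; there the
  wave and its speed are determined by analyticity.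
\<close>

lemma powser_value_at_0:
  fixes f :: "real \<Rightarrow> complex"
  assumes "\<delta> > 0" "\<And>a. \<bar>a\<bar> < \<delta> \<Longrightarrow> (\<lambda>k. c k * of_real a ^ k) sums f a" "(f \<longlongrightarrow> L) (at 0)"
  shows "f 0 = L"
proof -
  define K where "K = complex_of_real (\<delta> / 2)"
  have "summable (\<lambda>k. c k * K ^ k)"
    using assms(2)[of "\<delta> / 2"] assms(1) unfolding K_def by (auto simp: sums_iff)
  then have "isCont (\<lambda>x. \<Sum>k. c k * x ^ k) 0"
    by (rule isCont_powser) (use assms(1) in \<open>simp add: K_def\<close>)
  then have "isCont (\<lambda>a. \<Sum>k. c k * complex_of_real a ^ k) 0"
    by (intro isCont_o2[where g = "\<lambda>x. \<Sum>k. c k * x ^ k" and f = complex_of_real]) auto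
  moreover have "\<forall>\<^sub>F a in nhds 0. (\<Sum>k. c k * complex_of_real a ^ k) = f a"
    unfolding eventually_nhds_metric using assms(1,2) by (auto simp: sums_iff dist_norm)
  ultimately have "isCont f 0"
    by (simp only: isCont_cong)
  then have "(f \<longlongrightarrow> f 0) (at 0)" by (simp add: isCont_def)
  then show ?thesis using assms(3) tendsto_unique by (metis trivial_limit_at)
qed

text \<open>The expanded function is the imaginary part of the entry of mode 1 at a = 0. Solving for
  j expresses it near \<rho> through a convergent power series, which proves that j is twice
  differentiable there. The factor 1 + \<mu> from the derivative mixes the first derivative of j
  into the second order coefficient; this is the origin of the combination in
  \<open>Delta_odd\<close>.\<close>

lemma symbol_second_order:
  fixes j :: "real \<Rightarrow> real"
  assumes \<rho>: "\<rho> > 0" and r: "r > 0"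
    and sums: "\<And>\<mu>. \<bar>\<mu>\<bar> < r \<Longrightarrow> (\<lambda>l. h l * \<mu> ^ l) sums ((1 + \<mu>) * (j \<rho> - j (\<rho> * (1 + \<mu>))))"
  obtains E where "isCont E 0" "E 0 = - (\<rho> * deriv j \<rho> + 1 / 2 * \<rho>\<^sup>2 * deriv (deriv j) \<rho>)"
    "\<And>\<mu>. \<bar>\<mu>\<bar> < r \<Longrightarrow> (1 + \<mu>) * (j \<rho> - j (\<rho> * (1 + \<mu>))) = - \<rho> * deriv j \<rho> * \<mu> + \<mu>\<^sup>2 * E \<mu>"
proof -
  define G where "G \<mu> = (\<Sum>l. h l * \<mu> ^ l)" for \<mu>
  define G1 where "G1 \<mu> = (\<Sum>l. diffs h l * \<mu> ^ l)" for \<mu>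
  define G2 where "G2 \<mu> = (\<Sum>l. diffs (diffs h) l * \<mu> ^ l)" for \<mu>
  have sm: "summable (\<lambda>l. h l * \<mu> ^ l)" if "norm \<mu> < r" for \<mu>
    using sums[of \<mu>] that by (simp add: sums_iff)
  have sm1: "summable (\<lambda>l. diffs h l * \<mu> ^ l)" if "norm \<mu> < r" for \<mu>
    using that sm by (rule termdiff_converges)
  have G: "G \<mu> = (1 + \<mu>) * (j \<rho> - j (\<rho> * (1 + \<mu>)))" if "\<bar>\<mu>\<bar> < r" for \<mu>
    using sums[OF that] by (simp add: G_def sums_iff)
  have dG: "(G has_real_derivative G1 \<mu>) (at \<mu>)" if "\<bar>\<mu>\<bar> < r" for \<mu>
    unfolding G_def G1_def by (rule termdiffs_strong'[OF sm]) (use that in auto)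
  have dG1: "(G1 has_real_derivative G2 \<mu>) (at \<mu>)" if "\<bar>\<mu>\<bar> < r" for \<mu>
    unfolding G1_def G2_def by (rule termdiffs_strong'[OF sm1]) (use that in auto)
  have G0: "G 0 = 0" "h 0 = 0" using G[of 0] r by (simp_all add: G_def)
  have G1_0: "G1 0 = h 1" and G2_0: "G2 0 = 2 * h 2"
    by (simp_all add: G1_def G2_def diffs_def numeral_2_eq_2)
  \<comment> \<open>The cap 1 keeps the interval inside the positive reals, so that solving for j by
    dividing by k is legitimate.\<close>
  define r' where "r' = min r 1"
  define S where "S = {\<rho> - \<rho> * r'<..<\<rho> + \<rho> * r'}"
  have S: "\<bar>k / \<rho> - 1\<bar> < r'" if "k \<in> S" for k
    using that \<rho> by (auto simp: S_def abs_less_iff field_simps)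
  have \<rho>S: "\<rho> \<in> S" and openS: "open S" using \<rho> r by (auto simp: S_def r'_def)
  have pos: "k > 0" if "k \<in> S" for k
  proof -
    have "\<rho> * r' \<le> \<rho> * 1" using \<rho> by (intro mult_left_mono) (auto simp: r'_def)
    then show ?thesis using that by (simp add: S_def)
  qed
  have j: "j k = j \<rho> - G (k / \<rho> - 1) * \<rho> / k" if "k \<in> S" for k
    using G[of "k / \<rho> - 1"] S[OF that] pos[OF that] \<rho> by (simp add: r'_def field_simps)
  define F where "F k = - (G1 (k / \<rho> - 1) * (1 / \<rho>) * \<rho> * k - G (k / \<rho> - 1) * \<rho>) / (k * k)" for k
  have dj: "(j has_real_derivative F k) (at k)" if k: "k \<in> S" for k
  proof -
    have "((\<lambda>k. j \<rho> - G (k / \<rho> - 1) * \<rho> / k) has_real_derivative F k) (at k)"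
      unfolding F_def using pos[OF k] \<rho> S[OF k]
      by (auto intro!: derivative_eq_intros DERIV_chain2[OF dG] simp: r'_def)
         (simp add: field_simps)
    then show ?thesis
      by (rule has_field_derivative_transform_within_open[OF _ openS k]) (simp add: j)
  qed
  have derivj: "deriv j k = F k" if "k \<in> S" for k
    using dj[OF that] by (rule DERIV_imp_deriv)
  have d2j: "(deriv j has_real_derivative (- (G2 0) + 2 * G1 0) / \<rho>\<^sup>2) (at \<rho>)"
  proof -
    have "(F has_real_derivative (- (G2 0) + 2 * G1 0) / \<rho>\<^sup>2) (at \<rho>)"
      unfolding F_def using \<rho> r G0
      by (auto intro!: derivative_eq_intros DERIV_chain2[OF dG] DERIV_chain2[OF dG1] simp: G0 power2_eq_square)
         (simp add: field_simps power2_eq_square)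
    then show ?thesis
      by (rule has_field_derivative_transform_within_open[OF _ openS \<rho>S]) (simp add: derivj)
  qed
  have j1: "\<rho> * deriv j \<rho> = - h 1"
    using \<rho> by (simp add: derivj[OF \<rho>S] F_def G0 G1_0)
  have j2: "\<rho>\<^sup>2 * deriv (deriv j) \<rho> = - (2 * h 2) + 2 * h 1"
    using \<rho> DERIV_imp_deriv[OF d2j] by (simp add: G1_0 G2_0)
  \<comment> \<open>Taking the shifted series instead of the quotient by \<mu>^2 makes the remainder
    continuous at 0, where its value is the second coefficient.\<close>
  define E where "E \<mu> = (\<Sum>l. h (l + 2) * \<mu> ^ l)" for \<mu>
  have E_sums: "(\<lambda>l. h (l + 2) * \<mu> ^ l) sums ((G \<mu> - h 1 * \<mu>) / \<mu>\<^sup>2)" if "\<bar>\<mu>\<bar> < r" "\<mu> \<noteq> 0" for \<mu>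
  proof -
    have "(\<lambda>l. h (l + 2) * \<mu> ^ (l + 2)) sums (G \<mu> - (\<Sum>l<2. h l * \<mu> ^ l))"
      using sums[OF that(1)] G[OF that(1)] by (intro sums_split_initial_segment) simp
    from sums_divide[OF this, of "\<mu>\<^sup>2"] show ?thesis
      using that(2) by (simp add: numeral_2_eq_2 G0 power_add)
  qed
  show ?thesis
  proof
    have "summable (\<lambda>l. h (l + 2) * (r / 2) ^ l)" using E_sums[of "r / 2"] r by (auto simp: sums_iff)
    then show "isCont E 0" unfolding E_def by (rule isCont_powser) (use r in simp)
    show "E 0 = - (\<rho> * deriv j \<rho> + 1 / 2 * \<rho>\<^sup>2 * deriv (deriv j) \<rho>)"
    proof -
      have "E 0 = h 2" by (simp add: E_def numeral_2_eq_2)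
      then show ?thesis unfolding mult.assoc j1 j2 by (simp add: field_simps)
    qed
    show "(1 + \<mu>) * (j \<rho> - j (\<rho> * (1 + \<mu>))) = - \<rho> * deriv j \<rho> * \<mu> + \<mu>\<^sup>2 * E \<mu>" if "\<bar>\<mu>\<bar> < r" for \<mu>
    proof (cases "\<mu> = 0")
      case False
      have "E \<mu> = (G \<mu> - h 1 * \<mu>) / \<mu>\<^sup>2" using E_sums[OF that False] by (simp add: E_def sums_iff)
      then show ?thesis using False j1 by (simp add: G[OF that, symmetric])
    qed simp
  qed
qed

section \<open>The unstable eigenvalue\<close>

text \<open>The order of choice is r, then \<theta>, then \<epsilon>: r depends on s alone, \<theta>
  tames the constant C, and \<epsilon> has to beat 1/\<theta>. Collecting the terms with r, with C
  \<theta> and with \<epsilon>, each group is given at most 1/8 of the Lipschitz budget 1/2. Writing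
  C + 1 in \<theta> avoids a division by zero when C = 0.\<close>

lemma contraction_constants:
  fixes s C c\<^sub>0 :: real
  assumes "s > 0" "C \<ge> 0" "c\<^sub>0 > 0"
  obtains r \<theta> \<epsilon>\<^sub>0 where "0 < r" "r \<le> s / 2" "0 < \<theta>" "\<theta> \<le> 1" "\<epsilon>\<^sub>0 > 0"
    "\<And>\<epsilon> g b. 0 \<le> \<epsilon> \<Longrightarrow> \<epsilon> \<le> \<epsilon>\<^sub>0 \<Longrightarrow> \<bar>g\<bar> \<le> \<epsilon> \<Longrightarrow> b\<^sup>2 \<le> \<epsilon> \<Longrightarrow>
       (\<epsilon> + C * \<theta> + r) / s + (2 * (\<epsilon> + C * \<theta>) + r) + (\<epsilon> + C * \<theta> + 2 * r) / s
        + ((\<bar>g\<bar> + b\<^sup>2 * (s + 2 * r)) / c\<^sub>0 + \<epsilon> / \<theta>) \<le> 1 / 2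
       \<and> 4 * \<epsilon> / s + 4 * \<epsilon> + 2 * \<epsilon> / \<theta> \<le> r / 2"
proof -
  define r where "r = min (s / 2) (1 / (8 * (3 / s + 1)))"
  define \<theta> where "\<theta> = min 1 (1 / (8 * ((C + 1) * (2 / s + 2))))"
  define A where "A = 2 / s + 2 + (1 + s + 2 * r) / c\<^sub>0 + 1 / \<theta>"
  define B where "B = 4 / s + 4 + 2 / \<theta>"
  define \<epsilon>\<^sub>0 where "\<epsilon>\<^sub>0 = min (1 / (8 * A)) (r / 2 / B)"
  have r: "0 < r" "r \<le> s / 2" using assms by (auto simp: r_def add_pos_pos)
  have "r \<le> 1 / (8 * (3 / s + 1))" by (simp add: r_def)
  then have r2: "r * (3 / s + 1) \<le> 1 / 8" using assms by (simp add: field_simps add_pos_pos)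
  have \<theta>: "0 < \<theta>" "\<theta> \<le> 1" using assms by (auto simp: \<theta>_def add_pos_pos add_nonneg_pos)
  define y where "y = (C + 1) * (2 / s + 2)"
  have "y > 0" using assms by (simp add: y_def add_pos_pos add_nonneg_pos)
  moreover have "\<theta> \<le> 1 / (8 * y)" by (simp add: \<theta>_def y_def)
  ultimately have "\<theta> * y \<le> 1 / 8" by (simp add: field_simps)
  then have "\<theta> * ((C + 1) * (2 / s + 2)) \<le> 1 / 8" by (simp only: y_def)
  moreover have "C * (\<theta> * (2 / s + 2)) \<le> (C + 1) * (\<theta> * (2 / s + 2))"
    using assms \<theta> by (intro mult_right_mono) auto
  then have "C * \<theta> * (2 / s + 2) \<le> \<theta> * ((C + 1) * (2 / s + 2))"
    by (simp only: mult_ac)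
  ultimately have \<theta>2: "C * \<theta> * (2 / s + 2) \<le> 1 / 8" by linarith
  have A: "A > 0" using assms r \<theta> by (simp add: A_def add_pos_pos)
  have B: "B > 0" using assms \<theta> by (simp add: B_def add_pos_pos)
  have "\<epsilon>\<^sub>0 > 0" using A B r by (simp add: \<epsilon>\<^sub>0_def)
  moreover have "(\<epsilon> + C * \<theta> + r) / s + (2 * (\<epsilon> + C * \<theta>) + r) + (\<epsilon> + C * \<theta> + 2 * r) / s
        + ((\<bar>g\<bar> + b\<^sup>2 * (s + 2 * r)) / c\<^sub>0 + \<epsilon> / \<theta>) \<le> 1 / 2
       \<and> 4 * \<epsilon> / s + 4 * \<epsilon> + 2 * \<epsilon> / \<theta> \<le> r / 2"
    if \<epsilon>: "0 \<le> \<epsilon>" "\<epsilon> \<le> \<epsilon>\<^sub>0" "\<bar>g\<bar> \<le> \<epsilon>" "b\<^sup>2 \<le> \<epsilon>" for \<epsilon> g b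
  proof
    have "\<epsilon> \<le> 1 / (8 * A)" "\<epsilon> \<le> r / 2 / B" using \<epsilon> by (auto simp: \<epsilon>\<^sub>0_def)
    then have \<epsilon>A: "\<epsilon> * A \<le> 1 / 8" and \<epsilon>B: "\<epsilon> * B \<le> r / 2" using A B by (simp_all add: field_simps)
    have "\<bar>g\<bar> + b\<^sup>2 * (s + 2 * r) \<le> \<epsilon> + \<epsilon> * (s + 2 * r)"
      using \<epsilon> assms r by (intro add_mono mult_right_mono) auto
    then have "(\<bar>g\<bar> + b\<^sup>2 * (s + 2 * r)) / c\<^sub>0 \<le> (\<epsilon> + \<epsilon> * (s + 2 * r)) / c\<^sub>0"
      using assms by (intro divide_right_mono) auto
    also have "\<dots> = \<epsilon> * ((1 + s + 2 * r) / c\<^sub>0)" by (simp add: algebra_simps)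
    finally have "(\<epsilon> + C * \<theta> + r) / s + (2 * (\<epsilon> + C * \<theta>) + r) + (\<epsilon> + C * \<theta> + 2 * r) / s
        + ((\<bar>g\<bar> + b\<^sup>2 * (s + 2 * r)) / c\<^sub>0 + \<epsilon> / \<theta>)
        \<le> \<epsilon> * A + C * \<theta> * (2 / s + 2) + r * (3 / s + 1)"
      by (simp add: A_def add_divide_distrib algebra_simps)
    also have "\<dots> \<le> 1 / 2" using \<epsilon>A \<theta>2 r2 by linarith
    finally show "(\<epsilon> + C * \<theta> + r) / s + (2 * (\<epsilon> + C * \<theta>) + r) + (\<epsilon> + C * \<theta> + 2 * r) / s
        + ((\<bar>g\<bar> + b\<^sup>2 * (s + 2 * r)) / c\<^sub>0 + \<epsilon> / \<theta>) \<le> 1 / 2" .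
    show "4 * \<epsilon> / s + 4 * \<epsilon> + 2 * \<epsilon> / \<theta> \<le> r / 2"
      using \<epsilon>B by (simp add: B_def algebra_simps)
  qed
  ultimately show ?thesis using r \<theta> by (intro that) auto
qed

lemma continuous_on_power_of_real:
  assumes "continuous_on UNIV (\<lambda>z. complex_of_real (f z))"
  shows "continuous_on UNIV (\<lambda>z. complex_of_real (f z ^ m))"
  using continuous_on_power[OF assms, of m] by simp

text \<open>The mean of the potential being real makes the diagonal entry of mode 0 purely
  imaginary.\<close>

lemma fourier_coeff_const_real:
  assumes "continuous_on UNIV (\<lambda>z. complex_of_real (f z))"
  obtains x where "fourier_coeff (\<lambda>z. complex_of_real (f z)) 0 = complex_of_real x"
proof -
  have "continuous_on {0..2*pi} f"
    using continuous_on_Re[OF assms] by (auto intro: continuous_on_subset)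
  from integral_interval_of_real[OF this]
  have "fourier_coeff (\<lambda>z. complex_of_real (f z)) 0 = of_real (integral {0..2*pi} f / (2 * pi))"
    by (simp add: fourier_coeff_def)
  then show ?thesis by (rule that)
qed

lemma Q_op_synth_diff:
  assumes s: "s \<ge> 1" and \<eta>: "continuous_on UNIV (\<lambda>z. complex_of_real (\<eta> z))"
  shows "Q_op j \<rho> N \<alpha> \<eta> c \<mu> (synth s (u - v)) n
    = Q_op j \<rho> N \<alpha> \<eta> c \<mu> (synth s u) n - Q_op j \<rho> N \<alpha> \<eta> c \<mu> (synth s v) n"
proof -
  have "(\<lambda>z. complex_of_real (\<eta> z ^ (N - 1)) * synth s (u - v) z)
      = (\<lambda>z. complex_of_real (\<eta> z ^ (N - 1)) * synth s u z - complex_of_real (\<eta> z ^ (N - 1)) * synth s v z)"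
    by (simp add: synth_diff[OF s] right_diff_distrib)
  then have "fourier_coeff (\<lambda>z. complex_of_real (\<eta> z ^ (N - 1)) * synth s (u - v) z) n
      = fourier_coeff (\<lambda>z. complex_of_real (\<eta> z ^ (N - 1)) * synth s u z) n
        - fourier_coeff (\<lambda>z. complex_of_real (\<eta> z ^ (N - 1)) * synth s v z) n"
    by (simp only:) (intro fourier_coeff_diff continuous_on_mult continuous_on_power_of_real \<eta>
        continuous_on_synth[OF s])
  moreover have "fourier_coeff (synth s (u - v)) n = fourier_coeff (synth s u) n - fourier_coeff (synth s v) n"
    by (simp add: fourier_coeff_synth[OF s] diff_divide_distrib)
  ultimately show ?thesis
    unfolding Q_op_def by (simp only: right_diff_distrib) (simp add: algebra_simps)
qed

lemma synth_split:
  assumes "s \<ge> 1"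
  shows "synth s u z = coord u 1 / of_real (wt s 1) * cis z + coord u (-1) / of_real (wt s 1) * cis (- z)
    + coord u 0 + synth s (tail u) z"
proof -
  have "synth s u z = synth s (unit_at 1 (coord u 1) + unit_at (-1) (coord u (-1)) + unit_at 0 (coord u 0) + tail u) z"
    by (subst ell2_split) rule
  then show ?thesis
    using wt_minus[of s 1] by (simp add: synth_add[OF assms] synth_unit_at[OF assms])
qed

text \<open>Multiplication by a mode shifts coefficients, so the rows \<plusminus>1 see the
  coefficients of the even power at 0 and \<plusminus>2. The contribution of mode 0 involves a
  coefficient of odd index and vanishes: mode 0 does not enter these rows at leading order.\<close>

lemma fourier_coeff_cos_power_synth:
  assumes s: "s \<ge> 1" and q: "q \<ge> 1" and n: "n \<in> {1, -1}"
  shows "fourier_coeff (\<lambda>z. complex_of_real (cos z ^ (2 * q)) * synth s u z) n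
    = of_real (cos_mean q) * coord u n / of_real (wt s 1) + of_real (cos_second q) * coord u (- n) / of_real (wt s 1)
      + fourier_coeff (\<lambda>z. complex_of_real (cos z ^ (2 * q)) * synth s (tail u) z) n"
proof -
  define f where "f = (\<lambda>z. complex_of_real (cos z ^ (2 * q)))"
  define x where "x = coord u 1 / of_real (wt s 1)"
  define y where "y = coord u (-1) / of_real (wt s 1)"
  have cf: "continuous_on UNIV f" unfolding f_def by (intro continuous_intros)
  have eq: "f z * synth s u z = x * (f z * cis (of_int 1 * z)) + y * (f z * cis (of_int (-1) * z))
      + coord u 0 * f z + f z * synth s (tail u) z" for z
    unfolding synth_split[OF s, of u z] x_def y_def by (simp add: algebra_simps)
  have "fourier_coeff (\<lambda>z. f z * synth s u z) n = x * fourier_coeff f (n - 1) + y * fourier_coeff f (n - (-1))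
      + coord u 0 * fourier_coeff f n + fourier_coeff (\<lambda>z. f z * synth s (tail u) z) n"
    unfolding eq
    by (subst fourier_coeff_add, (intro continuous_intros cf continuous_on_synth[OF s])+)+
       (simp only: fourier_coeff_cmult fourier_coeff_shift)
  then show ?thesis
    using n fourier_coeff_cos_even_power[OF q] by (auto simp: f_def x_def y_def mult.commute)
qed

text \<open>
  All quantities that tend to zero with the amplitude are bounded by one number \<open>e\<close>, which is fixed
  before the amplitude is chosen.
\<close>

lemma unstable_eigenvalue:
  fixes j :: "real \<Rightarrow> real" and \<eta> :: "real \<Rightarrow> real" and E :: "real \<Rightarrow> real"
    and s \<rho> \<alpha> c b \<mu> \<kappa> dj e c\<^sub>0 r \<theta> :: real and q N :: nat
  defines "m\<^sub>0 \<equiv> cos_mean q" and "m\<^sub>2 \<equiv> cos_second q"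
  defines "w \<equiv> wt s 1"
  defines "Q \<equiv> Q_op j \<rho> N \<alpha> \<eta> c \<mu>"
  defines "M \<equiv> 4 + \<bar>c_tau N \<alpha>\<bar> + real N * (m\<^sub>0 + m\<^sub>2) + 4 * real N * w * sup_const + 1 / c\<^sub>0 + \<bar>\<rho> * dj\<bar>"
  defines "C \<equiv> 2 * real N * w * sup_const"
  defines "S \<equiv> real N * m\<^sub>2"
  assumes s: "s \<ge> 1" and q: "q \<ge> 1" and N: "N = 2 * q + 1" and \<alpha>: "\<alpha>\<^sup>2 = 1"
    and even: "\<And>k. j (- k) = j k"
    and \<eta>: "continuous_on UNIV (\<lambda>z. complex_of_real (\<eta> z))"
    and b: "b > 0" "b\<^sup>2 \<le> e" and e: "e \<le> 1" and \<mu>: "\<mu> = \<kappa> * b" "\<bar>\<mu>\<bar> \<le> e"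
    and \<eta>_le: "\<And>z. \<bar>\<eta> z ^ (2 * q) - b\<^sup>2 * cos z ^ (2 * q)\<bar> \<le> b\<^sup>2 * e"
    and c_le: "\<bar>c - j \<rho> - b\<^sup>2 * c_tau N \<alpha>\<bar> \<le> b\<^sup>2 * e"
    and E: "\<And>x. \<bar>x\<bar> \<le> \<bar>\<mu>\<bar> \<Longrightarrow> (1 + x) * (j \<rho> - j (\<rho> * (1 + x))) = - \<rho> * dj * x + x\<^sup>2 * E x"
    and E_le: "\<And>x. \<bar>x\<bar> \<le> \<bar>\<mu>\<bar> \<Longrightarrow> \<bar>\<kappa>\<^sup>2 * E x - \<alpha> * S\<bar> \<le> e"
    and R: "\<And>u. (\<lambda>n. Q (synth s u) n - \<i> * of_int n * of_real (D_symbol j \<rho> n) * fourier_coeff (synth s u) n) \<in> L2_space"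
      "\<And>u. L2_norm (\<lambda>n. Q (synth s u) n - \<i> * of_int n * of_real (D_symbol j \<rho> n) * fourier_coeff (synth s u) n)
        \<le> e * norm u"
    and c0: "c\<^sub>0 > 0" and D: "\<And>n. \<bar>n\<bar> \<ge> 2 \<Longrightarrow> c\<^sub>0 * wt s n \<le> \<bar>of_int n\<bar> * \<bar>D_symbol j \<rho> n\<bar>"
    and r: "0 < r" "r \<le> S / 2" and \<theta>: "0 < \<theta>" "\<theta> \<le> 1"
    and const: "\<And>g b. \<bar>g\<bar> \<le> e * M \<Longrightarrow> b\<^sup>2 \<le> e * M \<Longrightarrow>
       (e * M + C * \<theta> + r) / S + (2 * (e * M + C * \<theta>) + r) + (e * M + C * \<theta> + 2 * r) / S
        + ((\<bar>g\<bar> + b\<^sup>2 * (S + 2 * r)) / c\<^sub>0 + e * M / \<theta>) \<le> 1 / 2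
       \<and> 4 * (e * M) / S + 4 * (e * M) + 2 * (e * M) / \<theta> \<le> r / 2"
  obtains \<nu> where "is_eigenvalue s Q \<nu>" "Re \<nu> > 0" "cmod \<nu> \<le> e * M + 2 * e * S"
proof -
  have N1: "N - 1 = 2 * q" using N by simp
  have \<alpha>abs: "\<bar>\<alpha>\<bar> = 1" using \<alpha> by (auto simp: power2_eq_1_iff)
  have e0: "e \<ge> 0" using b by (smt (verit) zero_le_power2)
  have m0: "m\<^sub>0 \<ge> 0" and m2: "m\<^sub>2 > 0" using q by (auto simp: m\<^sub>0_def m\<^sub>2_def cos_mean_nonneg cos_second_pos)
  have S: "S > 0" using m2 N by (simp add: S_def)
  have w: "w > 0" "w \<ge> 1" using wt_square_ge[OF s, of 1] power2_le_imp_le[of 1 w] by (auto simp: w_def less_imp_le)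
  have wn: "wt s n = w" if "n \<in> {1, -1}" for n using that wt_minus[of s 1] by (auto simp: w_def)
  have C0: "C \<ge> 0" using w sup_const_nonneg by (simp add: C_def)
  have M: "M \<ge> 1" "\<bar>\<rho> * dj\<bar> \<le> M" "1 / c\<^sub>0 \<le> M"
    using m0 m2 w c0 sup_const_nonneg by (simp_all add: M_def)
  define \<epsilon> where "\<epsilon> = e * M"
  have \<epsilon>0: "\<epsilon> \<ge> 0" using e0 M by (simp add: \<epsilon>_def)
  define \<gamma> where "\<gamma> = \<rho> * dj * \<mu>"
  have \<gamma>: "\<bar>\<gamma>\<bar> \<le> e * M"
    using mult_mono[OF M(2) \<mu>(2)] M by (simp add: \<gamma>_def abs_mult mult.commute)
  define F where "F u n = fourier_coeff (\<lambda>z. complex_of_real (\<eta> z ^ (2 * q)) * synth s u z) n" for u n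
  define G where "G u n = fourier_coeff (\<lambda>z. complex_of_real (cos z ^ (2 * q)) * synth s u z) n" for u n
  note cont = continuous_on_mult[OF continuous_on_power_of_real[OF \<eta>] continuous_on_synth[OF s]]
  have contc: "continuous_on UNIV (\<lambda>z. complex_of_real (cos z ^ (2 * q)) * synth s u z)" for u
    by (intro continuous_intros continuous_on_synth[OF s])
  have F_diff: "F (u - v) n = F u n - F v n" for u v n
    unfolding F_def synth_diff[OF s] right_diff_distrib by (rule fourier_coeff_diff[OF cont cont])
  have FG_le: "cmod (F u n - of_real (b\<^sup>2) * G u n) \<le> b\<^sup>2 * e * (sup_const * norm u)" for u n
  proof -
    have "F u n - of_real (b\<^sup>2) * G u n = fourier_coeff (\<lambda>z. complex_of_real (\<eta> z ^ (2 * q)) * synth s u z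
        - of_real (b\<^sup>2) * (complex_of_real (cos z ^ (2 * q)) * synth s u z)) n"
      unfolding F_def G_def
      by (subst fourier_coeff_diff[OF cont continuous_on_mult[OF continuous_on_const contc]])
         (simp add: fourier_coeff_cmult)
    also have "cmod \<dots> \<le> b\<^sup>2 * e * (sup_const * norm u)"
    proof (rule norm_fourier_coeff_le)
      show "continuous_on UNIV (\<lambda>z. complex_of_real (\<eta> z ^ (2 * q)) * synth s u z
          - of_real (b\<^sup>2) * (complex_of_real (cos z ^ (2 * q)) * synth s u z))"
        by (intro continuous_on_diff cont continuous_on_mult[OF continuous_on_const contc])
      fix z :: real
      have "complex_of_real (\<eta> z ^ (2 * q)) * synth s u z
          - of_real (b\<^sup>2) * (complex_of_real (cos z ^ (2 * q)) * synth s u z)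
          = of_real (\<eta> z ^ (2 * q) - b\<^sup>2 * cos z ^ (2 * q)) * synth s u z"
        by (simp add: algebra_simps)
      also have "cmod \<dots> \<le> b\<^sup>2 * e * (sup_const * norm u)"
        unfolding norm_mult norm_of_real using e0
        by (intro mult_mono \<eta>_le norm_synth_le[OF s]) auto
      finally show "cmod (complex_of_real (\<eta> z ^ (2 * q)) * synth s u z
          - of_real (b\<^sup>2) * (complex_of_real (cos z ^ (2 * q)) * synth s u z)) \<le> b\<^sup>2 * e * (sup_const * norm u)" .
    qed
    finally show ?thesis .
  qed
  have F_le: "cmod (F u n) \<le> b\<^sup>2 * 2 * (sup_const * norm u)" for u n
    unfolding F_def
  proof (rule norm_fourier_coeff_le[OF cont])
    fix z :: real
    have "\<bar>cos z ^ (2 * q)\<bar> \<le> 1" 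
      unfolding power_abs by (intro power_le_one abs_ge_zero abs_cos_le_one)
    then have "b\<^sup>2 * \<bar>cos z ^ (2 * q)\<bar> \<le> b\<^sup>2 * 1" by (intro mult_left_mono) auto
    moreover have "b\<^sup>2 * e \<le> b\<^sup>2 * 1" using e by (intro mult_left_mono) auto
    ultimately have "\<bar>\<eta> z ^ (2 * q)\<bar> \<le> b\<^sup>2 * 2"
      using \<eta>_le[of z] abs_triangle_ineq2[of "\<eta> z ^ (2 * q)" "b\<^sup>2 * cos z ^ (2 * q)"] by (simp add: abs_mult)
    then show "cmod (complex_of_real (\<eta> z ^ (2 * q)) * synth s u z) \<le> b\<^sup>2 * 2 * (sup_const * norm u)"
      unfolding norm_mult norm_of_real by (intro mult_mono norm_synth_le[OF s]) auto
  qed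
  have G_tail_le: "cmod (G (tail u) n) \<le> sup_const * norm (tail u)" for u n
    unfolding G_def
  proof (rule norm_fourier_coeff_le[OF contc])
    fix z :: real
    have "\<bar>cos z ^ (2 * q)\<bar> \<le> 1" 
      unfolding power_abs by (intro power_le_one abs_ge_zero abs_cos_le_one)
    then have "cmod (complex_of_real (cos z ^ (2 * q)) * synth s (tail u) z) \<le> 1 * (sup_const * norm (tail u))"
      unfolding norm_mult norm_of_real by (intro mult_mono norm_synth_le[OF s]) auto
    then show "cmod (complex_of_real (cos z ^ (2 * q)) * synth s (tail u) z) \<le> sup_const * norm (tail u)" by simp
  qed
  have Q: "Q (synth s u) n = \<i> * of_real (of_int n + \<mu>) *
       (of_real (c - j (\<rho> * (of_int n + \<mu>))) * (coord u n / of_real (wt s n)) - of_real (real N * \<alpha>) * F u n)" for u n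
    unfolding Q_def Q_op_def F_def N1 fourier_coeff_synth[OF s] ..

  \<comment> \<open>Multiplying by the weight turns \<open>Q \<psi> = \<nu> \<psi>\<close> on
    Fourier coefficients into an eigenvalue equation for the coordinates u.\<close>
  define A where "A u n = of_real (wt s n) * Q (synth s u) n" for u n
  have A_eq: "A u n = \<i> * of_real ((of_int n + \<mu>) * (c - j (\<rho> * (of_int n + \<mu>)))) * coord u n
      - \<i> * of_real (wt s n * (of_int n + \<mu>) * (real N * \<alpha>)) * F u n" for u n
    by (simp add: A_def Q field_simps)
  \<comment> \<open>\<open>k n\<close> is what remains of the diagonal besides the drift -\<gamma>
    common to both rows. Evenness of j turns the frequency n + \<mu> into 1 + n \<mu>; the linear
    term then carries n^2 = 1, while the quadratic one keeps the sign n.\<close>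
  define k where "k n = (of_int n + \<mu>) * (c - j \<rho>) + of_int n * \<mu>\<^sup>2 * E (of_int n * \<mu>)" for n :: int
  have symbol: "(of_int n + \<mu>) * (c - j (\<rho> * (of_int n + \<mu>))) = - \<gamma> + k n" if n: "n \<in> {1, -1}" for n
  proof -
    have n2: "of_int n * of_int n = (1::real)" using n by auto
    have "\<rho> * (of_int n + \<mu>) = \<rho> * (1 + of_int n * \<mu>) \<or> \<rho> * (of_int n + \<mu>) = - (\<rho> * (1 + of_int n * \<mu>))"
      using n by (auto simp: algebra_simps)
    then have j_eq: "j (\<rho> * (of_int n + \<mu>)) = j (\<rho> * (1 + of_int n * \<mu>))" using even by auto
    have n_eq: "of_int n + \<mu> = of_int n * (1 + of_int n * \<mu>)"
      using n2 by (simp add: distrib_left flip: mult.assoc)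
    have "(of_int n + \<mu>) * (c - j (\<rho> * (of_int n + \<mu>)))
        = (of_int n + \<mu>) * (c - j \<rho>) + (of_int n + \<mu>) * (j \<rho> - j (\<rho> * (1 + of_int n * \<mu>)))"
      unfolding j_eq by (simp add: algebra_simps)
    also have "(of_int n + \<mu>) * (j \<rho> - j (\<rho> * (1 + of_int n * \<mu>)))
        = of_int n * ((1 + of_int n * \<mu>) * (j \<rho> - j (\<rho> * (1 + of_int n * \<mu>))))"
      unfolding n_eq mult.assoc ..
    also have "(1 + of_int n * \<mu>) * (j \<rho> - j (\<rho> * (1 + of_int n * \<mu>)))
        = - \<rho> * dj * (of_int n * \<mu>) + (of_int n * \<mu>)\<^sup>2 * E (of_int n * \<mu>)"
      using n by (intro E) auto
    also have "of_int n * \<dots> = - \<gamma> * (of_int n * of_int n) + of_int n * (of_int n * of_int n) * \<mu>\<^sup>2 * E (of_int n * \<mu>)"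
      by (simp add: \<gamma>_def power2_eq_square algebra_simps)
    finally show ?thesis by (simp add: n2 k_def)
  qed
  define \<beta> where "\<beta> = \<alpha> * S"
  \<comment> \<open>In row 0 the coupling of mode 0 to itself is removed, since \<open>d\<close>
    below absorbs it exactly and need not be small. In the rows \<plusminus>1 the last summand takes
    out the leading coupling, so that \<open>l\<close> holds only the error.\<close>
  define l where "l n u = (if n = 0 then - \<i> * of_real (\<mu> * (real N * \<alpha>)) * F (u - unit_at 0 (coord u 0)) 0 / of_real (b\<^sup>2)
    else (\<i> * of_real (k n) * coord u n - \<i> * of_real (w * (of_int n + \<mu>) * (real N * \<alpha>)) * F u n) / of_real (b\<^sup>2)
       + \<i> * of_real \<beta> * of_int n * coord u (- n))" for n :: int and u
  have b2: "b\<^sup>2 \<noteq> 0" "b\<^sup>2 > 0" using b by auto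
  have row: "A u n = - \<i> * of_real \<gamma> * coord u n
        + of_real (b\<^sup>2) * (- \<i> * of_real (\<alpha> * S) * of_int n * coord u (- n) + l n u)" if n: "n \<in> {1, -1}" for u n
  proof -
    have "n \<noteq> 0" using n by auto
    then have "of_real (b\<^sup>2) * (- \<i> * of_real (\<alpha> * S) * of_int n * coord u (- n) + l n u)
        = \<i> * of_real (k n) * coord u n - \<i> * of_real (w * (of_int n + \<mu>) * (real N * \<alpha>)) * F u n"
      using b2 by (simp add: l_def \<beta>_def)
    then show ?thesis
      unfolding A_eq symbol[OF n] wn[OF n] by (simp add: algebra_simps)
  qed
  obtain H where H: "fourier_coeff (\<lambda>z. complex_of_real (\<eta> z ^ (2 * q))) 0 = complex_of_real H"
    using fourier_coeff_const_real[OF continuous_on_power_of_real[OF \<eta>]] by blast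
  define d where "d = \<mu> * (c - j (\<rho> * \<mu>) - real N * \<alpha> * H)"
  have row0: "A u 0 = \<i> * of_real d * coord u 0 + of_real (b\<^sup>2) * l 0 u" for u
  proof -
    have "F (unit_at 0 (coord u 0)) 0 = coord u 0 * of_real H"
      unfolding F_def synth_unit_at[OF s] using H
      by (simp add: fourier_coeff_cmult mult.commute[of _ "coord u 0"])
    then have "F u 0 = coord u 0 * of_real H + F (u - unit_at 0 (coord u 0)) 0"
      using F_diff[of u "unit_at 0 (coord u 0)" 0] by simp
    moreover have "of_real (b\<^sup>2) * l 0 u = - \<i> * of_real (\<mu> * (real N * \<alpha>)) * F (u - unit_at 0 (coord u 0)) 0"
      using b2 by (simp add: l_def)
    ultimately show ?thesis
      unfolding A_eq by (simp add: d_def algebra_simps)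
  qed
  define q' where "q' n = \<i> * of_int n * complex_of_real (D_symbol j \<rho> n)" for n :: int
  have q': "cmod (q' n) \<ge> c\<^sub>0 * wt s n" if "\<bar>n\<bar> \<ge> 2" for n
    using D[OF that] by (simp add: q'_def norm_mult)
  define R\<^sub>0 where "R\<^sub>0 u n = Q (synth s u) n - \<i> * of_int n * of_real (D_symbol j \<rho> n) * fourier_coeff (synth s u) n" for u n
  \<comment> \<open>\<open>A\<close> carries the weight, but the remainder is controlled only
    without it. Dividing by the diagonal, which dominates \<open>c\<^sub>0 * wt s n\<close>, absorbs
    the weight.\<close>
  define Z where "Z n = (if \<bar>n\<bar> \<le> 1 then 0 else of_real (wt s n) / q' n)" for n
  define Rr where "Rr u = mult_coord Z (Ell2 (R\<^sub>0 u))" for u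
  have R0: "R\<^sub>0 u \<in> L2_space" "L2_norm (R\<^sub>0 u) \<le> e * norm u" for u
    using R[of u] by (simp_all add: R\<^sub>0_def[abs_def])
  have Z: "cmod (Z n) \<le> 1 / c\<^sub>0" for n
  proof (cases "\<bar>n\<bar> \<le> 1")
    case False
    then have "c\<^sub>0 * wt s n \<le> cmod (q' n)" by (intro q') auto
    moreover have "0 < c\<^sub>0 * wt s n" using c0 by simp
    ultimately have "wt s n / cmod (q' n) \<le> wt s n / (c\<^sub>0 * wt s n)"
      by (intro frac_le) (auto simp: less_imp_le)
    then show ?thesis using False by (simp add: Z_def norm_divide abs_of_pos)
  qed (use c0 in \<open>simp add: Z_def\<close>)
  have coord_R: "coord (Rr u) n = Z n * R\<^sub>0 u n" for u n
    unfolding Rr_def using c0 by (subst coord_mult_coord[OF _ Z]) (auto simp: Ell2_inverse R0)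
  have R_le: "norm (Rr u) \<le> \<epsilon> * norm u" for u
  proof -
    have "norm (Rr u) \<le> 1 / c\<^sub>0 * (e * norm u)"
      unfolding Rr_def using c0 R0[of u]
      by (intro order_trans[OF norm_mult_coord_le[OF _ Z]] mult_left_mono) (auto simp: norm_Ell2)
    also have "\<dots> \<le> M * (e * norm u)" using M e0 by (intro mult_right_mono) auto
    finally show ?thesis by (simp add: \<epsilon>_def mult_ac)
  qed
  have R0_diff: "R\<^sub>0 (u - v) n = R\<^sub>0 u n - R\<^sub>0 v n" for u v n
    unfolding R\<^sub>0_def Q_def Q_op_synth_diff[OF s \<eta>] fourier_coeff_synth[OF s]
    by (simp add: diff_divide_distrib algebra_simps)
  have R_diff: "Rr (u - v) = Rr u - Rr v" for u v
    by (rule ell2_eqI) (simp add: coord_R R0_diff algebra_simps)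
  have rowt: "A u n = q' n * (coord u n + coord (Rr u) n)" if n: "\<bar>n\<bar> \<ge> 2" for u n
  proof -
    have "0 < c\<^sub>0 * wt s n" using c0 by simp
    then have "q' n \<noteq> 0" using q'[OF n] by auto
    then have "q' n * coord (Rr u) n = of_real (wt s n) * R\<^sub>0 u n"
      using n by (simp add: coord_R Z_def)
    moreover have "Q (synth s u) n = q' n * (coord u n / of_real (wt s n)) + R\<^sub>0 u n"
      by (simp add: R\<^sub>0_def q'_def fourier_coeff_synth[OF s])
    ultimately show ?thesis
      unfolding A_def by (simp add: field_simps)
  qed
  have l_diff: "l n (u - v) = l n u - l n v" for n u v
  proof -
    have "u - v - unit_at 0 (coord (u - v) 0) = (u - unit_at 0 (coord u 0)) - (v - unit_at 0 (coord v 0))"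
      by (rule ell2_eqI) simp
    then have F0: "F (u - v - unit_at 0 (coord (u - v) 0)) 0
        = F (u - unit_at 0 (coord u 0)) 0 - F (v - unit_at 0 (coord v 0)) 0"
      by (simp only: F_diff)
    show ?thesis
    proof (cases "n = 0")
      case True
      then show ?thesis unfolding l_def F0 by (simp only: if_True simp_thms right_diff_distrib diff_divide_distrib)
    next
      case False
      then show ?thesis by (simp add: l_def F_diff add_divide_distrib diff_divide_distrib algebra_simps)
    qed
  qed
  have w_sup: "sup_const \<le> w * sup_const" using w sup_const_nonneg by (simp add: mult_le_cancel_right1)
  \<comment> \<open>The potential is of size b^2, which the division in \<open>l\<close> uses up;
    the smallness comes from the factor \<mu> of row 0.\<close>
  have l0_le: "cmod (l 0 u) \<le> \<epsilon> * norm u" for u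
  proof -
    define v where "v = u - unit_at 0 (coord u 0)"
    have v: "norm v \<le> 2 * norm u"
      unfolding v_def using norm_triangle_ineq4[of u "unit_at 0 (coord u 0)"] norm_coord_le[of u 0] by simp
    have "cmod (l 0 u) = \<bar>\<mu>\<bar> * real N * cmod (F v 0) / b\<^sup>2"
      by (simp add: l_def v_def norm_mult norm_divide abs_mult \<alpha>abs norm_power)
    also have "\<dots> \<le> e * real N * (b\<^sup>2 * 2 * (sup_const * norm v)) / b\<^sup>2"
      using \<mu> F_le[of v 0] b2 e0 by (intro divide_right_mono mult_mono) auto
    also have "\<dots> = e * real N * 2 * sup_const * norm v" using b2 by simp
    also have "\<dots> \<le> e * real N * 2 * sup_const * (2 * norm u)"
      using v e0 sup_const_nonneg by (intro mult_left_mono) auto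
    also have "\<dots> = e * (4 * real N * sup_const) * norm u" by simp
    also have "\<dots> \<le> e * M * norm u"
    proof (intro mult_right_mono mult_left_mono e0)
      have "4 * real N * sup_const \<le> 4 * real N * w * sup_const"
        using w_sup by (simp add: mult.assoc mult_left_mono)
      moreover have "real N * (m\<^sub>0 + m\<^sub>2) \<ge> 0" "1 / c\<^sub>0 \<ge> 0" using m0 m2 c0 by simp_all
      ultimately show "4 * real N * sup_const \<le> M" unfolding M_def by linarith
    qed auto
    finally show ?thesis by (simp add: \<epsilon>_def)
  qed
  define c\<^sub>\<tau> where "c\<^sub>\<tau> = c_tau N \<alpha>"
  have c\<^sub>\<tau>: "c\<^sub>\<tau> - real N * \<alpha> * m\<^sub>0 = - \<beta>"
  proof -
    have "c\<^sub>\<tau> = \<alpha> * (m\<^sub>0 + m\<^sub>2)"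
      by (simp add: c\<^sub>\<tau>_def c_tau_def N circle_inner_cos_power[OF q, simplified] m\<^sub>0_def m\<^sub>2_def)
    moreover have "real q * m\<^sub>0 = (real q + 1) * m\<^sub>2"
      unfolding m\<^sub>0_def m\<^sub>2_def by (rule cos_mean_second_relation[OF q])
    then have "\<alpha> * (real q * m\<^sub>0) = \<alpha> * ((real q + 1) * m\<^sub>2)" by simp
    ultimately show ?thesis unfolding \<beta>_def S_def N by (simp add: algebra_simps)
  qed
  have l1_le: "cmod (l n u) \<le> \<epsilon> * norm u + C * norm (tail u)" if n: "n \<in> {1, -1}" for n u
  proof -
    \<comment> \<open>After division by b^2, \<open>e\<^sub>1\<close> is the error of the speed,
      \<open>e\<^sub>2\<close> that of the potential and \<open>e\<^sub>3\<close> that of the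
      quadratic part of the symbol.\<close>
    define e\<^sub>1 where "e\<^sub>1 = (c - j \<rho>) / b\<^sup>2 - c\<^sub>\<tau>"
    have e1: "\<bar>e\<^sub>1\<bar> \<le> e"
    proof -
      have "e\<^sub>1 = (c - j \<rho> - b\<^sup>2 * c\<^sub>\<tau>) / b\<^sup>2" using b2 by (simp add: e\<^sub>1_def field_simps)
      then have "\<bar>e\<^sub>1\<bar> = \<bar>c - j \<rho> - b\<^sup>2 * c\<^sub>\<tau>\<bar> / b\<^sup>2" by (simp add: abs_divide)
      also have "\<dots> \<le> b\<^sup>2 * e / b\<^sup>2" using c_le unfolding c\<^sub>\<tau>_def by (intro divide_right_mono) auto
      finally show ?thesis using b2 by simp
    qed
    define e\<^sub>2 where "e\<^sub>2 = (F u n - of_real (b\<^sup>2) * G u n) / of_real (b\<^sup>2)"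
    have e2: "cmod e\<^sub>2 \<le> e * (sup_const * norm u)"
      using FG_le[of u n] b2 by (simp add: e\<^sub>2_def norm_divide norm_power field_simps)
    define e\<^sub>3 where "e\<^sub>3 = \<kappa>\<^sup>2 * E (of_int n * \<mu>) - \<beta>"
    have e3: "\<bar>e\<^sub>3\<bar> \<le> e" unfolding e\<^sub>3_def \<beta>_def using n by (intro E_le) auto
    have n\<mu>: "\<bar>of_int n + \<mu>\<bar> \<le> 2" and n1: "\<bar>of_int n :: real\<bar> = 1" using n \<mu> e by auto
    have k: "k n / b\<^sup>2 = (of_int n + \<mu>) * (c\<^sub>\<tau> + e\<^sub>1) + of_int n * (\<beta> + e\<^sub>3)"
      using b2 by (simp add: k_def e\<^sub>1_def e\<^sub>3_def \<mu>(1) power_mult_distrib field_simps)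
    have F: "F u n / of_real (b\<^sup>2) = G u n + e\<^sub>2" using b2 by (simp add: e\<^sub>2_def field_simps)
    have G: "of_real w * G u n = of_real m\<^sub>0 * coord u n + of_real m\<^sub>2 * coord u (- n) + of_real w * G (tail u) n"
      unfolding G_def using fourier_coeff_cos_power_synth[OF s q n, of u] w
      by (simp add: w_def[symmetric] m\<^sub>0_def[symmetric] m\<^sub>2_def[symmetric] field_simps)
    have "n \<noteq> 0" using n by auto
    then have "l n u = \<i> * of_real (k n / b\<^sup>2) * coord u n
        - \<i> * of_real ((of_int n + \<mu>) * (real N * \<alpha>)) * (of_real w * (F u n / of_real (b\<^sup>2)))
        + \<i> * of_real \<beta> * of_int n * coord u (- n)"
      by (simp add: l_def diff_divide_distrib mult_ac)
    also have "of_real w * (F u n / of_real (b\<^sup>2))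
        = of_real m\<^sub>0 * coord u n + of_real m\<^sub>2 * coord u (- n) + of_real w * (G (tail u) n + e\<^sub>2)"
      unfolding F using G by (simp add: distrib_left)
    also have "\<i> * of_real (k n / b\<^sup>2) * coord u n
        - \<i> * of_real ((of_int n + \<mu>) * (real N * \<alpha>)) * (of_real m\<^sub>0 * coord u n + of_real m\<^sub>2 * coord u (- n) + of_real w * (G (tail u) n + e\<^sub>2))
        + \<i> * of_real \<beta> * of_int n * coord u (- n)
      = \<i> * of_real (of_int n * e\<^sub>3 + (of_int n + \<mu>) * e\<^sub>1 + \<mu> * c\<^sub>\<tau> - \<mu> * (real N * \<alpha>) * m\<^sub>0) * coord u n
        + (- \<i> * of_real (\<mu> * (real N * \<alpha>) * m\<^sub>2)) * coord u (- n)
        + (- \<i> * of_real ((of_int n + \<mu>) * (real N * \<alpha>) * w)) * (G (tail u) n + e\<^sub>2)"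
    proof -
      \<comment> \<open>This is the cancellation for which \<kappa> was chosen: the shift -\<beta>
        from speed and mean potential meets +\<beta> from the symbol. Every surviving term contains
        an error or a factor \<mu>, except the coupling to the tail, which is merely bounded and
        yields \<open>C\<close>.\<close>
      have "of_int n * (c\<^sub>\<tau> - real N * \<alpha> * m\<^sub>0) = of_int n * (- \<beta>)" unfolding c\<^sub>\<tau> ..
      then have "k n / b\<^sup>2 = of_int n * e\<^sub>3 + (of_int n + \<mu>) * e\<^sub>1 + \<mu> * c\<^sub>\<tau> + of_int n * (real N * \<alpha>) * m\<^sub>0"
        unfolding k by (simp add: algebra_simps)
      moreover have "\<beta> = real N * \<alpha> * m\<^sub>2" by (simp add: \<beta>_def S_def)
      ultimately show ?thesis by (simp add: algebra_simps)
    qed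
    also have "cmod \<dots> \<le> (e + 2 * e + e * \<bar>c\<^sub>\<tau>\<bar> + e * real N * m\<^sub>0) * norm u + (e * real N * m\<^sub>2) * norm u
        + (2 * real N * w) * (sup_const * norm (tail u) + e * (sup_const * norm u))"
    proof (intro norm_triangle_mono)
      have cm: "cmod (- \<i> * of_real x * y) = \<bar>x\<bar> * cmod y" "cmod (\<i> * of_real x * y) = \<bar>x\<bar> * cmod y" for x y
        by (simp_all add: norm_mult)
      have "\<bar>of_int n * e\<^sub>3 + (of_int n + \<mu>) * e\<^sub>1 + \<mu> * c\<^sub>\<tau> - \<mu> * (real N * \<alpha>) * m\<^sub>0\<bar>
          \<le> \<bar>of_int n * e\<^sub>3\<bar> + \<bar>(of_int n + \<mu>) * e\<^sub>1\<bar> + \<bar>\<mu> * c\<^sub>\<tau>\<bar> + \<bar>\<mu> * (real N * \<alpha>) * m\<^sub>0\<bar>" by linarith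
      also have "\<dots> \<le> e + 2 * e + e * \<bar>c\<^sub>\<tau>\<bar> + e * real N * m\<^sub>0"
      proof (intro add_mono)
        show "\<bar>of_int n * e\<^sub>3\<bar> \<le> e" using e3 n1 by (simp add: abs_mult)
        show "\<bar>(of_int n + \<mu>) * e\<^sub>1\<bar> \<le> 2 * e" unfolding abs_mult using n\<mu> e1 by (intro mult_mono) auto
        show "\<bar>\<mu> * c\<^sub>\<tau>\<bar> \<le> e * \<bar>c\<^sub>\<tau>\<bar>" unfolding abs_mult using \<mu> by (intro mult_right_mono) auto
        show "\<bar>\<mu> * (real N * \<alpha>) * m\<^sub>0\<bar> \<le> e * real N * m\<^sub>0"
          unfolding abs_mult using \<mu> m0 by (intro mult_mono) (auto simp: \<alpha>abs)
      qed
      finally show "cmod (\<i> * of_real (of_int n * e\<^sub>3 + (of_int n + \<mu>) * e\<^sub>1 + \<mu> * c\<^sub>\<tau> - \<mu> * (real N * \<alpha>) * m\<^sub>0) * coord u n)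
          \<le> (e + 2 * e + e * \<bar>c\<^sub>\<tau>\<bar> + e * real N * m\<^sub>0) * norm u"
        unfolding cm using norm_coord_le[of u n]
        by (intro mult_mono) auto
      have "\<bar>\<mu> * (real N * \<alpha>) * m\<^sub>2\<bar> \<le> e * real N * m\<^sub>2"
        unfolding abs_mult using \<mu> m2 by (intro mult_mono) (auto simp: \<alpha>abs)
      then show "cmod ((- \<i> * of_real (\<mu> * (real N * \<alpha>) * m\<^sub>2)) * coord u (- n)) \<le> (e * real N * m\<^sub>2) * norm u"
        unfolding cm using norm_coord_le[of u "- n"] e0 m2
        by (intro mult_mono) auto
      have "\<bar>(of_int n + \<mu>) * (real N * \<alpha>) * w\<bar> \<le> 2 * real N * w"
        unfolding abs_mult using n\<mu> w by (intro mult_mono) (auto simp: \<alpha>abs)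
      moreover have "cmod (G (tail u) n + e\<^sub>2) \<le> sup_const * norm (tail u) + e * (sup_const * norm u)"
        by (intro norm_triangle_mono G_tail_le e2)
      ultimately show "cmod ((- \<i> * of_real ((of_int n + \<mu>) * (real N * \<alpha>) * w)) * (G (tail u) n + e\<^sub>2))
          \<le> (2 * real N * w) * (sup_const * norm (tail u) + e * (sup_const * norm u))"
        unfolding cm using w
        by (intro mult_mono) auto
    qed
    also have "\<dots> = e * (3 + \<bar>c\<^sub>\<tau>\<bar> + real N * (m\<^sub>0 + m\<^sub>2) + 2 * real N * w * sup_const) * norm u + C * norm (tail u)"
      by (simp add: C_def algebra_simps)
    also have "\<dots> \<le> e * M * norm u + C * norm (tail u)"
    proof (intro add_right_mono mult_right_mono mult_left_mono e0)
      have "2 * real N * w * sup_const \<le> 4 * real N * w * sup_const"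
        using w sup_const_nonneg by (intro mult_right_mono) auto
      moreover have "1 / c\<^sub>0 \<ge> 0" using c0 by simp
      ultimately show "3 + \<bar>c\<^sub>\<tau>\<bar> + real N * (m\<^sub>0 + m\<^sub>2) + 2 * real N * w * sup_const \<le> M"
        unfolding M_def c\<^sub>\<tau>_def by linarith
    qed auto
    finally show ?thesis by (simp add: \<epsilon>_def)
  qed
  have l_le: "cmod (l n u) \<le> \<epsilon> * norm u + C * norm (tail u)" if "\<bar>n\<bar> \<le> 1" for n u
  proof (cases "n = 0")
    case True
    then show ?thesis using l0_le[of u] C0 by (simp add: add_increasing2)
  next
    case False
    then have "n \<in> {1, -1}" using that by auto
    then show ?thesis by (rule l1_le)
  qed
  have q'_ge: "cmod (q' n) \<ge> c\<^sub>0" if "\<bar>n\<bar> \<ge> 2" for n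
  proof -
    have "(wt s n)\<^sup>2 \<ge> 1\<^sup>2" using wt_square_ge[OF s, of n] by (simp add: order_trans[rotated])
    then have "wt s n \<ge> 1" by (rule power2_le_imp_le) (simp add: less_imp_le)
    then have "c\<^sub>0 * 1 \<le> c\<^sub>0 * wt s n" using c0 by (intro mult_left_mono) auto
    then show ?thesis using q'[OF that] by simp
  qed
  have b2_le: "b\<^sup>2 \<le> e * M" using b e0 M mult_left_mono[of 1 M e] by simp
  obtain u \<nu> where u: "coord u 1 = 1" "\<And>n. A u n = \<nu> * coord u n" "Re \<nu> > 0"
    "cmod \<nu> \<le> \<bar>\<gamma>\<bar> + 2 * b\<^sup>2 * S"
    using perturbed_block_eigenvector[OF S \<alpha> b(1) row row0 rowt q'_ge c0 l_diff R_diff l_le R_le r \<theta> \<epsilon>0 C0]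
      const[OF \<gamma> b2_le] unfolding \<epsilon>_def by blast
  have "is_eigenvalue s Q \<nu>"
    unfolding is_eigenvalue_def
  proof (intro bexI[of _ "synth s u"] conjI allI)
    show "\<exists>z. synth s u z \<noteq> 0"
    proof (rule ccontr)
      assume "\<not> ?thesis"
      then have "synth s u = (\<lambda>z. 0)" by auto
      then have "fourier_coeff (synth s u) 1 = 0" by (simp add: fourier_coeff_def)
      then show False using u(1) by (simp add: fourier_coeff_synth[OF s])
    qed
    fix n
    show "Q (synth s u) n = \<nu> * fourier_coeff (synth s u) n"
      using u(2)[of n] by (simp add: A_def fourier_coeff_synth[OF s] field_simps)
  qed (use s in simp)
  moreover have "cmod \<nu> \<le> e * M + 2 * e * S"
  proof -
    have "2 * b\<^sup>2 * S \<le> 2 * e * S" using b(2) S by (simp add: mult_right_mono)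
    then show ?thesis using u(4) \<gamma> by linarith
  qed
  ultimately show ?thesis using u(3) that by blast
qed

section \<open>Uniform estimates for the family of waves\<close>

lemma abs_power_diff_le:
  fixes x y :: real
  assumes "\<bar>x\<bar> \<le> 1" "\<bar>y\<bar> \<le> 1"
  shows "\<bar>x ^ m - y ^ m\<bar> \<le> real m * \<bar>x - y\<bar>"
  using norm_power_diff[of x y m] assms by simp

text \<open>The Sobolev embedding turns the expansion of the profile into a uniform error of order
  |a|^N for the deviation from a cos z. The crude Lipschitz bound for powers on [-1, 1] suffices,
  because |a|^N = |a|^(2 q + 1) is already one order smaller than the leading potential.\<close>

lemma family_bounds:
  assumes fam: "small_amplitude_family j \<sigma> \<rho> N \<alpha> \<eta> c" and q: "q \<ge> 1" and N: "N = 2 * q + 1"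
  obtains \<delta> C where "0 < \<delta>" "\<delta> \<le> 1" "C \<ge> 0"
    "\<And>a. \<bar>a\<bar> < \<delta> \<Longrightarrow> continuous_on UNIV (\<lambda>z. complex_of_real (\<eta> a z))"
    "\<And>a z. 0 < \<bar>a\<bar> \<Longrightarrow> \<bar>a\<bar> < \<delta> \<Longrightarrow> \<bar>\<eta> a z ^ (2 * q) - a ^ (2 * q) * cos z ^ (2 * q)\<bar> \<le> C * \<bar>a\<bar> ^ (2 * q + 1)"
    "\<And>a. 0 < \<bar>a\<bar> \<Longrightarrow> \<bar>a\<bar> < \<delta> \<Longrightarrow> \<bar>c a - j \<rho> - a ^ (2 * q) * c_tau N \<alpha>\<bar> \<le> C * \<bar>a\<bar> ^ (2 * q + 1)"
    "\<And>z. \<eta> 0 z = 0" "c 0 = j \<rho>"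
proof -
  define s where "s = sobolev_exponent \<sigma>"
  have s: "s \<ge> 1" by (simp add: s_def sobolev_exponent_def)
  obtain \<delta> e B where \<delta>: "\<delta> > 0" and e: "\<forall>k. e k \<in> sobolev s"
    and \<eta>e: "\<forall>a. \<bar>a\<bar> < \<delta> \<longrightarrow> (\<lambda>z. of_real (\<eta> a z)) \<in> sobolev s \<and>
             (\<lambda>n. sobolev_norm s (\<lambda>z. of_real (\<eta> a z) - (\<Sum>k<n. of_real (a ^ k) * e k z))) \<longlonglongrightarrow> 0"
    and B: "\<forall>a. \<bar>a\<bar> < \<delta> \<longrightarrow> (\<lambda>k. B k * a ^ k) sums c a"
    and \<eta>O: "(\<lambda>a. sobolev_norm s
        (\<lambda>z. of_real (\<eta> a z) - of_real (a * cos z) - of_real (a ^ N) * eta_N j \<rho> N \<alpha> z))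
       \<in> O[at 0](\<lambda>a. a ^ (N + 1))"
    and cO: "(\<lambda>a. c a - j \<rho> - a ^ (N - 1) * c_tau N \<alpha>) \<in> O[at 0](\<lambda>a. a ^ N)"
    using fam unfolding small_amplitude_family_def s_def[symmetric] by (elim exE conjE) (rule that)
  note e = e[rule_format] and B = B[rule_format]
    and \<eta>S = \<eta>e[rule_format, THEN conjunct1] and \<eta>lim = \<eta>e[rule_format, THEN conjunct2]
  obtain C\<^sub>1 where C1: "C\<^sub>1 > 0" "\<forall>\<^sub>F a in at 0. norm (sobolev_norm s
        (\<lambda>z. of_real (\<eta> a z) - of_real (a * cos z) - of_real (a ^ N) * eta_N j \<rho> N \<alpha> z)) \<le> C\<^sub>1 * norm (a ^ (N + 1))"
    using landau_o.bigE[OF \<eta>O] by blast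
  obtain C\<^sub>2 where C2: "C\<^sub>2 > 0" "\<forall>\<^sub>F a in at 0. norm (c a - j \<rho> - a ^ (N - 1) * c_tau N \<alpha>) \<le> C\<^sub>2 * norm (a ^ N)"
    using landau_o.bigE[OF cO] by blast
  obtain d where d: "d > 0"
    "\<And>a. a \<noteq> 0 \<Longrightarrow> \<bar>a\<bar> < d \<Longrightarrow> \<bar>sobolev_norm s
        (\<lambda>z. of_real (\<eta> a z) - of_real (a * cos z) - of_real (a ^ N) * eta_N j \<rho> N \<alpha> z)\<bar> \<le> C\<^sub>1 * \<bar>a\<bar> ^ (N + 1)"
    "\<And>a. a \<noteq> 0 \<Longrightarrow> \<bar>a\<bar> < d \<Longrightarrow> \<bar>c a - j \<rho> - a ^ (N - 1) * c_tau N \<alpha>\<bar> \<le> C\<^sub>2 * \<bar>a\<bar> ^ N"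
    using eventually_conj[OF C1(2) C2(2)] unfolding eventually_at
    by (auto simp: dist_norm power_abs abs_mult)
  define B\<^sub>N where "B\<^sub>N = sup_const * sobolev_norm s (eta_N j \<rho> N \<alpha>)"
  have BN: "cmod (eta_N j \<rho> N \<alpha> z) \<le> B\<^sub>N" for z
    unfolding B\<^sub>N_def by (rule sobolev_sup_le[OF s eta_N_in_sobolev[OF s]])
  then have BN0: "B\<^sub>N \<ge> 0" using norm_ge_zero order_trans by blast
  define C\<^sub>3 where "C\<^sub>3 = sup_const * C\<^sub>1 + B\<^sub>N"
  have C3: "C\<^sub>3 \<ge> 0" using BN0 C1 sup_const_nonneg by (simp add: C\<^sub>3_def)
  \<comment> \<open>The last cap keeps the profile bounded by 1, as required by the Lipschitz bound
    for powers.\<close>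
  define \<delta>' where "\<delta>' = min (min \<delta> d) (1 / (1 + C\<^sub>3))"
  have \<delta>': "0 < \<delta>'" "\<delta>' \<le> 1" "\<delta>' \<le> \<delta>" "\<delta>' \<le> d" "\<delta>' \<le> 1 / (1 + C\<^sub>3)"
  proof -
    show "0 < \<delta>'" using \<delta> d C3 by (simp add: \<delta>'_def add_pos_nonneg)
    show "\<delta>' \<le> \<delta>" "\<delta>' \<le> d" "\<delta>' \<le> 1 / (1 + C\<^sub>3)" by (simp_all add: \<delta>'_def)
    moreover have "1 / (1 + C\<^sub>3) \<le> 1" using C3 by simp
    ultimately show "\<delta>' \<le> 1" by linarith
  qed
  have sup: "\<bar>\<eta> a z - a * cos z\<bar> \<le> C\<^sub>3 * \<bar>a\<bar> ^ N" if a: "0 < \<bar>a\<bar>" "\<bar>a\<bar> < \<delta>'" for a z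
  proof -
    define f where "f = (\<lambda>z. complex_of_real (\<eta> a z) - of_real (a * cos z) - of_real (a ^ N) * eta_N j \<rho> N \<alpha> z)"
    \<comment> \<open>Membership has to be shown: the norm of a function outside the space is the junk value 0.\<close>
    have trig: "(\<lambda>z. complex_of_real (a * cos z)) = (\<lambda>z. of_real a / 2 * cis (of_int 1 * z) + of_real a / 2 * cis (of_int (-1) * z))"
      by (simp add: fun_eq_iff complex_eq_iff)
    have "(\<lambda>z. complex_of_real (a * cos z)) \<in> sobolev s"
      unfolding trig by (intro sobolev_add[OF s] sobolev_trig[OF s])
    then have "f \<in> sobolev s"
      unfolding f_def using a \<delta>'
      by (intro sobolev_diff[OF s] sobolev_cmult[OF s] eta_N_in_sobolev[OF s] \<eta>S) auto
    then have "cmod (f z) \<le> sup_const * sobolev_norm s f" by (rule sobolev_sup_le[OF s])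
    also have "\<dots> \<le> sup_const * (C\<^sub>1 * \<bar>a\<bar> ^ (N + 1))"
      using d(2)[of a] a \<delta>' sup_const_nonneg unfolding f_def by (intro mult_left_mono) auto
    also have "\<dots> \<le> sup_const * (C\<^sub>1 * \<bar>a\<bar> ^ N)"
      using a \<delta>' C1 sup_const_nonneg by (intro mult_left_mono power_decreasing) auto
    finally have f: "cmod (f z) \<le> sup_const * C\<^sub>1 * \<bar>a\<bar> ^ N" by (simp add: mult_ac)
    have "complex_of_real (\<eta> a z - a * cos z) = f z + of_real (a ^ N) * eta_N j \<rho> N \<alpha> z"
      by (simp add: f_def)
    then have "\<bar>\<eta> a z - a * cos z\<bar> = cmod (f z + of_real (a ^ N) * eta_N j \<rho> N \<alpha> z)"
      by (metis norm_of_real)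
    also have "\<dots> \<le> sup_const * C\<^sub>1 * \<bar>a\<bar> ^ N + \<bar>a\<bar> ^ N * B\<^sub>N"
      by (intro norm_triangle_mono f) (simp add: norm_mult norm_power mult_left_mono BN)
    finally show ?thesis by (simp add: C\<^sub>3_def algebra_simps)
  qed
  have \<eta>1: "\<bar>\<eta> a z\<bar> \<le> (1 + C\<^sub>3) * \<bar>a\<bar>" if a: "0 < \<bar>a\<bar>" "\<bar>a\<bar> < \<delta>'" for a z
  proof -
    have "\<bar>a\<bar> ^ N \<le> \<bar>a\<bar> ^ 1" using a \<delta>' N by (intro power_decreasing) auto
    then have "C\<^sub>3 * \<bar>a\<bar> ^ N \<le> C\<^sub>3 * \<bar>a\<bar>" using C3 by (intro mult_left_mono) auto
    moreover have "\<bar>a * cos z\<bar> \<le> \<bar>a\<bar> * 1" unfolding abs_mult by (intro mult_left_mono) auto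
    ultimately show ?thesis using sup[OF a, of z] by (simp add: algebra_simps)
  qed
  define C where "C = real (2 * q) * C\<^sub>3 + C\<^sub>2"
  show ?thesis
  proof
    show "0 < \<delta>'" "\<delta>' \<le> 1" by (rule \<delta>')+
    show "C \<ge> 0" using C3 C2 by (simp add: C_def)
    show "continuous_on UNIV (\<lambda>z. complex_of_real (\<eta> a z))" if "\<bar>a\<bar> < \<delta>'" for a
      using \<eta>S[of a] that \<delta>' by (simp add: sobolev_def)
    show "\<bar>\<eta> a z ^ (2 * q) - a ^ (2 * q) * cos z ^ (2 * q)\<bar> \<le> C * \<bar>a\<bar> ^ (2 * q + 1)"
      if a: "0 < \<bar>a\<bar>" "\<bar>a\<bar> < \<delta>'" for a z
    proof -
      have "(1 + C\<^sub>3) * \<bar>a\<bar> \<le> (1 + C\<^sub>3) * (1 / (1 + C\<^sub>3))"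
        using a \<delta>' C3 by (intro mult_left_mono) auto
      also have "\<dots> = 1" using C3 by simp
      finally have "\<bar>\<eta> a z\<bar> \<le> 1" using \<eta>1[OF a, of z] by linarith
      moreover have "\<bar>a * cos z\<bar> \<le> 1 * 1" unfolding abs_mult using a \<delta>' by (intro mult_mono) auto
      ultimately have "\<bar>\<eta> a z ^ (2 * q) - (a * cos z) ^ (2 * q)\<bar> \<le> real (2 * q) * \<bar>\<eta> a z - a * cos z\<bar>"
        by (intro abs_power_diff_le) auto
      also have "\<dots> \<le> real (2 * q) * (C\<^sub>3 * \<bar>a\<bar> ^ N)" using sup[OF a] by (intro mult_left_mono) auto
      also have "\<dots> \<le> C * \<bar>a\<bar> ^ N"
        unfolding C_def distrib_right mult.assoc using C2 by simp
      finally show ?thesis by (simp add: N power_mult_distrib)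
    qed
    show "\<bar>c a - j \<rho> - a ^ (2 * q) * c_tau N \<alpha>\<bar> \<le> C * \<bar>a\<bar> ^ (2 * q + 1)"
      if a: "0 < \<bar>a\<bar>" "\<bar>a\<bar> < \<delta>'" for a
    proof -
      have "\<bar>c a - j \<rho> - a ^ (2 * q) * c_tau N \<alpha>\<bar> \<le> C\<^sub>2 * \<bar>a\<bar> ^ (2 * q + 1)"
        using d(3)[of a] a \<delta>' by (simp add: N)
      also have "\<dots> \<le> C * \<bar>a\<bar> ^ (2 * q + 1)" using C3 by (intro mult_right_mono) (auto simp: C_def)
      finally show ?thesis .
    qed
    have small: "\<forall>\<^sub>F a in at 0. 0 < \<bar>a\<bar> \<and> \<bar>a\<bar> < \<delta>'"
      unfolding eventually_at using \<delta>'(1) by (auto intro!: exI[of _ \<delta>'])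
    have to0: "((\<lambda>a. K * \<bar>a\<bar>) \<longlongrightarrow> 0) (at 0)" for K :: real
      by (auto intro!: tendsto_eq_intros)
    \<comment> \<open>Each Fourier coefficient of the profile is a power series in a, because
      convergence in the Sobolev norm forces convergence of the coefficients. It tends to 0 with a,
      hence vanishes at a = 0.\<close>
    have coeff0: "fourier_coeff (\<lambda>z. complex_of_real (\<eta> 0 z)) n = 0" for n
    proof (rule powser_value_at_0[OF \<delta>, where c = "\<lambda>k. fourier_coeff (e k) n"])
      fix a :: real assume a: "\<bar>a\<bar> < \<delta>"
      define g where "g m = (\<lambda>z. complex_of_real (\<eta> a z) - (\<Sum>k<m. of_real (a ^ k) * e k z))" for m
      have partial: "(\<lambda>z. \<Sum>k<m. of_real (a ^ k) * e k z) \<in> sobolev s" for m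
        by (intro sobolev_sum[OF s] sobolev_cmult[OF s] e)
      have gS: "g m \<in> sobolev s" for m
        unfolding g_def by (intro sobolev_diff[OF s] \<eta>S a partial)
      have cont: "continuous_on UNIV f" if "f \<in> sobolev s" for f using that by (simp add: sobolev_def)
      have sum: "fourier_coeff (\<lambda>z. \<Sum>k<m. of_real (a ^ k) * e k z) n
          = (\<Sum>k<m. fourier_coeff (e k) n * of_real a ^ k)" for m
      proof (induction m)
        case 0
        then show ?case by (simp add: fourier_coeff_def)
      next
        case (Suc m)
        have "fourier_coeff (\<lambda>z. (\<Sum>k<m. of_real (a ^ k) * e k z) + of_real (a ^ m) * e m z) n
            = (\<Sum>k<m. fourier_coeff (e k) n * of_real a ^ k) + fourier_coeff (e m) n * of_real a ^ m"
          by (subst fourier_coeff_add[OF cont[OF partial] cont[OF sobolev_cmult[OF s e]]])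
             (simp only: Suc fourier_coeff_cmult, simp add: mult.commute)
        then show ?case by (simp only: sum.lessThan_Suc)
      qed
      have g: "fourier_coeff (g m) n = fourier_coeff (\<lambda>z. complex_of_real (\<eta> a z)) n
          - (\<Sum>k<m. fourier_coeff (e k) n * of_real a ^ k)" for m
        unfolding g_def by (subst fourier_coeff_diff[OF cont[OF \<eta>S[OF a]] cont[OF partial]]) (simp only: sum)
      have bound: "cmod (fourier_coeff (g m) n) \<le> sup_const * sobolev_norm s (g m)" for m
        by (rule norm_fourier_coeff_le[OF cont[OF gS] sobolev_sup_le[OF s gS]])
      have lim: "(\<lambda>m. sup_const * sobolev_norm s (g m)) \<longlonglongrightarrow> 0"
        unfolding g_def by (rule tendsto_mult_right_zero[OF \<eta>lim[OF a]])
      have "(\<lambda>m. fourier_coeff (g m) n) \<longlonglongrightarrow> 0"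
        by (rule Lim_null_comparison[OF always_eventually[OF allI[OF bound]] lim])
      then have "(\<lambda>m. fourier_coeff (\<lambda>z. complex_of_real (\<eta> a z)) n - fourier_coeff (g m) n)
          \<longlonglongrightarrow> fourier_coeff (\<lambda>z. complex_of_real (\<eta> a z)) n - 0"
        by (intro tendsto_intros)
      then show "(\<lambda>k. fourier_coeff (e k) n * of_real a ^ k) sums fourier_coeff (\<lambda>z. complex_of_real (\<eta> a z)) n"
        unfolding g sums_def by simp
    next
      have "\<forall>\<^sub>F a in at 0. cmod (fourier_coeff (\<lambda>z. complex_of_real (\<eta> a z)) n) \<le> (1 + C\<^sub>3) * \<bar>a\<bar>"
        using small
      proof eventually_elim
        case (elim a)
        then have "continuous_on UNIV (\<lambda>z. complex_of_real (\<eta> a z))"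
          using \<eta>S[of a] \<delta>' by (simp add: sobolev_def)
        then show ?case by (rule norm_fourier_coeff_le) (use \<eta>1[of a] elim in simp)
      qed
      then show "((\<lambda>a. fourier_coeff (\<lambda>z. complex_of_real (\<eta> a z)) n) \<longlongrightarrow> 0) (at 0)"
        using to0 by (rule Lim_null_comparison)
    qed
    show "\<eta> 0 z = 0" for z
    proof -
      have "(\<lambda>z. complex_of_real (\<eta> 0 z)) \<in> sobolev s" using \<eta>S[of 0] \<delta> by simp
      then have "complex_of_real (\<eta> 0 z) = 0"
        by (intro fourier_uniqueness[where f = "\<lambda>z. complex_of_real (\<eta> 0 z)"] coeff0)
           (auto simp: sobolev_def)
      then show ?thesis by simp
    qed
    have "complex_of_real (c 0) = of_real (j \<rho>)"
    proof (rule powser_value_at_0[OF \<delta>, where c = "\<lambda>k. of_real (B k)" and f = "\<lambda>a. complex_of_real (c a)"])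
      fix a :: real assume "\<bar>a\<bar> < \<delta>"
      from sums_of_real[OF B[OF this], where 'a = complex]
      show "(\<lambda>k. complex_of_real (B k) * complex_of_real a ^ k) sums complex_of_real (c a)" by simp
    next
      have "\<forall>\<^sub>F a in at 0. norm (c a - j \<rho>) \<le> (\<bar>c_tau N \<alpha>\<bar> + C\<^sub>2) * \<bar>a\<bar>"
        using small
      proof eventually_elim
        case (elim a)
        have p: "\<bar>a\<bar> ^ (N - 1) \<le> \<bar>a\<bar> ^ 1" "\<bar>a\<bar> ^ N \<le> \<bar>a\<bar> ^ 1"
          using elim \<delta>' N q by (intro power_decreasing; simp)+
        have "\<bar>c a - j \<rho>\<bar> \<le> \<bar>a ^ (N - 1) * c_tau N \<alpha>\<bar> + \<bar>c a - j \<rho> - a ^ (N - 1) * c_tau N \<alpha>\<bar>" by linarith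
        also have "\<dots> \<le> \<bar>a\<bar> * \<bar>c_tau N \<alpha>\<bar> + C\<^sub>2 * \<bar>a\<bar>"
        proof (rule add_mono)
          show "\<bar>a ^ (N - 1) * c_tau N \<alpha>\<bar> \<le> \<bar>a\<bar> * \<bar>c_tau N \<alpha>\<bar>"
            unfolding abs_mult power_abs using p by (intro mult_right_mono) auto
          have "C\<^sub>2 * \<bar>a\<bar> ^ N \<le> C\<^sub>2 * \<bar>a\<bar>" using p C2 by (intro mult_left_mono) auto
          then show "\<bar>c a - j \<rho> - a ^ (N - 1) * c_tau N \<alpha>\<bar> \<le> C\<^sub>2 * \<bar>a\<bar>"
            using d(3)[of a] elim \<delta>' by auto
        qed
        finally show ?case by (simp add: algebra_simps)
      qed
      then have "((\<lambda>a. c a - j \<rho>) \<longlongrightarrow> 0) (at 0)"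
        using to0 by (rule Lim_null_comparison)
      then have "(c \<longlongrightarrow> j \<rho>) (at 0)" by (simp add: LIM_zero_iff)
      then show "((\<lambda>a. complex_of_real (c a)) \<longlongrightarrow> of_real (j \<rho>)) (at 0)" by (rule tendsto_of_real)
    qed
    then show "c 0 = j \<rho>" by simp
  qed
qed

theorem theorem4p3:
  fixes j :: "real \<Rightarrow> real" and \<sigma> \<rho> \<alpha> :: real and N :: nat
    and \<eta> :: "real \<Rightarrow> real \<Rightarrow> real" and c :: "real \<Rightarrow> real"
  assumes H1: "\<And>k. j (- k) = j k" "j 0 = 1"
    and H2: "\<sigma> \<ge> -1"
      "\<exists>C\<^sub>1>0. \<exists>C\<^sub>2>0. \<forall>\<^sub>F k in at_top. C\<^sub>1 * k powr \<sigma> \<le> j k \<and> j k \<le> C\<^sub>2 * k powr \<sigma>"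
    and H3: "\<And>(n::nat) k. n \<noteq> 1 \<Longrightarrow> k > 0 \<Longrightarrow> j (k * real n) - j k \<noteq> 0"
    and N: "N \<ge> 3" "odd N"
    and \<alpha>: "\<alpha> \<in> {-1, 1}"
    and \<rho>: "\<rho> > 0"
    and D: "D_invertible j \<rho>"
    and family: "small_amplitude_family j \<sigma> \<rho> N \<alpha> \<eta> c"
    and analytic: "analytic_at_origin (sobolev_exponent \<sigma>)
                     (\<lambda>a \<mu>. Q_op j \<rho> N \<alpha> (\<eta> a) (c a) \<mu>)"
    and Delta: "Delta_odd j \<rho> \<alpha> > 0"
  shows "small_waves_modulationally_unstable (sobolev_exponent \<sigma>)
           (\<lambda>a \<mu>. Q_op j \<rho> N \<alpha> (\<eta> a) (c a) \<mu>)"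
proof -
  define s where "s = sobolev_exponent \<sigma>"
  have s: "s \<ge> 1" by (simp add: s_def sobolev_exponent_def)
  have an: "analytic_at_origin s (\<lambda>a \<mu>. Q_op j \<rho> N \<alpha> (\<eta> a) (c a) \<mu>)"
    using analytic by (simp add: s_def)
  obtain q where Nq: "N = 2 * q + 1" using N(2) by (elim oddE)
  have q: "q \<ge> 1" using N(1) Nq by simp
  have \<alpha>2: "\<alpha>\<^sup>2 = 1" using \<alpha> by auto
  obtain \<delta> C where \<delta>: "0 < \<delta>" "\<delta> \<le> 1" and C: "C \<ge> 0"
    and cont: "\<And>a. \<bar>a\<bar> < \<delta> \<Longrightarrow> continuous_on UNIV (\<lambda>z. complex_of_real (\<eta> a z))"
    and \<eta>_le: "\<And>a z. 0 < \<bar>a\<bar> \<Longrightarrow> \<bar>a\<bar> < \<delta> \<Longrightarrow> \<bar>\<eta> a z ^ (2 * q) - a ^ (2 * q) * cos z ^ (2 * q)\<bar> \<le> C * \<bar>a\<bar> ^ (2 * q + 1)"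
    and c_le: "\<And>a. 0 < \<bar>a\<bar> \<Longrightarrow> \<bar>a\<bar> < \<delta> \<Longrightarrow> \<bar>c a - j \<rho> - a ^ (2 * q) * c_tau N \<alpha>\<bar> \<le> C * \<bar>a\<bar> ^ (2 * q + 1)"
    and \<eta>0: "\<And>z. \<eta> 0 z = 0" and c_0: "c 0 = j \<rho>"
    by (rule family_bounds[OF family q Nq]) blast
  \<comment> \<open>The potential disappears at a = 0 because the exponent N - 1 = 2 q is positive;
    with exponent 0 it would be 1.\<close>
  have Q0: "Q_op j \<rho> N \<alpha> (\<eta> 0) (c 0) \<mu> \<psi> n
      = \<i> * of_real (of_int n + \<mu>) * (of_real (j \<rho> - j (\<rho> * (of_int n + \<mu>))) * fourier_coeff \<psi> n)" for \<mu> \<psi> n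
    using q by (simp add: Q_op_def \<eta>0 c_0 Nq power_0_left fourier_coeff_def)
  obtain C\<^sub>Q r\<^sub>Q where CQ: "C\<^sub>Q \<ge> 0" "r\<^sub>Q > 0" and QL: "\<And>a \<mu> u. \<bar>a\<bar> < r\<^sub>Q \<Longrightarrow> \<bar>\<mu>\<bar> < r\<^sub>Q \<Longrightarrow>
       (\<lambda>n. Q_op j \<rho> N \<alpha> (\<eta> a) (c a) \<mu> (synth s u) n - Q_op j \<rho> N \<alpha> (\<eta> 0) (c 0) 0 (synth s u) n) \<in> L2_space \<and>
       L2_norm (\<lambda>n. Q_op j \<rho> N \<alpha> (\<eta> a) (c a) \<mu> (synth s u) n - Q_op j \<rho> N \<alpha> (\<eta> 0) (c 0) 0 (synth s u) n)
         \<le> C\<^sub>Q * (\<bar>a\<bar> + \<bar>\<mu>\<bar>) * norm u"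
    by (rule analytic_operator_bound[OF s an]) blast
  have Q00: "Q_op j \<rho> N \<alpha> (\<eta> 0) (c 0) 0 (synth s u) n
      = \<i> * of_int n * of_real (D_symbol j \<rho> n) * fourier_coeff (synth s u) n" for u n
    unfolding Q0 by (simp add: D_symbol_def)
  obtain g r\<^sub>E where rE: "r\<^sub>E > 0" and g: "\<And>\<mu>. \<bar>\<mu>\<bar> < r\<^sub>E \<Longrightarrow>
      (\<lambda>l. of_real (\<mu> ^ l) * g l) sums Q_op j \<rho> N \<alpha> (\<eta> 0) (c 0) \<mu> (\<lambda>z. 1 * cis (of_int 1 * z)) 1"
    by (rule analytic_matrix_entry_sums[OF an sobolev_trig[OF s, of 1 1], of 1]) blast
  have E_sums: "(\<lambda>l. Im (g l) * \<mu> ^ l) sums ((1 + \<mu>) * (j \<rho> - j (\<rho> * (1 + \<mu>))))" if "\<bar>\<mu>\<bar> < r\<^sub>E" for \<mu>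
  proof -
    have "Q_op j \<rho> N \<alpha> (\<eta> 0) (c 0) \<mu> (\<lambda>z. 1 * cis (of_int 1 * z)) 1
        = \<i> * of_real ((1 + \<mu>) * (j \<rho> - j (\<rho> * (1 + \<mu>))))"
      unfolding Q0 fourier_coeff_const_cis by simp
    then have "(\<lambda>l. Im (of_real (\<mu> ^ l) * g l)) sums Im (\<i> * of_real ((1 + \<mu>) * (j \<rho> - j (\<rho> * (1 + \<mu>)))))"
      using g[OF that] by (simp only: sums_complex_iff)
    moreover have "Im (of_real (\<mu> ^ l) * g l) = Im (g l) * \<mu> ^ l" for l
      by (simp del: of_real_power)
    ultimately show ?thesis by (simp only: Im_i_times Re_complex_of_real)
  qed
  obtain E where E_cont: "isCont E 0"
    and E_0: "E 0 = - (\<rho> * deriv j \<rho> + 1 / 2 * \<rho>\<^sup>2 * deriv (deriv j) \<rho>)"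
    and E: "\<And>\<mu>. \<bar>\<mu>\<bar> < r\<^sub>E \<Longrightarrow> (1 + \<mu>) * (j \<rho> - j (\<rho> * (1 + \<mu>))) = - \<rho> * deriv j \<rho> * \<mu> + \<mu>\<^sup>2 * E \<mu>"
    by (rule symbol_second_order[OF \<rho> rE E_sums]) (assumption, rule that)
  define \<Delta> where "\<Delta> = Delta_odd j \<rho> \<alpha>"
  have \<Delta>: "\<Delta> > 0" using Delta by (simp add: \<Delta>_def)
  have E0: "E 0 = \<alpha> * \<Delta>"
    using \<alpha> by (auto simp: E_0 \<Delta>_def Delta_odd_def)
  obtain C\<^sub>1 where "C\<^sub>1 > 0" "\<forall>\<^sub>F k in at_top. C\<^sub>1 * k powr \<sigma> \<le> j k"
    using H2(2) by (auto simp: eventually_conj_iff)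
  then obtain c\<^sub>0 where c0: "c\<^sub>0 > 0" and symb: "\<And>n. \<bar>n\<bar> \<ge> 2 \<Longrightarrow> c\<^sub>0 * wt s n \<le> \<bar>of_int n\<bar> * \<bar>D_symbol j \<rho> n\<bar>"
    using tail_symbol_bound[OF H1(1) \<rho> D] unfolding s_def by blast
  define w where "w = wt s 1"
  have w: "w > 0" by (simp add: w_def)
  define S where "S = real N * cos_second q"
  have S: "S > 0" using cos_second_pos[OF q] Nq by (simp add: S_def)
  define M where "M = 4 + \<bar>c_tau N \<alpha>\<bar> + real N * (cos_mean q + cos_second q)
    + 4 * real N * w * sup_const + 1 / c\<^sub>0 + \<bar>\<rho> * deriv j \<rho>\<bar>"
  have M: "M > 0"
    using w c0 sup_const_nonneg cos_mean_nonneg[of q] cos_second_pos[OF q]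
    by (simp add: M_def add_pos_nonneg)
  define C' where "C' = 2 * real N * w * sup_const"
  have C': "C' \<ge> 0" using w sup_const_nonneg by (simp add: C'_def)
  obtain r \<theta> \<epsilon>\<^sub>0 where r: "0 < r" "r \<le> S / 2" and \<theta>: "0 < \<theta>" "\<theta> \<le> 1" and \<epsilon>0: "\<epsilon>\<^sub>0 > 0"
    and const: "\<And>\<epsilon> g b. 0 \<le> \<epsilon> \<Longrightarrow> \<epsilon> \<le> \<epsilon>\<^sub>0 \<Longrightarrow> \<bar>g\<bar> \<le> \<epsilon> \<Longrightarrow> b\<^sup>2 \<le> \<epsilon> \<Longrightarrow>
       (\<epsilon> + C' * \<theta> + r) / S + (2 * (\<epsilon> + C' * \<theta>) + r) + (\<epsilon> + C' * \<theta> + 2 * r) / S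
        + ((\<bar>g\<bar> + b\<^sup>2 * (S + 2 * r)) / c\<^sub>0 + \<epsilon> / \<theta>) \<le> 1 / 2
       \<and> 4 * \<epsilon> / S + 4 * \<epsilon> + 2 * \<epsilon> / \<theta> \<le> r / 2"
    by (rule contraction_constants[OF S C' c0]) blast
  \<comment> \<open>Since \<open>E 0 = \<alpha> * \<Delta>\<close>, this solves
    \<open>\<kappa>\<^sub>0\<^sup>2 * E 0 = \<alpha> * S\<close>, the condition under which the
    diagonal of the leading block vanishes. Positivity of \<Delta> is what allows a real
    solution.\<close>
  define \<kappa>\<^sub>0 where "\<kappa>\<^sub>0 = sqrt (S / \<Delta>)"
  have \<kappa>0: "\<kappa>\<^sub>0 > 0" "\<kappa>\<^sub>0\<^sup>2 = S / \<Delta>" using S \<Delta> by (simp_all add: \<kappa>\<^sub>0_def)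
  have \<kappa>E: "\<kappa>\<^sub>0\<^sup>2 * E 0 = \<alpha> * S" using \<Delta> by (simp add: \<kappa>0 E0)

  show ?thesis
    unfolding small_waves_modulationally_unstable_def s_def[symmetric]
  proof (intro allI impI)
    fix \<epsilon> :: real assume \<epsilon>: "\<epsilon> > 0"
    \<comment> \<open>The second bound makes the contraction constants available; the third keeps
      the eigenvalue, of modulus at most e (M + 2 S), strictly below \<epsilon>.\<close>
    define e where "e = min (min 1 (\<epsilon>\<^sub>0 / M)) (\<epsilon> / (2 * (M + 2 * S)))"
    have e: "e > 0" "e \<le> 1" "e * M \<le> \<epsilon>\<^sub>0" "e * (M + 2 * S) < \<epsilon>"
    proof -
      show e0: "e > 0" using M S \<epsilon>0 \<epsilon> by (simp add: e_def)
      show "e \<le> 1" by (simp add: e_def)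
      have "e \<le> \<epsilon>\<^sub>0 / M" by (simp add: e_def)
      then show "e * M \<le> \<epsilon>\<^sub>0" using M by (simp add: field_simps)
      define y where "y = M + 2 * S"
      have y: "y > 0" using M S by (simp add: y_def)
      have "e \<le> \<epsilon> / (2 * y)" by (simp add: e_def y_def)
      then have "e * y \<le> \<epsilon> / (2 * y) * y" using y by (intro mult_right_mono) auto
      also have "\<dots> < \<epsilon>" using y \<epsilon> by simp
      finally show "e * (M + 2 * S) < \<epsilon>" by (simp add: y_def)
    qed
    \<comment> \<open>Because \<kappa>^2 will be at most
      \<open>4 * \<kappa>\<^sub>0\<^sup>2\<close>, the factor 8 lets the variation of
      \<open>E\<close> use up e/2. The other half is left for the variation of \<kappa>.\<close>
    obtain t where t: "t > 0" "\<And>x. \<bar>x\<bar> < t \<Longrightarrow> \<bar>E x - E 0\<bar> < e / (8 * \<kappa>\<^sub>0\<^sup>2)"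
    proof -
      have "e / (8 * \<kappa>\<^sub>0\<^sup>2) > 0" using e \<kappa>0(1) by simp
      then show ?thesis using E_cont that unfolding continuous_at_eps_delta by (metis diff_zero dist_real_def)
    qed
    define \<zeta> where "\<zeta> = min (3 * \<kappa>\<^sub>0\<^sup>2) (e / (2 * (\<bar>E 0\<bar> + 1)))"
    have \<zeta>: "\<zeta> > 0" "\<zeta> \<le> 3 * \<kappa>\<^sub>0\<^sup>2" "\<zeta> * \<bar>E 0\<bar> \<le> e / 2"
    proof -
      show "\<zeta> > 0" using \<kappa>0(1) e by (simp add: \<zeta>_def)
      show "\<zeta> \<le> 3 * \<kappa>\<^sub>0\<^sup>2" by (simp add: \<zeta>_def)
      have "\<zeta> * \<bar>E 0\<bar> \<le> e / (2 * (\<bar>E 0\<bar> + 1)) * (\<bar>E 0\<bar> + 1)"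
        using \<open>\<zeta> > 0\<close> e by (intro mult_mono) (auto simp: \<zeta>_def)
      also have "\<dots> = e / 2"
      proof -
        have "\<bar>E 0\<bar> + 1 \<noteq> 0" by linarith
        moreover have "e / (2 * y) * y = e / 2" if "y \<noteq> 0" for y :: real using that by simp
        ultimately show ?thesis by blast
      qed
      finally show "\<zeta> * \<bar>E 0\<bar> \<le> e / 2" .
    qed
    define \<kappa>\<^sub>1 where "\<kappa>\<^sub>1 = sqrt (\<kappa>\<^sub>0\<^sup>2 + \<zeta>)"
    have \<kappa>1: "\<kappa>\<^sub>0 < \<kappa>\<^sub>1"
      using \<zeta>(1) \<kappa>0(1) by (simp add: \<kappa>\<^sub>1_def real_less_rsqrt)
    have \<kappa>1sq: "\<kappa>\<^sub>1\<^sup>2 = \<kappa>\<^sub>0\<^sup>2 + \<zeta>" using \<zeta>(1) by (simp add: \<kappa>\<^sub>1_def)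
    have \<kappa>1_le: "\<kappa>\<^sub>1 \<le> 2 * \<kappa>\<^sub>0"
    proof (rule power2_le_imp_le)
      show "\<kappa>\<^sub>1\<^sup>2 \<le> (2 * \<kappa>\<^sub>0)\<^sup>2" using \<zeta>(2) by (simp add: \<kappa>1sq power_mult_distrib)
    qed (use \<kappa>0 in simp)
    have E_le: "\<bar>\<kappa>\<^sup>2 * E x - \<alpha> * S\<bar> \<le> e" if \<kappa>: "\<kappa>\<^sub>0 < \<kappa>" "\<kappa> < \<kappa>\<^sub>1" and x: "\<bar>x\<bar> < t" for \<kappa> x
    proof -
      have "\<kappa>\<^sup>2 \<le> \<kappa>\<^sub>1\<^sup>2" "\<kappa>\<^sub>0\<^sup>2 \<le> \<kappa>\<^sup>2" using \<kappa> \<kappa>0(1) by (auto intro: power_mono)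
      then have k: "\<bar>\<kappa>\<^sup>2 - \<kappa>\<^sub>0\<^sup>2\<bar> \<le> \<zeta>" "\<kappa>\<^sup>2 \<le> 4 * \<kappa>\<^sub>0\<^sup>2" using \<kappa>1sq \<zeta>(2) by auto
      have "\<kappa>\<^sup>2 * E x - \<alpha> * S = \<kappa>\<^sup>2 * (E x - E 0) + (\<kappa>\<^sup>2 - \<kappa>\<^sub>0\<^sup>2) * E 0"
        unfolding \<kappa>E[symmetric] by (simp add: algebra_simps)
      also have "\<bar>\<dots>\<bar> \<le> 4 * \<kappa>\<^sub>0\<^sup>2 * (e / (8 * \<kappa>\<^sub>0\<^sup>2)) + \<zeta> * \<bar>E 0\<bar>"
      proof (intro order_trans[OF abs_triangle_ineq] add_mono)
        show "\<bar>\<kappa>\<^sup>2 * (E x - E 0)\<bar> \<le> 4 * \<kappa>\<^sub>0\<^sup>2 * (e / (8 * \<kappa>\<^sub>0\<^sup>2))"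
          unfolding abs_mult abs_power2 using k less_imp_le[OF t(2)[OF x]]
          by (intro mult_mono abs_ge_zero) simp_all
        show "\<bar>(\<kappa>\<^sup>2 - \<kappa>\<^sub>0\<^sup>2) * E 0\<bar> \<le> \<zeta> * \<bar>E 0\<bar>"
          unfolding abs_mult using k by (intro mult_right_mono) auto
      qed
      also have "4 * \<kappa>\<^sub>0\<^sup>2 * (e / (8 * \<kappa>\<^sub>0\<^sup>2)) = e / 2" using \<kappa>0(1) by simp
      finally show ?thesis using \<zeta>(3) by simp
    qed
    \<comment> \<open>\<open>L\<close> dominates all factors multiplying |a| in the conditions
      below, so that |a| < \<xi> / L meets them all at once.\<close>
    define L where "L = 1 + 2 * \<kappa>\<^sub>0 + C + C\<^sub>Q * (1 + 2 * \<kappa>\<^sub>0)"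
    have L: "L \<ge> 1" "2 * \<kappa>\<^sub>0 \<le> L" "C \<le> L" "C\<^sub>Q * (1 + 2 * \<kappa>\<^sub>0) \<le> L"
      using \<kappa>0(1) C CQ(1) by (simp_all add: L_def)
    define \<xi> where "\<xi> = Min {e, t, r\<^sub>E, r\<^sub>Q, \<delta>, 1 / 2, \<epsilon>}"
    have \<xi>: "\<xi> > 0" "\<xi> \<le> e" "\<xi> \<le> t" "\<xi> \<le> r\<^sub>E" "\<xi> \<le> r\<^sub>Q" "\<xi> \<le> \<delta>" "\<xi> \<le> 1 / 2" "\<xi> \<le> \<epsilon>"
    proof -
      show "\<xi> > 0" using e(1) t(1) rE CQ(2) \<delta>(1) \<epsilon> by (simp add: \<xi>_def)
    qed (unfold \<xi>_def, (rule Min_le; simp)+)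
    show "\<exists>a\<^sub>0>0. \<forall>a. 0 < \<bar>a\<bar> \<and> \<bar>a\<bar> < a\<^sub>0 \<longrightarrow>
        modulationally_unstable_within s \<epsilon> (Q_op j \<rho> N \<alpha> (\<eta> a) (c a))"
    proof (intro exI[of _ "\<xi> / L"] conjI allI impI)
      show "\<xi> / L > 0" using \<xi>(1) L(1) by simp
      fix a :: real assume a: "0 < \<bar>a\<bar> \<and> \<bar>a\<bar> < \<xi> / L"
      then have La: "L * \<bar>a\<bar> < \<xi>" using L(1) by (simp add: field_simps)
      have small: "K * \<bar>a\<bar> < \<xi>" if "K \<le> L" for K
        using mult_right_mono[OF that, of "\<bar>a\<bar>"] La by simp
      have a1: "\<bar>a\<bar> < \<xi>" using small[OF L(1)] by simp
      \<comment> \<open>With N - 1 = 2 q the square of \<open>b\<close> is exactly a^(N - 1), also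
        for negative a; \<open>q \<ge> 1\<close> and |a| < 1 give
        \<open>b \<le> \<bar>a\<bar>\<close>.\<close>
      define b where "b = \<bar>a\<bar> ^ q"
      have b: "b > 0" using a by (simp add: b_def)
      have b2: "b\<^sup>2 = a ^ (2 * q)" by (simp add: b_def power_mult[symmetric] mult.commute power_even_abs)
      have ba: "b \<le> \<bar>a\<bar>" "b\<^sup>2 \<le> \<bar>a\<bar>"
      proof -
        have "\<bar>a\<bar> ^ q \<le> \<bar>a\<bar> ^ 1" "\<bar>a\<bar> ^ (2 * q) \<le> \<bar>a\<bar> ^ 1"
          using a1 \<xi>(7) q by (intro power_decreasing; simp)+
        then show "b \<le> \<bar>a\<bar>" "b\<^sup>2 \<le> \<bar>a\<bar>" by (simp_all add: b_def power_mult[symmetric] mult.commute)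
      qed
      have Ca: "C * \<bar>a\<bar> ^ (2 * q + 1) \<le> b\<^sup>2 * e"
      proof -
        have "b\<^sup>2 * (C * \<bar>a\<bar>) \<le> b\<^sup>2 * e" using small[OF L(3)] \<xi>(2) by (intro mult_left_mono) auto
        then show ?thesis by (simp add: b_def power_mult[symmetric] mult_ac)
      qed
      have \<mu>_le: "\<bar>\<kappa> * b\<bar> < \<xi>" "\<bar>\<kappa> * b\<bar> \<le> 2 * \<kappa>\<^sub>0 * \<bar>a\<bar>" if "\<kappa>\<^sub>0 < \<kappa>" "\<kappa> < \<kappa>\<^sub>1" for \<kappa>
      proof -
        show "\<bar>\<kappa> * b\<bar> \<le> 2 * \<kappa>\<^sub>0 * \<bar>a\<bar>"
          unfolding abs_mult using that \<kappa>0(1) \<kappa>1_le ba b by (intro mult_mono) auto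
        then show "\<bar>\<kappa> * b\<bar> < \<xi>" using small[OF L(2)] by simp
      qed
      have unstable: "\<exists>\<nu>. is_eigenvalue s (Q_op j \<rho> N \<alpha> (\<eta> a) (c a) \<mu>) \<nu> \<and> cmod \<nu> < \<epsilon> \<and> Re \<nu> > 0"
        if \<kappa>: "\<kappa>\<^sub>0 < \<kappa>" "\<kappa> < \<kappa>\<^sub>1" and \<mu>: "\<mu> = \<kappa> * b" for \<kappa> \<mu>
      proof -
        have \<mu>1: "\<bar>\<mu>\<bar> < \<xi>" "\<bar>\<mu>\<bar> \<le> 2 * \<kappa>\<^sub>0 * \<bar>a\<bar>" using \<mu>_le[OF \<kappa>] \<mu> by auto
        have Ra: "C\<^sub>Q * (\<bar>a\<bar> + \<bar>\<mu>\<bar>) \<le> e"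
        proof -
          have "C\<^sub>Q * (\<bar>a\<bar> + \<bar>\<mu>\<bar>) \<le> C\<^sub>Q * (\<bar>a\<bar> + 2 * \<kappa>\<^sub>0 * \<bar>a\<bar>)"
            using \<mu>1 CQ(1) by (intro mult_left_mono) auto
          also have "\<dots> = C\<^sub>Q * (1 + 2 * \<kappa>\<^sub>0) * \<bar>a\<bar>" by (simp add: algebra_simps)
          finally show ?thesis using small[OF L(4)] \<xi>(2) by simp
        qed
        have R: "(\<lambda>n. Q_op j \<rho> N \<alpha> (\<eta> a) (c a) \<mu> (synth s u) n
            - \<i> * of_int n * of_real (D_symbol j \<rho> n) * fourier_coeff (synth s u) n) \<in> L2_space"
          "L2_norm (\<lambda>n. Q_op j \<rho> N \<alpha> (\<eta> a) (c a) \<mu> (synth s u) n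
            - \<i> * of_int n * of_real (D_symbol j \<rho> n) * fourier_coeff (synth s u) n) \<le> e * norm u" for u
          using QL[of a \<mu> u] a1 \<mu>1 \<xi>(5) mult_right_mono[OF Ra, of "norm u"] unfolding Q00 by auto
        obtain \<nu> where "is_eigenvalue s (Q_op j \<rho> N \<alpha> (\<eta> a) (c a) \<mu>) \<nu>" "Re \<nu> > 0" "cmod \<nu> \<le> e * M + 2 * e * S"
        proof (rule unstable_eigenvalue[where j = j and s = s and q = q and N = N and \<alpha> = \<alpha> and \<eta> = "\<eta> a"
              and c = "c a" and \<rho> = \<rho> and \<mu> = \<mu> and b = b and \<kappa> = \<kappa> and e = e and E = E
              and dj = "deriv j \<rho>" and c\<^sub>0 = c\<^sub>0 and r = r and \<theta> = \<theta>,
              folded w_def S_def, folded M_def C'_def, OF s q Nq \<alpha>2 H1(1) _ b _ e(2) \<mu>])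
          show "continuous_on UNIV (\<lambda>z. complex_of_real (\<eta> a z))" using a1 \<xi>(6) by (intro cont) auto
          show "b\<^sup>2 \<le> e" "\<bar>\<mu>\<bar> \<le> e" using ba a1 \<mu>1 \<xi>(2) by auto
          show "\<bar>\<eta> a z ^ (2 * q) - b\<^sup>2 * cos z ^ (2 * q)\<bar> \<le> b\<^sup>2 * e" for z
            using \<eta>_le[of a z] Ca a a1 \<xi>(6) unfolding b2 by linarith
          show "\<bar>c a - j \<rho> - b\<^sup>2 * c_tau N \<alpha>\<bar> \<le> b\<^sup>2 * e"
            using c_le[of a] Ca a a1 \<xi>(6) unfolding b2 by linarith
          show "(1 + x) * (j \<rho> - j (\<rho> * (1 + x))) = - \<rho> * deriv j \<rho> * x + x\<^sup>2 * E x" if "\<bar>x\<bar> \<le> \<bar>\<mu>\<bar>" for x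
            using that \<mu>1 \<xi>(4) by (intro E) auto
          show "\<bar>\<kappa>\<^sup>2 * E x - \<alpha> * S\<bar> \<le> e" if "\<bar>x\<bar> \<le> \<bar>\<mu>\<bar>" for x
            using that \<mu>1 \<xi>(3) by (intro E_le \<kappa>) auto
          fix g b :: real assume "\<bar>g\<bar> \<le> e * M" "b\<^sup>2 \<le> e * M"
          then show "(e * M + C' * \<theta> + r) / S + (2 * (e * M + C' * \<theta>) + r) + (e * M + C' * \<theta> + 2 * r) / S
              + ((\<bar>g\<bar> + b\<^sup>2 * (S + 2 * r)) / c\<^sub>0 + e * M / \<theta>) \<le> 1 / 2
             \<and> 4 * (e * M) / S + 4 * (e * M) + 2 * (e * M) / \<theta> \<le> r / 2"
            using e M by (intro const) auto
        qed (use R c0 symb r \<theta> in auto)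
        moreover have "e * M + 2 * e * S < \<epsilon>" using e(4) by (simp add: algebra_simps)
        ultimately show ?thesis by force
      qed
      show "modulationally_unstable_within s \<epsilon> (Q_op j \<rho> N \<alpha> (\<eta> a) (c a))"
        unfolding modulationally_unstable_within_def
      proof (rule exI[of _ "\<kappa>\<^sub>0 * b"], rule exI[of _ "\<kappa>\<^sub>1 * b"], intro conjI ballI)
        show "\<kappa>\<^sub>0 * b < \<kappa>\<^sub>1 * b" using \<kappa>1 b by simp
        have *: "\<kappa>\<^sub>0 < \<mu> / b" "\<mu> / b < \<kappa>\<^sub>1" "\<mu> = \<mu> / b * b" if "\<mu> \<in> {\<kappa>\<^sub>0 * b<..<\<kappa>\<^sub>1 * b}" for \<mu>
          using that b by (auto simp: field_simps)
        show "{\<kappa>\<^sub>0 * b<..<\<kappa>\<^sub>1 * b} \<subseteq> {- 1 / 2<..1 / 2} \<inter> {- \<epsilon><..<\<epsilon>}"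
        proof
          fix \<mu> assume \<mu>: "\<mu> \<in> {\<kappa>\<^sub>0 * b<..<\<kappa>\<^sub>1 * b}"
          then have "\<bar>\<mu>\<bar> < \<xi>" using \<mu>_le(1)[OF *(1,2)[OF \<mu>]] *(3)[OF \<mu>] by simp
          then show "\<mu> \<in> {- 1 / 2<..1 / 2} \<inter> {- \<epsilon><..<\<epsilon>}" using \<xi>(7,8) by auto
        qed
        show "\<exists>\<nu>. is_eigenvalue s (Q_op j \<rho> N \<alpha> (\<eta> a) (c a) \<mu>) \<nu> \<and> cmod \<nu> < \<epsilon> \<and> Re \<nu> > 0"
          if "\<mu> \<in> {\<kappa>\<^sub>0 * b<..<\<kappa>\<^sub>1 * b}" for \<mu>
          using unstable[OF *[OF that]] .
      qed
    qed
  qed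
qed

end
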